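(* Let $R$ be an $F$-finite Noetherian ring with $p$-generating set $x=x_1,\dots,x_n$. Let $W\subseteq R$ be a multiplicative set and $V\subseteq G(R;x)$ a multiplicative subset surjecting onto $W$ by $\pi_\infty:G(R;x)\to R$. Let $J=\ker\pi_\infty$, and write $\frac{x}{1}$ for the induced $p$-generating set of $W^{-1}R$. Then there is a canonical isomorphism $$G\big(W^{-1}R;\tfrac{x}{1}\big)\cong\big(V^{-1}G(R;x)\big)^{\wedge_{V^{-1}J}},$$ where the right-hand side is the completion along $V^{-1}J$.
   Context: Fix a prime $p$; rings are commutative of characteristic $p$. $R^p\subseteq R$ is the image of Frobenius; $R$ is $F$-finite if Frobenius is finite. A finite tuple $x$ in $R$ is a $p$-generating set if $R=R^p[x_1,\dots,x_n]$. Gabber's construction: given an $F$-finite Noetherian ring $R$ with $p$-generating set $x$, put $R_0=R$, $x^{(0)}=x$, and inductively $R_{i}=R_{i-1}[X_1,\dots,X_n]/(X_j^p-x_j^{(i-1)})_{j}$ with $x_j^{(i)}$ the class of $X_j$, and $\phi:R_i\to R_{i-1}$ the surjection with $r\mapsto r^p$ for $r\in R_{i-1}$ and $X_j\mapsto x_j^{(i-1)}$. Then $G(R;x):=\varprojlim_\phi R_i$, and $\pi_\infty:G(R;x)\to R_0=R$ is the projection, which is surjective. *)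

theory Defs
  imports
    "HOL-Algebra.Algebra"
    "HOL-Algebra.Indexed_Polynomials"
    "HOL-Computational_Algebra.Primes"
begin

text \<open>A ring of characteristic \<open>p\<close> is a commutative ring with \<open>p \<cdot> 1 = 0\<close>, i.e. an
  \<open>F\<^sub>p\<close>-algebra; the zero ring is allowed, so that the class is closed under localization.\<close>

definition F_finite :: "nat \<Rightarrow> ('a, 'b) ring_scheme \<Rightarrow> bool" where
  "F_finite p R \<longleftrightarrow>
     (\<exists>S. finite S \<and> S \<subseteq> carrier R \<and>
        (\<forall>r\<in>carrier R. \<exists>c\<in>S \<rightarrow> carrier R. r = (\<Oplus>\<^bsub>R\<^esub>s\<in>S. (c s [^]\<^bsub>R\<^esub> p) \<otimes>\<^bsub>R\<^esub> s)))"

definition p_generating :: "nat \<Rightarrow> ('a, 'b) ring_scheme \<Rightarrow> 'a list \<Rightarrow> bool" where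
  "p_generating p R xs \<longleftrightarrow>
     set xs \<subseteq> carrier R \<and>
     generate_ring R ((\<lambda>r. r [^]\<^bsub>R\<^esub> p) ` carrier R \<union> set xs) = carrier R"


section \<open>Polynomial rings in \<open>n\<close> variables\<close>

text \<open>Monomials are multisets over \<open>{..<n}\<close>; carrier, addition, constants and variables are
  those of \<^theory>\<open>HOL-Algebra.Indexed_Polynomials\<close>, which has no product of two polynomials.\<close>

definition mpoly_ring :: "('a, 'b) ring_scheme \<Rightarrow> nat \<Rightarrow> (nat multiset \<Rightarrow> 'a) ring" where
  "mpoly_ring S n =
     \<lparr>carrier = ring.indexed_pset S {..<n} (carrier S),
      monoid.mult = (\<lambda>f g m. \<Oplus>\<^bsub>S\<^esub>k\<in>{k. k \<subseteq># m}. f k \<otimes>\<^bsub>S\<^esub> g (m - k)),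
      monoid.one = ring.indexed_const S \<one>\<^bsub>S\<^esub>,
      ring.zero = ring.indexed_const S \<zero>\<^bsub>S\<^esub>,
      ring.add = ring.indexed_padd S\<rparr>"

text \<open>The value in \<open>T\<close> of \<open>f \<in> S[X\<^sub>0,\<dots>]\<close>, with \<open>h\<close> applied to coefficients and \<open>X\<^sub>j \<mapsto> zs ! j\<close>.\<close>

definition mpoly_eval ::
  "('a, 'b) ring_scheme \<Rightarrow> ('c, 'd) ring_scheme \<Rightarrow> ('a \<Rightarrow> 'c) \<Rightarrow> 'c list \<Rightarrow>
    (nat multiset \<Rightarrow> 'a) \<Rightarrow> 'c" where
  "mpoly_eval S T h zs f =
     (\<Oplus>\<^bsub>T\<^esub>m\<in>{m. f m \<noteq> \<zero>\<^bsub>S\<^esub>}.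
        h (f m) \<otimes>\<^bsub>T\<^esub> (\<Otimes>\<^bsub>T\<^esub>j\<in>{..<length zs}. (zs ! j) [^]\<^bsub>T\<^esub> count m j))"


section \<open>Adjoining \<open>p\<close>-th roots\<close>

text \<open>In the literal iterated construction \<open>R\<^sub>i = R\<^sub>i\<^sub>-\<^sub>1[X]/(X\<^sub>j\<^sup>p - x\<^sub>j)\<close> the type of
  elements would change with \<open>i\<close>. To keep all \<open>R\<^sub>i\<close> in one type, the genuine quotient ring is
  formed at each step and its elements are then renamed along the injection that sends a coset to
  \<open>Rep f\<close> for a chosen polynomial \<open>f\<close> in it.\<close>

datatype 'a tower = Base 'a | Rep "nat multiset \<Rightarrow> 'a tower"

primrec base_val :: "'a tower \<Rightarrow> 'a" where
  "base_val (Base r) = r"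
| "base_val (Rep f) = undefined"

primrec poly_rep :: "'a tower \<Rightarrow> nat multiset \<Rightarrow> 'a tower" where
  "poly_rep (Base r) = undefined"
| "poly_rep (Rep f) = f"

definition rename_coset :: "(nat multiset \<Rightarrow> 'a tower) set \<Rightarrow> 'a tower" where
  "rename_coset C = Rep (SOME f. f \<in> C)"

definition root_ideal ::
  "nat \<Rightarrow> ('a, 'b) ring_scheme \<Rightarrow> 'a list \<Rightarrow> (nat multiset \<Rightarrow> 'a) set" where
  "root_ideal p S ys =
     (let P = mpoly_ring S (length ys) in
      Idl\<^bsub>P\<^esub> {ring.indexed_var S j [^]\<^bsub>P\<^esub> p \<ominus>\<^bsub>P\<^esub> ring.indexed_const S (ys ! j) | j. j < length ys})"

definition adjoin_roots ::
  "nat \<Rightarrow> ('a tower, 'b) ring_scheme \<Rightarrow> 'a tower list \<Rightarrow> 'a tower ring" where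
  "adjoin_roots p S ys =
     image_ring rename_coset (mpoly_ring S (length ys) Quot root_ideal p S ys)"

definition poly_class ::
  "nat \<Rightarrow> ('a tower, 'b) ring_scheme \<Rightarrow> 'a tower list \<Rightarrow> (nat multiset \<Rightarrow> 'a tower) \<Rightarrow> 'a tower" where
  "poly_class p S ys f =
     rename_coset (root_ideal p S ys +>\<^bsub>mpoly_ring S (length ys)\<^esub> f)"

text \<open>The map \<open>S[X]/(X\<^sub>j\<^sup>p - y\<^sub>j) \<rightarrow> T\<close> induced by a homomorphism \<open>h : S \<rightarrow> T\<close> and
  \<open>X\<^sub>j \<mapsto> zs ! j\<close>, where \<open>h(y\<^sub>j) = (zs ! j)\<^sup>p\<close>: evaluate any representative.\<close>

definition adjoin_lift ::
  "('a tower, 'b) ring_scheme \<Rightarrow> ('c, 'd) ring_scheme \<Rightarrow> ('a tower \<Rightarrow> 'c) \<Rightarrow> 'c list \<Rightarrow>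
    'a tower \<Rightarrow> 'c" where
  "adjoin_lift S T h zs t = mpoly_eval S T h zs (poly_rep t)"


section \<open>Inverse limits\<close>

text \<open>Limit of \<open>\<cdots> \<rightarrow> A 2 \<rightarrow> A 1 \<rightarrow> A 0\<close> with transition maps \<open>f i : A (i+1) \<rightarrow> A i\<close>.\<close>

definition inv_lim ::
  "(nat \<Rightarrow> ('a, 'b) ring_scheme) \<Rightarrow> (nat \<Rightarrow> 'a \<Rightarrow> 'a) \<Rightarrow> (nat \<Rightarrow> 'a) ring" where
  "inv_lim A f =
     \<lparr>carrier = {a. \<forall>i. a i \<in> carrier (A i) \<and> f i (a (Suc i)) = a i},
      monoid.mult = (\<lambda>a b i. a i \<otimes>\<^bsub>A i\<^esub> b i),
      monoid.one = (\<lambda>i. \<one>\<^bsub>A i\<^esub>),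
      ring.zero = (\<lambda>i. \<zero>\<^bsub>A i\<^esub>),
      ring.add = (\<lambda>a b i. a i \<oplus>\<^bsub>A i\<^esub> b i)\<rparr>"


section \<open>Gabber's construction\<close>

primrec gabber_stage ::
  "nat \<Rightarrow> ('a, 'b) ring_scheme \<Rightarrow> 'a list \<Rightarrow> nat \<Rightarrow> 'a tower ring \<times> 'a tower list" where
  "gabber_stage p R xs 0 = (image_ring Base R, map Base xs)"
| "gabber_stage p R xs (Suc i) =
     (let (S, ys) = gabber_stage p R xs i in
      (adjoin_roots p S ys,
       map (\<lambda>j. poly_class p S ys (ring.indexed_var S j)) [0..<length ys]))"

definition gabber_ring :: "nat \<Rightarrow> ('a, 'b) ring_scheme \<Rightarrow> 'a list \<Rightarrow> nat \<Rightarrow> 'a tower ring" where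
  "gabber_ring p R xs i = fst (gabber_stage p R xs i)"

definition gabber_gens :: "nat \<Rightarrow> ('a, 'b) ring_scheme \<Rightarrow> 'a list \<Rightarrow> nat \<Rightarrow> 'a tower list" where
  "gabber_gens p R xs i = snd (gabber_stage p R xs i)"

definition gabber_const ::
  "nat \<Rightarrow> ('a, 'b) ring_scheme \<Rightarrow> 'a list \<Rightarrow> nat \<Rightarrow> 'a tower \<Rightarrow> 'a tower" where
  "gabber_const p R xs i r =
     poly_class p (gabber_ring p R xs i) (gabber_gens p R xs i)
       (ring.indexed_const (gabber_ring p R xs i) r)"

text \<open>\<open>\<phi> : R\<^sub>i\<^sub>+\<^sub>1 \<rightarrow> R\<^sub>i\<close> with \<open>r \<mapsto> r\<^sup>p\<close> on \<open>R\<^sub>i\<close> and \<open>X\<^sub>j \<mapsto> x\<^sub>j\<close>.\<close>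

definition gabber_phi ::
  "nat \<Rightarrow> ('a, 'b) ring_scheme \<Rightarrow> 'a list \<Rightarrow> nat \<Rightarrow> 'a tower \<Rightarrow> 'a tower" where
  "gabber_phi p R xs i =
     adjoin_lift (gabber_ring p R xs i) (gabber_ring p R xs i)
       (\<lambda>r. r [^]\<^bsub>gabber_ring p R xs i\<^esub> p) (gabber_gens p R xs i)"

definition gabber :: "nat \<Rightarrow> ('a, 'b) ring_scheme \<Rightarrow> 'a list \<Rightarrow> (nat \<Rightarrow> 'a tower) ring" where
  "gabber p R xs = inv_lim (gabber_ring p R xs) (gabber_phi p R xs)"

definition gabber_proj :: "(nat \<Rightarrow> 'a tower) \<Rightarrow> 'a" where
  "gabber_proj g = base_val (g 0)"

text \<open>The functoriality of the construction: for \<open>h : R \<rightarrow> R'\<close>, the induced maps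
  \<open>R\<^sub>i \<rightarrow> R'\<^sub>i\<close> (extending the previous one and sending \<open>X\<^sub>j\<close> to \<open>X\<^sub>j\<close>), and in the limit
  \<open>G(R; xs) \<rightarrow> G(R'; h(xs))\<close>.\<close>

primrec gabber_stage_map ::
  "nat \<Rightarrow> ('a, 'b) ring_scheme \<Rightarrow> 'a list \<Rightarrow> ('c, 'd) ring_scheme \<Rightarrow> ('a \<Rightarrow> 'c) \<Rightarrow> nat \<Rightarrow>
    'a tower \<Rightarrow> 'c tower" where
  "gabber_stage_map p R xs R' h 0 = (\<lambda>t. Base (h (base_val t)))"
| "gabber_stage_map p R xs R' h (Suc i) =
     adjoin_lift (gabber_ring p R xs i) (gabber_ring p R' (map h xs) (Suc i))
       (\<lambda>r. gabber_const p R' (map h xs) i (gabber_stage_map p R xs R' h i r))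
       (gabber_gens p R' (map h xs) (Suc i))"

definition gabber_map ::
  "nat \<Rightarrow> ('a, 'b) ring_scheme \<Rightarrow> 'a list \<Rightarrow> ('c, 'd) ring_scheme \<Rightarrow> ('a \<Rightarrow> 'c) \<Rightarrow>
    (nat \<Rightarrow> 'a tower) \<Rightarrow> nat \<Rightarrow> 'c tower" where
  "gabber_map p R xs R' h g = (\<lambda>i. gabber_stage_map p R xs R' h i (g i))"


section \<open>Localization\<close>

definition frac_rel :: "('a, 'b) ring_scheme \<Rightarrow> 'a set \<Rightarrow> (('a \<times> 'a) \<times> ('a \<times> 'a)) set" where
  "frac_rel A S =
     {((a, s), (b, t)). a \<in> carrier A \<and> s \<in> S \<and> b \<in> carrier A \<and> t \<in> S \<and>
        (\<exists>u\<in>S. u \<otimes>\<^bsub>A\<^esub> (a \<otimes>\<^bsub>A\<^esub> t) = u \<otimes>\<^bsub>A\<^esub> (b \<otimes>\<^bsub>A\<^esub> s))}"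

definition frac :: "('a, 'b) ring_scheme \<Rightarrow> 'a set \<Rightarrow> 'a \<Rightarrow> 'a \<Rightarrow> ('a \<times> 'a) set" where
  "frac A S a s = frac_rel A S `` {(a, s)}"

definition localization :: "('a, 'b) ring_scheme \<Rightarrow> 'a set \<Rightarrow> ('a \<times> 'a) set ring" where
  "localization A S =
     \<lparr>carrier = (carrier A \<times> S) // frac_rel A S,
      monoid.mult = (\<lambda>x y. (\<Union>(a, s)\<in>x. \<Union>(b, t)\<in>y. frac A S (a \<otimes>\<^bsub>A\<^esub> b) (s \<otimes>\<^bsub>A\<^esub> t))),
      monoid.one = frac A S \<one>\<^bsub>A\<^esub> \<one>\<^bsub>A\<^esub>,
      ring.zero = frac A S \<zero>\<^bsub>A\<^esub> \<one>\<^bsub>A\<^esub>,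
      ring.add = (\<lambda>x y. (\<Union>(a, s)\<in>x. \<Union>(b, t)\<in>y.
               frac A S (a \<otimes>\<^bsub>A\<^esub> t \<oplus>\<^bsub>A\<^esub> b \<otimes>\<^bsub>A\<^esub> s) (s \<otimes>\<^bsub>A\<^esub> t)))\<rparr>"

definition loc_map :: "('a, 'b) ring_scheme \<Rightarrow> 'a set \<Rightarrow> 'a \<Rightarrow> ('a \<times> 'a) set" where
  "loc_map A S a = frac A S a \<one>\<^bsub>A\<^esub>"

definition loc_ideal :: "('a, 'b) ring_scheme \<Rightarrow> 'a set \<Rightarrow> 'a set \<Rightarrow> ('a \<times> 'a) set set" where
  "loc_ideal A S J = {frac A S j s | j s. j \<in> J \<and> s \<in> S}"


section \<open>Completion along an ideal\<close>

text \<open>Powers of ideals are taken in \<^const>\<open>ideals_set\<close>; the transition map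
  \<open>A/I\<^sup>m\<^sup>+\<^sup>1 \<rightarrow> A/I\<^sup>m\<close> sends a coset \<open>C\<close> to \<open>I\<^sup>m + C\<close>.\<close>

definition completion :: "('a, 'b) ring_scheme \<Rightarrow> 'a set \<Rightarrow> (nat \<Rightarrow> 'a set) ring" where
  "completion A I =
     inv_lim (\<lambda>m::nat. A Quot (I [^]\<^bsub>ideals_set A\<^esub> m))
       (\<lambda>m C. (I [^]\<^bsub>ideals_set A\<^esub> m) <+>\<^bsub>A\<^esub> C)"

definition completion_map :: "('a, 'b) ring_scheme \<Rightarrow> 'a set \<Rightarrow> 'a \<Rightarrow> nat \<Rightarrow> 'a set" where
  "completion_map A I a = (\<lambda>m::nat. (I [^]\<^bsub>ideals_set A\<^esub> m) +>\<^bsub>A\<^esub> a)"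


section \<open>The canonical isomorphism\<close>

text \<open>\<open>\<Psi>\<close> is an isomorphism from the \<open>V\<^sup>-\<^sup>1J\<close>-adic completion of \<open>V\<^sup>-\<^sup>1G(R; xs)\<close> to
  \<open>G(W\<^sup>-\<^sup>1R; xs/1)\<close> that is compatible with the natural maps from \<open>G(R; xs)\<close> to both sides
  and continuous for the inverse limit topologies (with discrete stages). Since the fractions
  \<open>g/v\<close> are dense in the completion and the target is Hausdorff, these conditions determine
  \<open>\<Psi>\<close>.\<close>

definition canonical_gabber_iso ::
  "nat \<Rightarrow> ('a, 'b) ring_scheme \<Rightarrow> 'a list \<Rightarrow> 'a set \<Rightarrow> (nat \<Rightarrow> 'a tower) set \<Rightarrow>
    ((nat \<Rightarrow> ((nat \<Rightarrow> 'a tower) \<times> (nat \<Rightarrow> 'a tower)) set set) \<Rightarrow>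
     (nat \<Rightarrow> ('a \<times> 'a) set tower)) \<Rightarrow> bool" where
  "canonical_gabber_iso p R xs W V \<Psi> \<longleftrightarrow>
     (let G = gabber p R xs;
          J = a_kernel G R gabber_proj;
          A = localization G V;
          I = loc_ideal G V J;
          R' = localization R W;
          xs' = map (loc_map R W) xs
      in \<Psi> \<in> ring_iso (completion A I) (gabber p R' xs') \<and>
         (\<forall>g\<in>carrier G.
            \<Psi> (completion_map A I (loc_map G V g)) = gabber_map p R xs R' (loc_map R W) g) \<and>
         (\<forall>i. \<exists>m. \<forall>a\<in>carrier (completion A I).
            a m = \<zero>\<^bsub>A Quot (I [^]\<^bsub>ideals_set A\<^esub> m)\<^esub> \<longrightarrow> \<Psi> a i = \<zero>\<^bsub>gabber_ring p R' xs' i\<^esub>))"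

end

theory Submission
  imports Defs
begin

text \<open>Write \<open>R\<^sub>i\<close> for the tower, \<open>c : R\<^sub>i \<rightarrow> R\<^sub>i\<^sub>+\<^sub>1\<close> for the structure map and \<open>J\<^sub>i\<close> for the kernel of \<open>G \<rightarrow> R\<^sub>i\<close>.
  Both composites of \<open>c\<close> and \<open>\<phi>\<close> are Frobenius maps, and \<open>ker \<phi>\<^sub>i\<^sub>+\<^sub>1\<close> is generated by
  \<open>c(ker \<phi>\<^sub>i)\<close>; hence \<open>J\<^sub>i\<close> is generated modulo \<open>J\<^sub>i\<^sub>+\<^sub>1\<close> by the \<open>p\<^sup>i\<close>-th powers of elements of
  \<open>J = J\<^sub>0\<close>. As \<open>R\<^sub>1\<close> is finite over the Noetherian ring \<open>R\<close>, finitely many \<open>f\<close> in \<open>J\<close> suffice, and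
  completeness of \<open>G\<close> gives \<open>J\<^sub>i = (f\<^bsup>p^i\<^esup>)\<close> on the nose. So the \<open>J\<^sub>i\<close> define the \<open>J\<close>-adic
  topology, and this persists in \<open>V\<^sup>-\<^sup>1G\<close>.

  On the other side, \<open>R\<^sub>i \<rightarrow> R'\<^sub>i\<close> is the localization at \<open>W\<close>, and an element \<open>v\<close> of \<open>V\<close> satisfies
  \<open>v\<^sub>i\<^bsup>p^i\<^esup> = w\<close> in \<open>R\<^sub>i\<close>, where \<open>w\<close> is its image in \<open>W\<close>. Hence \<open>V\<^sup>-\<^sup>1G \<rightarrow> R'\<^sub>i\<close> is well defined and
  surjective with kernel \<open>V\<^sup>-\<^sup>1J\<^sub>i\<close>, and passing to the limit gives the isomorphism.

  Flatness of the tower is never used: its consequences are derived from the universal property of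
  adjoining roots.\<close>

section \<open>Rings of characteristic \<open>p\<close>\<close>

text \<open>The obstacle is that \<open>V\<^sup>-\<^sup>1G\<close> need not be complete: a
  description of J_i that held only up to closure would not carry over to it. Exact finite
  combinations are therefore produced inside \<open>G\<close>, where successive approximations still
  converge, and only then localized. Finiteness enters twice. It yields the generators f, and it
  bounds adic powers from the other side: if q-th powers of finitely many generators lie in an
  ideal, so does a large enough power of the ideal they generate. With q = p^i this puts a power of
  J into J_i, while J_i lies in J^(p^i) and so in J^i. All exponents p^i have one source: for g in
  \<open>G\<close>, the p-th power of coordinate i+1 is the image under \<open>c\<close> of
  coordinate i. Iterating, coordinate i to the p^i depends on g only through its projection to
  \<open>R\<close>. For g in J this gives nilpotent coordinates; for g in V it makes the coordinates
  units once W is inverted. The passage to limits is isolated in a criterion about any surjections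
  \<open>\<sigma> i\<close> with I^(m i) \<subseteq> ker \<open>\<sigma> i\<close> \<subseteq>
  I^i.\<close>

lemma (in cring) add_pow_assoc_mult:
  assumes "a \<in> carrier R"
  shows "[(n * (m::nat))] \<cdot>\<^bsub>R\<^esub> a = [(n::nat)] \<cdot>\<^bsub>R\<^esub> ([m] \<cdot>\<^bsub>R\<^esub> a)"
  using assms by (metis add.nat_pow_pow mult.commute)

lemma (in cring) binomial:
  assumes x: "x \<in> carrier R" and y: "y \<in> carrier R"
  shows "(x \<oplus> y) [^] (n::nat) = (\<Oplus>k\<in>{..n}. [(n choose k)] \<cdot>\<^bsub>R\<^esub> (x [^] k \<otimes> y [^] (n - k)))"
proof (induction n)
  case 0
  show ?case using x y by simp
next
  case (Suc n)
  let ?f = "\<lambda>k. [(n choose k)] \<cdot>\<^bsub>R\<^esub> (x [^] k \<otimes> y [^] (n - k))"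
  let ?g = "\<lambda>k. [(n choose k)] \<cdot>\<^bsub>R\<^esub> (x [^] k \<otimes> y [^] (Suc n - k))"
  \<comment> \<open>These are the terms of the sum times x, shifted by one. The value zero at 0 lets
    both sums run over \<open>{..Suc n}\<close>, so that Pascal's rule applies termwise.\<close>
  let ?h = "\<lambda>k. if k = 0 then \<zero> else [(n choose (k - 1))] \<cdot>\<^bsub>R\<^esub> (x [^] k \<otimes> y [^] (Suc n - k))"
  have mono: "x [^] (k::nat) \<otimes> y [^] (l::nat) \<in> carrier R" for k l
    using x y by simp
  have gc: "?g k \<in> carrier R" "?h k \<in> carrier R" "?f k \<in> carrier R" for k
    using mono by simp_all
  have gs: "(\<Oplus>k\<in>{..n}. ?f k) \<otimes> y = (\<Oplus>k\<in>{..Suc n}. ?g k)"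
  proof -
    have "(\<Oplus>k\<in>{..n}. ?f k) \<otimes> y = (\<Oplus>k\<in>{..n}. ?f k \<otimes> y)"
      by (rule finsum_ldistr) (use gc y in auto)
    also have "\<dots> = (\<Oplus>k\<in>{..n}. ?g k)"
    proof (rule finsum_cong')
      fix k assume k: "k \<in> {..n}"
      have "?f k \<otimes> y = [(n choose k)] \<cdot>\<^bsub>R\<^esub> ((x [^] k \<otimes> y [^] (n - k)) \<otimes> y)"
        using mono y by (simp add: add_pow_ldistr)
      also have "(x [^] k \<otimes> y [^] (n - k)) \<otimes> y = x [^] k \<otimes> y [^] (Suc n - k)"
        using k x y by (simp add: m_assoc Suc_diff_le)
      finally show "?f k \<otimes> y = ?g k" .
    qed (use gc in auto)
    also have "\<dots> = (\<Oplus>k\<in>{..Suc n}. ?g k)"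
      using finsum_Suc[of ?g n] gc by (simp add: binomial_eq_0)
    finally show ?thesis .
  qed
  have hs: "(\<Oplus>k\<in>{..n}. ?f k) \<otimes> x = (\<Oplus>k\<in>{..Suc n}. ?h k)"
  proof -
    have "(\<Oplus>k\<in>{..n}. ?f k) \<otimes> x = (\<Oplus>k\<in>{..n}. ?f k \<otimes> x)"
      by (rule finsum_ldistr) (use gc x in auto)
    also have "\<dots> = (\<Oplus>k\<in>{..n}. ?h (Suc k))"
    proof (rule finsum_cong')
      fix k assume k: "k \<in> {..n}"
      have "?f k \<otimes> x = [(n choose k)] \<cdot>\<^bsub>R\<^esub> ((x [^] k \<otimes> y [^] (n - k)) \<otimes> x)"
        using mono x by (simp add: add_pow_ldistr)
      also have "(x [^] k \<otimes> y [^] (n - k)) \<otimes> x = x [^] (Suc k) \<otimes> y [^] (n - k)"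
        using x y by (simp add: m_ac)
      finally show "?f k \<otimes> x = ?h (Suc k)" by simp
    qed (use x y in auto)
    also have "\<dots> = (\<Oplus>k\<in>{..n}. ?h (Suc k)) \<oplus> ?h 0"
      using gc(2)[of "Suc _"] by simp
    also have "\<dots> = (\<Oplus>k\<in>{..Suc n}. ?h k)"
      by (rule finsum_Suc2[symmetric]) (use gc(2) in blast)
    finally show ?thesis .
  qed
  have "(x \<oplus> y) [^] Suc n = (\<Oplus>k\<in>{..n}. ?f k) \<otimes> x \<oplus> (\<Oplus>k\<in>{..n}. ?f k) \<otimes> y"
    using Suc x y gc by (simp add: r_distr)
  also have "\<dots> = (\<Oplus>k\<in>{..Suc n}. ?h k \<oplus> ?g k)"
    unfolding gs hs by (rule finsum_addf[symmetric]) (use gc in blast)+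
  also have "\<dots> = (\<Oplus>k\<in>{..Suc n}. [(Suc n choose k)] \<cdot>\<^bsub>R\<^esub> (x [^] k \<otimes> y [^] (Suc n - k)))"
  proof (rule finsum_cong')
    fix k assume "k \<in> {..Suc n}"
    show "?h k \<oplus> ?g k = [(Suc n choose k)] \<cdot>\<^bsub>R\<^esub> (x [^] k \<otimes> y [^] (Suc n - k))"
      using x y mono by (cases k) (simp_all add: add.nat_pow_mult)
  qed (use mono in auto)
  finally show ?case .
qed

text \<open>For additivity, the binomial coefficients strictly between the ends are divisible by p,
  and p kills every element because it kills the unit; only the two extreme terms remain.\<close>

lemma (in cring) frobenius_hom:
  assumes p: "Factorial_Ring.prime (p::nat)" and char: "[p] \<cdot>\<^bsub>R\<^esub> \<one> = \<zero>"
  shows "(\<lambda>r. r [^] p) \<in> ring_hom R R"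
proof (rule ring_hom_memI)
  fix x y assume x: "x \<in> carrier R" and y: "y \<in> carrier R"
  show "(x \<otimes> y) [^] p = x [^] p \<otimes> y [^] p"
    using x y by (rule nat_pow_distrib)
  have pz: "[p] \<cdot>\<^bsub>R\<^esub> a = \<zero>" if "a \<in> carrier R" for a
    using add_pow_ldistr[of \<one> a p] that char by simp
  let ?f = "\<lambda>k. [(p choose k)] \<cdot>\<^bsub>R\<^esub> (x [^] k \<otimes> y [^] (p - k))"
  have mono: "x [^] (k::nat) \<otimes> y [^] (l::nat) \<in> carrier R" for k l
    using x y by simp
  have mid: "?f k = \<zero>" if "0 < k" "k < p" for k
  proof -
    have "p dvd (p choose k)"
      using that p by (intro dvd_choose_prime) auto
    then obtain c where "p choose k = p * c" by (elim dvdE)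
    then show ?thesis using pz mono by (simp add: add_pow_assoc_mult)
  qed
  have p0: "0 < p" using p by (simp add: prime_gt_0_nat)
  have "(x \<oplus> y) [^] p = (\<Oplus>k\<in>{..p}. ?f k)" by (rule binomial[OF x y])
  also have "\<dots> = (\<Oplus>k\<in>{0, p}. ?f k)"
    by (rule add.finprod_mono_neutral_cong_right) (use mid mono in \<open>auto intro!: mid\<close>)
  also have "\<dots> = ?f 0 \<oplus> ?f p"
    using p0 x y by (subst finsum_insert) auto
  also have "\<dots> = x [^] p \<oplus> y [^] p"
    using x y by (simp add: a_comm)
  finally show "(x \<oplus> y) [^] p = x [^] p \<oplus> y [^] p" .
qed auto


section \<open>Polynomial rings\<close>

text \<open>Makes the convolution sums genuine: \<open>finsum\<close> over an infinite index set is
  zero by convention.\<close>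

lemma finite_submultisets: "finite {k. k \<subseteq># (m::'c multiset)}"
proof (induction m)
  case empty
  then show ?case by simp
next
  case (add x m)
  have "k \<in> {k. k \<subseteq># m} \<union> add_mset x ` {k. k \<subseteq># m}" if "k \<subseteq># add_mset x m" for k
  proof (cases "x \<in># k")
    case True
    then obtain k' where "k = add_mset x k'" by (meson mset_add)
    with that show ?thesis by auto
  next
    case False
    with that show ?thesis
      by (metis (no_types, lifting) CollectI UnI1 diff_single_trivial subset_eq_diff_conv
          add_mset_add_single)
  qed
  then have "{k. k \<subseteq># add_mset x m} \<subseteq> {k. k \<subseteq># m} \<union> add_mset x ` {k. k \<subseteq># m}"
    by blast
  then show ?case
    using add.IH by (meson finite_UnI finite_imageI finite_subset)
qed

context cring
begin

text \<open>The product of \<open>mpoly_ring\<close>, taken out of the record and over any type of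
  variables, so that it applies to all coefficient functions, finitely supported or not.\<close>

definition conv :: "('c multiset \<Rightarrow> 'a) \<Rightarrow> ('c multiset \<Rightarrow> 'a) \<Rightarrow> ('c multiset \<Rightarrow> 'a)" where
  "conv f g = (\<lambda>m. \<Oplus>k\<in>{k. k \<subseteq># m}. f k \<otimes> g (m - k))"

lemma carrier_coeff_const: "c \<in> carrier R \<Longrightarrow> carrier_coeff (indexed_const c)"
  by (simp add: carrier_coeff_def indexed_const_def)

lemma carrier_coeff_conv:
  assumes "carrier_coeff f" "carrier_coeff g"
  shows "carrier_coeff (conv f g)"
  using assms unfolding carrier_coeff_def conv_def by (auto intro!: finsum_closed)

text \<open>The map taking k to m - k is an involution of the submultisets of m; reindexing by it
  swaps the two factors.\<close>

lemma conv_comm: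
  fixes f g :: "'c multiset \<Rightarrow> 'a"
  assumes "carrier_coeff f" "carrier_coeff g"
  shows "conv f g = conv g f"
proof
  fix m :: "'c multiset"
  have img: "(\<lambda>k. m - k) ` {k. k \<subseteq># m} = {k. k \<subseteq># m}"
  proof (intro equalityI subsetI)
    fix k assume "k \<in> {k. k \<subseteq># m}"
    then have "k = m - (m - k)" "m - k \<subseteq># m"
      by (auto simp: multiset_eq_iff subseteq_mset_def)
    then show "k \<in> (\<lambda>k. m - k) ` {k. k \<subseteq># m}" by blast
  qed auto
  have inj: "inj_on (\<lambda>k. m - k) {k. k \<subseteq># m}"
    by (rule inj_on_inverseI[where g = "\<lambda>k. m - k"]) (auto simp: multiset_eq_iff subseteq_mset_def)
  have "conv f g m = (\<Oplus>k\<in>(\<lambda>k. m - k) ` {k. k \<subseteq># m}. f k \<otimes> g (m - k))"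
    unfolding img conv_def ..
  also have "\<dots> = (\<Oplus>k\<in>{k. k \<subseteq># m}. f (m - k) \<otimes> g (m - (m - k)))"
    by (rule finsum_reindex) (use assms inj in \<open>auto simp: carrier_coeff_def\<close>)
  also have "\<dots> = conv g f m"
    unfolding conv_def
  proof (rule finsum_cong')
    fix k assume "k \<in> {k. k \<subseteq># m}"
    then have "m - (m - k) = k" by (auto simp: multiset_eq_iff subseteq_mset_def)
    then show "f (m - k) \<otimes> g (m - (m - k)) = g k \<otimes> f (m - k)"
      using assms by (simp add: carrier_coeff_def m_comm)
  qed (use assms in \<open>auto simp: carrier_coeff_def\<close>)
  finally show "conv f g m = conv g f m" .
qed

lemma conv_padd:
  assumes "carrier_coeff f" "carrier_coeff f'" "carrier_coeff g"
  shows "conv (indexed_padd f f') g = indexed_padd (conv f g) (conv f' g)"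
proof
  fix m
  have "conv (indexed_padd f f') g m
      = (\<Oplus>k\<in>{k. k \<subseteq># m}. f k \<otimes> g (m - k) \<oplus> f' k \<otimes> g (m - k))"
    unfolding conv_def indexed_padd_def
    by (rule finsum_cong') (use assms in \<open>auto simp: carrier_coeff_def l_distr\<close>)
  also have "\<dots> = indexed_padd (conv f g) (conv f' g) m"
    unfolding conv_def indexed_padd_def
    by (rule finsum_addf) (use assms in \<open>auto simp: carrier_coeff_def\<close>)
  finally show "conv (indexed_padd f f') g m = indexed_padd (conv f g) (conv f' g) m" .
qed

lemma conv_const:
  assumes "c \<in> carrier R" "carrier_coeff g"
  shows "conv (indexed_const c) g = (\<lambda>m. c \<otimes> g m)"
proof
  fix m
  have "conv (indexed_const c) g m = (\<Oplus>k\<in>{{#}}. indexed_const c k \<otimes> g (m - k))"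
    unfolding conv_def
    by (rule add.finprod_mono_neutral_cong_right)
      (use assms finite_submultisets in \<open>auto simp: carrier_coeff_def indexed_const_def\<close>)
  also have "\<dots> = c \<otimes> g m"
    using assms by (subst finsum_insert) (auto simp: carrier_coeff_def indexed_const_def)
  finally show "conv (indexed_const c) g m = c \<otimes> g m" .
qed

text \<open>Only submultisets k containing i contribute, and in \<open>add_mset i m'\<close> these
  are exactly \<open>add_mset i k\<close> for k inside m'.\<close>

lemma conv_pmult:
  assumes "carrier_coeff f" "carrier_coeff g"
  shows "conv (indexed_pmult f i) g = indexed_pmult (conv f g) i"
proof
  fix m
  let ?t = "\<lambda>k. indexed_pmult f i k \<otimes> g (m - k)"
  have tc: "?t k \<in> carrier R" for k
    using assms by (auto simp: carrier_coeff_def indexed_pmult_def)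
  show "conv (indexed_pmult f i) g m = indexed_pmult (conv f g) i m"
  proof (cases "i \<in># m")
    case False
    have "?t k = \<zero>" if "k \<subseteq># m" for k
      using that False assms by (auto simp: carrier_coeff_def indexed_pmult_def dest: mset_subset_eqD)
    then have "conv (indexed_pmult f i) g m = (\<Oplus>k\<in>{k. k \<subseteq># m}. \<zero>)"
      unfolding conv_def by (intro finsum_cong') auto
    then show ?thesis using False by (simp add: indexed_pmult_def)
  next
    case True
    then obtain m' where m: "m = add_mset i m'" by (meson mset_add)
    have "conv (indexed_pmult f i) g m = (\<Oplus>k\<in>add_mset i ` {k. k \<subseteq># m'}. ?t k)"
      unfolding conv_def
    proof (rule add.finprod_mono_neutral_cong_right)
      fix k assume k: "k \<in> {k. k \<subseteq># m} - add_mset i ` {k. k \<subseteq># m'}"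
      have "i \<notin># k"
      proof
        assume "i \<in># k"
        then obtain k' where "k = add_mset i k'" by (meson mset_add)
        with k m show False by auto
      qed
      then show "?t k = \<zero>" using assms by (simp add: carrier_coeff_def indexed_pmult_def)
    qed (use tc m finite_submultisets in auto)
    also have "\<dots> = (\<Oplus>k\<in>{k. k \<subseteq># m'}. ?t (add_mset i k))"
      by (rule finsum_reindex) (use tc in \<open>auto simp: inj_on_def\<close>)
    also have "\<dots> = conv f g m'"
      unfolding conv_def m by (rule finsum_cong') (use assms in \<open>auto simp: carrier_coeff_def indexed_pmult_def\<close>)
    also have "\<dots> = indexed_pmult (conv f g) i m"
      using m by (simp add: indexed_pmult_def)
    finally show ?thesis .
  qed
qed

lemma indexed_pset_coeff: "f \<in> indexed_pset I (carrier R) \<Longrightarrow> carrier_coeff f"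
  by (rule indexed_pset_in_carrier) auto

text \<open>Scaling commutes with the three constructors of \<open>indexed_pset\<close>. It serves
  as the constant case of closure under products, and the scalar -1 supplies additive
  inverses.\<close>

lemma const_smult_pset:
  assumes "c \<in> carrier R" "g \<in> indexed_pset I (carrier R)"
  shows "(\<lambda>m. c \<otimes> g m) \<in> indexed_pset I (carrier R)"
  using assms(2)
proof (induction rule: indexed_pset.induct)
  case (indexed_const k)
  have eq: "(\<lambda>m. c \<otimes> indexed_const k m) = indexed_const (c \<otimes> k)"
    using assms(1) by (auto simp: indexed_const_def)
  show ?case unfolding eq using indexed_const assms(1) by (intro indexed_pset.indexed_const) simp
next
  case (indexed_padd P Q)
  have eq: "(\<lambda>m. c \<otimes> indexed_padd P Q m) = indexed_padd (\<lambda>m. c \<otimes> P m) (\<lambda>m. c \<otimes> Q m)"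
    using assms(1) indexed_pset_coeff[OF indexed_padd.hyps(1)] indexed_pset_coeff[OF indexed_padd.hyps(2)]
    by (auto simp: indexed_padd_def carrier_coeff_def r_distr)
  show ?case unfolding eq using indexed_padd.IH by (rule indexed_pset.indexed_padd)
next
  case (indexed_pmult P i)
  have eq: "(\<lambda>m. c \<otimes> indexed_pmult P i m) = indexed_pmult (\<lambda>m. c \<otimes> P m) i"
    using assms(1) by (auto simp: indexed_pmult_def)
  show ?case unfolding eq using indexed_pmult by (intro indexed_pset.indexed_pmult)
qed

lemma conv_pset:
  assumes "f \<in> indexed_pset I (carrier R)" "g \<in> indexed_pset I (carrier R)"
  shows "conv f g \<in> indexed_pset I (carrier R)"
  using assms(1)
proof (induction rule: indexed_pset.induct)
  case (indexed_const k)
  then show ?case using assms(2)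
    by (simp add: conv_const indexed_pset_coeff const_smult_pset)
next
  case (indexed_padd P Q)
  then show ?case using assms(2)
    by (simp add: conv_padd indexed_pset_coeff indexed_pset.indexed_padd)
next
  case (indexed_pmult P i)
  then show ?case using assms(2)
    by (simp add: conv_pmult indexed_pset_coeff indexed_pset.indexed_pmult)
qed

text \<open>Induction on the first factor alone: the product passes through sums and through
  multiplication by a variable, which leaves a constant factor. The other two arguments can
  therefore be arbitrary coefficient functions.\<close>

lemma conv_assoc:
  assumes "f \<in> indexed_pset I (carrier R)" "carrier_coeff g" "carrier_coeff h"
  shows "conv (conv f g) h = conv f (conv g h)"
  using assms(1)
proof (induction rule: indexed_pset.induct)
  case (indexed_const k)
  have cc: "carrier_coeff (\<lambda>m. k \<otimes> g m)"
    using indexed_const assms(2) by (simp add: carrier_coeff_def)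
  have "conv (\<lambda>m. k \<otimes> g m) h m = k \<otimes> conv g h m" for m
  proof -
    have "conv (\<lambda>m. k \<otimes> g m) h m = (\<Oplus>j\<in>{j. j \<subseteq># m}. k \<otimes> (g j \<otimes> h (m - j)))"
      unfolding conv_def using indexed_const assms
      by (intro finsum_cong') (auto simp: carrier_coeff_def m_assoc)
    also have "\<dots> = k \<otimes> conv g h m"
      unfolding conv_def using indexed_const assms finite_submultisets
      by (intro finsum_rdistr[symmetric]) (auto simp: carrier_coeff_def)
    finally show ?thesis .
  qed
  then show ?case
    using indexed_const assms by (simp add: conv_const carrier_coeff_conv)
next
  case (indexed_padd P Q)
  then show ?case using assms(2,3)
    by (simp add: conv_padd carrier_coeff_conv indexed_pset_coeff)
next
  case (indexed_pmult P i)
  then show ?case using assms(2,3)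
    by (simp add: conv_pmult carrier_coeff_conv indexed_pset_coeff)
qed

lemma mpoly_ring_simps:
  "carrier (mpoly_ring R n) = indexed_pset {..<n} (carrier R)"
  "x \<otimes>\<^bsub>mpoly_ring R n\<^esub> y = conv x y"
  "x \<oplus>\<^bsub>mpoly_ring R n\<^esub> y = indexed_padd x y"
  "\<one>\<^bsub>mpoly_ring R n\<^esub> = indexed_const \<one>"
  "\<zero>\<^bsub>mpoly_ring R n\<^esub> = indexed_const \<zero>"
  by (simp_all add: mpoly_ring_def conv_def)

lemma mpoly_ring_cring: "cring (mpoly_ring R n)" (is "cring ?P")
proof (rule cringI)
  have coeff: "carrier_coeff x" if "x \<in> carrier ?P" for x
    using that by (simp add: mpoly_ring_simps indexed_pset_coeff)
  show "abelian_group ?P"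
  proof (rule abelian_groupI)
    fix x assume x: "x \<in> carrier ?P"
    have "(\<lambda>m. \<ominus> \<one> \<otimes> x m) \<in> carrier ?P"
      using x by (simp add: mpoly_ring_simps const_smult_pset)
    moreover have "(\<lambda>m. \<ominus> \<one> \<otimes> x m) \<oplus>\<^bsub>?P\<^esub> x = \<zero>\<^bsub>?P\<^esub>"
      using coeff[OF x]
      by (auto simp: mpoly_ring_simps indexed_padd_def indexed_zero_def carrier_coeff_def l_minus l_neg)
    ultimately show "\<exists>y\<in>carrier ?P. y \<oplus>\<^bsub>?P\<^esub> x = \<zero>\<^bsub>?P\<^esub>"
      by blast
  qed (use coeff in \<open>auto simp: mpoly_ring_simps indexed_padd_def indexed_zero_def carrier_coeff_def a_ac
        intro: indexed_pset.indexed_padd[unfolded indexed_padd_def]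
        indexed_pset.indexed_const[of \<zero>, unfolded indexed_zero_def]\<close>)
  show "comm_monoid ?P"
  proof (rule comm_monoidI)
    fix x y z assume x: "x \<in> carrier ?P" and y: "y \<in> carrier ?P"
    show "x \<otimes>\<^bsub>?P\<^esub> y \<in> carrier ?P"
      using x y by (simp add: mpoly_ring_simps conv_pset)
    show "x \<otimes>\<^bsub>?P\<^esub> y = y \<otimes>\<^bsub>?P\<^esub> x"
      using coeff x y by (simp add: mpoly_ring_simps conv_comm)
    show "\<one>\<^bsub>?P\<^esub> \<otimes>\<^bsub>?P\<^esub> x = x"
      using coeff[OF x] by (simp add: mpoly_ring_simps conv_const) (simp add: carrier_coeff_def)
    assume z: "z \<in> carrier ?P"
    show "x \<otimes>\<^bsub>?P\<^esub> y \<otimes>\<^bsub>?P\<^esub> z = x \<otimes>\<^bsub>?P\<^esub> (y \<otimes>\<^bsub>?P\<^esub> z)"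
      using x coeff[OF y] coeff[OF z] by (simp add: mpoly_ring_simps conv_assoc)
  qed (simp add: mpoly_ring_simps indexed_pset.indexed_const)
  fix x y z
  assume "x \<in> carrier ?P" "y \<in> carrier ?P" "z \<in> carrier ?P"
  then show "(x \<oplus>\<^bsub>?P\<^esub> y) \<otimes>\<^bsub>?P\<^esub> z
      = x \<otimes>\<^bsub>?P\<^esub> z \<oplus>\<^bsub>?P\<^esub> y \<otimes>\<^bsub>?P\<^esub> z"
    using coeff by (simp add: mpoly_ring_simps conv_padd)
qed

lemma indexed_const_hom: "indexed_const \<in> ring_hom R (mpoly_ring R n)"
proof (rule ring_hom_memI)
  fix x y assume "x \<in> carrier R" "y \<in> carrier R"
  then show "indexed_const (x \<otimes> y) = indexed_const x \<otimes>\<^bsub>mpoly_ring R n\<^esub> indexed_const y"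
    by (simp add: mpoly_ring_simps conv_const carrier_coeff_const) (auto simp: indexed_const_def)
qed (auto simp: mpoly_ring_simps indexed_padd_const intro: indexed_pset.indexed_const)

lemma indexed_var_closed: "j < n \<Longrightarrow> indexed_var j \<in> carrier (mpoly_ring R n)"
  unfolding indexed_var_def mpoly_ring_simps
  by (intro indexed_pset.indexed_pmult indexed_pset.indexed_const) auto

lemma indexed_pmult_eq_var:
  assumes "f \<in> carrier (mpoly_ring R n)" "j < n"
  shows "indexed_pmult f j = f \<otimes>\<^bsub>mpoly_ring R n\<^esub> indexed_var j"
proof -
  interpret P: cring "mpoly_ring R n" by (rule mpoly_ring_cring)
  have f: "carrier_coeff f" using assms(1) by (simp add: mpoly_ring_simps indexed_pset_coeff)
  have "f \<otimes>\<^bsub>mpoly_ring R n\<^esub> indexed_var j = indexed_var j \<otimes>\<^bsub>mpoly_ring R n\<^esub> f"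
    using assms indexed_var_closed P.m_comm by blast
  also have "\<dots> = indexed_pmult f j"
    using f by (simp add: mpoly_ring_simps indexed_var_def conv_pmult carrier_coeff_const conv_const)
      (simp add: carrier_coeff_def)
  finally show ?thesis by simp
qed

text \<open>Recasts the inductive generation of polynomials in ring operations, so that a claim
  compatible with sums has to be checked only on constants and under multiplication by one
  variable.\<close>

lemma mpoly_ring_induct [consumes 1, case_names const add var]:
  assumes "f \<in> carrier (mpoly_ring R n)"
    and "\<And>c. c \<in> carrier R \<Longrightarrow> Q (indexed_const c)"
    and "\<And>f g. f \<in> carrier (mpoly_ring R n) \<Longrightarrow> g \<in> carrier (mpoly_ring R n) \<Longrightarrow> Q f \<Longrightarrow> Q g \<Longrightarrow>
      Q (f \<oplus>\<^bsub>mpoly_ring R n\<^esub> g)"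
    and "\<And>f j. f \<in> carrier (mpoly_ring R n) \<Longrightarrow> j < n \<Longrightarrow> Q f \<Longrightarrow>
      Q (f \<otimes>\<^bsub>mpoly_ring R n\<^esub> indexed_var j)"
  shows "Q f"
proof -
  have "f \<in> indexed_pset {..<n} (carrier R)" using assms(1) by (simp add: mpoly_ring_simps)
  then have "f \<in> carrier (mpoly_ring R n) \<and> Q f"
  proof (induction rule: indexed_pset.induct)
    case (indexed_const k)
    then show ?case using assms(2) by (simp add: mpoly_ring_simps indexed_pset.indexed_const)
  next
    case (indexed_padd P Q)
    then show ?case using assms(3)[of P Q]
      by (simp add: mpoly_ring_simps indexed_pset.indexed_padd)
  next
    case (indexed_pmult P i)
    then have "P \<in> carrier (mpoly_ring R n)" "i < n" "Q P"
      by (simp_all add: mpoly_ring_simps)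
    moreover have "indexed_pmult P i \<in> carrier (mpoly_ring R n)"
      using indexed_pmult.hyps by (simp add: mpoly_ring_simps indexed_pset.indexed_pmult)
    ultimately show ?case using assms(4)[of P i] by (simp only: indexed_pmult_eq_var)
  qed
  then show ?thesis by blast
qed

text \<open>\<open>mpoly_eval\<close> sums over the support, so it has the intended value only
  because this set is finite.\<close>

lemma finite_support:
  assumes "f \<in> indexed_pset I (carrier R)"
  shows "finite {m. f m \<noteq> \<zero>}"
  using assms
proof (induction rule: indexed_pset.induct)
  case (indexed_const k)
  have "{m. indexed_const k m \<noteq> \<zero>} \<subseteq> {{#}}" by (auto simp: indexed_const_def)
  then show ?case by (rule finite_subset) simp
next
  case (indexed_padd P Q)
  have "{m. indexed_padd P Q m \<noteq> \<zero>} \<subseteq> {m. P m \<noteq> \<zero>} \<union> {m. Q m \<noteq> \<zero>}"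
    by (auto simp: indexed_padd_def)
  then show ?case using indexed_padd.IH by (meson finite_UnI finite_subset)
next
  case (indexed_pmult P i)
  have "{m. indexed_pmult P i m \<noteq> \<zero>} \<subseteq> add_mset i ` {m. P m \<noteq> \<zero>}"
    by (auto simp: indexed_pmult_def split: if_splits) (metis (mono_tags, lifting) CollectI image_iff insert_DiffM)
  then show ?case using indexed_pmult.IH by (meson finite_imageI finite_subset)
qed

end

section \<open>Evaluation of polynomials as a ring homomorphism\<close>

context
  fixes S :: "('a, 'b) ring_scheme" and T :: "('c, 'd) ring_scheme" (structure) and h :: "'a \<Rightarrow> 'c" and zs :: "'c list"
  assumes S: "cring S" and T: "cring T" and h: "h \<in> ring_hom S T" and zs: "set zs \<subseteq> carrier T"
begin

interpretation S: cring S by (rule S)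
interpretation T: cring T by (rule T)

lemma zs_nth: "i < length zs \<Longrightarrow> zs ! i \<in> carrier T"
  using zs by (meson nth_mem subsetD)

definition mon_val :: "nat multiset \<Rightarrow> 'c" where
  "mon_val m = (\<Otimes>j\<in>{..<length zs}. (zs ! j) [^] count m j)"

lemma mon_val_closed: "mon_val m \<in> carrier T"
  unfolding mon_val_def using zs_nth by (intro T.finprod_closed) auto

lemma mon_val_empty: "mon_val {#} = \<one>"
  unfolding mon_val_def by simp

lemma mon_val_add:
  assumes "i < length zs"
  shows "mon_val (add_mset i m) = mon_val m \<otimes> zs ! i"
proof -
  have z: "zs ! j \<in> carrier T" if "j < length zs" for j
    using that by (rule zs_nth)
  let ?r = "\<Otimes>j\<in>{..<length zs} - {i}. (zs ! j) [^] count m j"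
  have rc: "?r \<in> carrier T" by (rule T.finprod_closed) (use z in auto)
  have ins: "{..<length zs} = insert i ({..<length zs} - {i})" using assms by auto
  have "mon_val (add_mset i m) = (zs ! i) [^] Suc (count m i)
      \<otimes> (\<Otimes>j\<in>{..<length zs} - {i}. (zs ! j) [^] count (add_mset i m) j)"
    unfolding mon_val_def by (subst ins, subst T.finprod_insert) (use z assms in auto)
  also have "(\<Otimes>j\<in>{..<length zs} - {i}. (zs ! j) [^] count (add_mset i m) j) = ?r"
    by (rule T.finprod_cong') (use z in auto)
  finally have 1: "mon_val (add_mset i m) = (zs ! i) [^] Suc (count m i) \<otimes> ?r" .
  have "mon_val m = (zs ! i) [^] count m i \<otimes> ?r"
    unfolding mon_val_def by (subst ins, subst T.finprod_insert) (use z assms in auto)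
  then show ?thesis using 1 rc z[OF assms] by (simp add: T.m_ac)
qed

text \<open>The supports of f, g and f + g differ; evaluating all of them over one common finite set
  makes the sums comparable. The added terms vanish because h maps zero to zero.\<close>

lemma mpoly_eval_superset:
  assumes "finite A" "{m. f m \<noteq> \<zero>\<^bsub>S\<^esub>} \<subseteq> A" "ring.carrier_coeff S f"
  shows "mpoly_eval S T h zs f = (\<Oplus>m\<in>A. h (f m) \<otimes> mon_val m)"
proof -
  have fc: "f m \<in> carrier S" for m using assms(3) by (simp add: S.carrier_coeff_def)
  have hc: "h (f m) \<in> carrier T" for m using fc h by (rule ring_hom_closed[rotated])
  have h0: "h \<zero>\<^bsub>S\<^esub> = \<zero>" by (rule ring_hom_zero[OF h S.ring_axioms T.ring_axioms])
  show ?thesis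
    unfolding mpoly_eval_def mon_val_def[symmetric]
    by (rule T.add.finprod_mono_neutral_cong_left)
      (use assms hc h0 mon_val_closed in auto)
qed

lemma mpoly_eval_const:
  assumes c: "c \<in> carrier S"
  shows "mpoly_eval S T h zs (ring.indexed_const S c) = h c"
proof -
  have "mpoly_eval S T h zs (S.indexed_const c)
      = (\<Oplus>m\<in>{{#}}. h (S.indexed_const c m) \<otimes> mon_val m)"
    by (rule mpoly_eval_superset) (use c in \<open>auto simp: S.indexed_const_def S.carrier_coeff_def\<close>)
  also have "\<dots> = h c"
    using ring_hom_closed[OF h c] by (simp add: S.indexed_const_def mon_val_empty)
  finally show ?thesis .
qed

lemma mpoly_eval_padd:
  assumes f: "f \<in> carrier (mpoly_ring S n)" and g: "g \<in> carrier (mpoly_ring S n)"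
  shows "mpoly_eval S T h zs (f \<oplus>\<^bsub>mpoly_ring S n\<^esub> g) = mpoly_eval S T h zs f \<oplus> mpoly_eval S T h zs g"
proof -
  let ?A = "{m. f m \<noteq> \<zero>\<^bsub>S\<^esub>} \<union> {m. g m \<noteq> \<zero>\<^bsub>S\<^esub>}"
  have fin: "finite ?A" using f g by (simp add: S.mpoly_ring_simps S.finite_support)
  have cc: "S.carrier_coeff f" "S.carrier_coeff g"
    using f g by (simp_all add: S.mpoly_ring_simps S.indexed_pset_coeff)
  have hc: "h (f m) \<in> carrier T" "h (g m) \<in> carrier T" for m
    using cc h by (auto simp: S.carrier_coeff_def intro: ring_hom_closed)
  have "mpoly_eval S T h zs (f \<oplus>\<^bsub>mpoly_ring S n\<^esub> g)
      = (\<Oplus>m\<in>?A. h ((f \<oplus>\<^bsub>mpoly_ring S n\<^esub> g) m) \<otimes> mon_val m)"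
    by (rule mpoly_eval_superset)
      (use fin cc in \<open>auto simp: S.mpoly_ring_simps S.indexed_padd_def S.carrier_coeff_def\<close>)
  also have "\<dots> = (\<Oplus>m\<in>?A. h (f m) \<otimes> mon_val m \<oplus> h (g m) \<otimes> mon_val m)"
    by (rule T.finsum_cong') (use cc hc mon_val_closed ring_hom_add[OF h] in
        \<open>auto simp: S.mpoly_ring_simps S.indexed_padd_def S.carrier_coeff_def T.l_distr\<close>)
  also have "\<dots> = (\<Oplus>m\<in>?A. h (f m) \<otimes> mon_val m) \<oplus> (\<Oplus>m\<in>?A. h (g m) \<otimes> mon_val m)"
    by (rule T.finsum_addf) (use hc mon_val_closed in auto)
  also have "(\<Oplus>m\<in>?A. h (f m) \<otimes> mon_val m) = mpoly_eval S T h zs f"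
    by (rule mpoly_eval_superset[symmetric]) (use fin cc in auto)
  also have "(\<Oplus>m\<in>?A. h (g m) \<otimes> mon_val m) = mpoly_eval S T h zs g"
    by (rule mpoly_eval_superset[symmetric]) (use fin cc in auto)
  finally show ?thesis .
qed

lemma mpoly_eval_pmult:
  assumes f: "f \<in> carrier (mpoly_ring S n)" and i: "i < length zs"
  shows "mpoly_eval S T h zs (ring.indexed_pmult S f i) = mpoly_eval S T h zs f \<otimes> zs ! i"
proof -
  let ?A = "{m. f m \<noteq> \<zero>\<^bsub>S\<^esub>}"
  have fin: "finite ?A" using f by (simp add: S.mpoly_ring_simps S.finite_support)
  have cc: "S.carrier_coeff f" using f by (simp_all add: S.mpoly_ring_simps S.indexed_pset_coeff)
  have hc: "h (f m) \<in> carrier T" for m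
    using cc h by (auto simp: S.carrier_coeff_def intro: ring_hom_closed)
  have zc: "zs ! i \<in> carrier T" using i by (rule zs_nth)
  have hc': "h (S.indexed_pmult f i m) \<in> carrier T" for m
    using hc by (auto simp: S.indexed_pmult_def ring_hom_zero[OF h S.ring_axioms T.ring_axioms])
  have "mpoly_eval S T h zs (S.indexed_pmult f i)
      = (\<Oplus>m\<in>add_mset i ` ?A. h (S.indexed_pmult f i m) \<otimes> mon_val m)"
  proof (rule mpoly_eval_superset)
    show "{m. S.indexed_pmult f i m \<noteq> \<zero>\<^bsub>S\<^esub>} \<subseteq> add_mset i ` ?A"
      by (auto simp: S.indexed_pmult_def split: if_splits)
        (metis (mono_tags, lifting) CollectI image_iff insert_DiffM)
  qed (use fin cc in \<open>auto intro: S.indexed_pmult_in_carrier\<close>)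
  also have "\<dots> = (\<Oplus>m\<in>?A. h (S.indexed_pmult f i (add_mset i m)) \<otimes> mon_val (add_mset i m))"
    by (rule T.finsum_reindex) (use hc' mon_val_closed in \<open>auto simp: inj_on_def\<close>)
  also have "\<dots> = (\<Oplus>m\<in>?A. (h (f m) \<otimes> mon_val m) \<otimes> zs ! i)"
    by (rule T.finsum_cong')
      (use hc mon_val_closed zc in \<open>auto simp: S.indexed_pmult_def mon_val_add[OF i] T.m_assoc\<close>)
  also have "\<dots> = (\<Oplus>m\<in>?A. h (f m) \<otimes> mon_val m) \<otimes> zs ! i"
    by (rule T.finsum_ldistr[symmetric]) (use fin hc mon_val_closed zc in auto)
  also have "(\<Oplus>m\<in>?A. h (f m) \<otimes> mon_val m) = mpoly_eval S T h zs f"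
    by (rule mpoly_eval_superset[symmetric]) (use fin cc in auto)
  finally show ?thesis .
qed

lemma mpoly_eval_var:
  assumes "i < length zs"
  shows "mpoly_eval S T h zs (ring.indexed_var S i) = zs ! i"
proof -
  have "S.indexed_const \<one>\<^bsub>S\<^esub> \<in> carrier (mpoly_ring S (length zs))"
    by (simp add: S.mpoly_ring_simps S.indexed_pset.indexed_const)
  then show ?thesis
    using mpoly_eval_pmult[of "S.indexed_const \<one>\<^bsub>S\<^esub>" "length zs" i] assms zs_nth ring_hom_one[OF h]
    by (auto simp: S.indexed_var_def mpoly_eval_const)
qed

lemma mpoly_eval_hom: "mpoly_eval S T h zs \<in> ring_hom (mpoly_ring S (length zs)) T"
proof -
  let ?P = "mpoly_ring S (length zs)" and ?E = "mpoly_eval S T h zs"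
  interpret P: cring ?P by (rule S.mpoly_ring_cring)
  note vc = S.indexed_var_closed
  have cc: "S.indexed_const c \<in> carrier ?P" if "c \<in> carrier S" for c
    using that by (rule ring_hom_closed[OF S.indexed_const_hom])
  have E_var: "?E (f \<otimes>\<^bsub>?P\<^esub> S.indexed_var j) = ?E f \<otimes> zs ! j"
    if "f \<in> carrier ?P" "j < length zs" for f j
    using that mpoly_eval_pmult[of f "length zs" j] by (simp add: S.indexed_pmult_eq_var)
  have zc: "zs ! j \<in> carrier T" if "j < length zs" for j using that by (rule zs_nth)
  have Ec: "?E f \<in> carrier T" if "f \<in> carrier ?P" for f
    using that
    by (induction rule: S.mpoly_ring_induct)
      (auto simp: mpoly_eval_const mpoly_eval_padd E_var zc intro: ring_hom_closed[OF h])
  \<comment> \<open>Multiplicativity goes by induction on the left factor. Its constant case is this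
    scalar rule, which needs an induction on the right factor.\<close>
  have E_smult: "?E (S.indexed_const c \<otimes>\<^bsub>?P\<^esub> g) = h c \<otimes> ?E g"
    if c: "c \<in> carrier S" and g: "g \<in> carrier ?P" for c g
    using g
  proof (induction rule: S.mpoly_ring_induct)
    case (const d)
    then show ?case
      using c ring_hom_mult[OF S.indexed_const_hom c const, symmetric] ring_hom_mult[OF h c const]
      by (simp add: mpoly_eval_const)
  next
    case (add f g)
    then show ?case
      using c ring_hom_closed[OF h c]
      by (simp add: P.r_distr cc mpoly_eval_padd Ec T.r_distr)
  next
    case (var f j)
    have "S.indexed_const c \<otimes>\<^bsub>?P\<^esub> (f \<otimes>\<^bsub>?P\<^esub> S.indexed_var j)
        = S.indexed_const c \<otimes>\<^bsub>?P\<^esub> f \<otimes>\<^bsub>?P\<^esub> S.indexed_var j"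
      using var vc cc[OF c] by (simp add: P.m_assoc)
    then show ?case
      using var c cc[OF c] ring_hom_closed[OF h c] by (simp add: E_var Ec zc T.m_assoc)
  qed
  have E_mult: "?E (f \<otimes>\<^bsub>?P\<^esub> g) = ?E f \<otimes> ?E g"
    if f: "f \<in> carrier ?P" and g: "g \<in> carrier ?P" for f g
    using f
  proof (induction rule: S.mpoly_ring_induct)
    case (const d)
    then show ?case using g by (simp add: E_smult mpoly_eval_const)
  next
    case (add f f')
    then show ?case using g by (simp add: P.l_distr mpoly_eval_padd Ec T.l_distr)
  next
    case (var f j)
    have "f \<otimes>\<^bsub>?P\<^esub> S.indexed_var j \<otimes>\<^bsub>?P\<^esub> g = f \<otimes>\<^bsub>?P\<^esub> g \<otimes>\<^bsub>?P\<^esub> S.indexed_var j"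
      using var vc g by (simp add: P.m_ac)
    then show ?case using var g by (simp add: E_var Ec zc T.m_ac)
  qed
  show ?thesis
    by (rule ring_hom_memI)
      (auto simp: Ec E_mult mpoly_eval_padd S.mpoly_ring_simps(4) mpoly_eval_const ring_hom_one[OF h])
qed

end

section \<open>Adjoining \<open>p\<close>-th roots\<close>

lemma carrier_FactRing: "carrier (R Quot I) = (+>\<^bsub>R\<^esub>) I ` carrier R"
  unfolding FactRing_def partial_object.select_convs A_RCOSETS_def' by blast

locale root_adjunction = cring S for p :: nat and S :: "('a tower, 'b) ring_scheme" (structure)
    and ys :: "'a tower list" +
  assumes ys: "set ys \<subseteq> carrier S"
begin

abbreviation P where "P \<equiv> mpoly_ring S (length ys)"
abbreviation A where "A \<equiv> adjoin_roots p S ys"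
abbreviation Ideal where "Ideal \<equiv> root_ideal p S ys"
abbreviation cls where "cls \<equiv> poly_class p S ys"

sublocale P: cring P by (rule mpoly_ring_cring)

lemma ys_nth: "j < length ys \<Longrightarrow> ys ! j \<in> carrier S"
  using ys by (meson nth_mem subsetD)

lemma const_closed: "c \<in> carrier S \<Longrightarrow> indexed_const c \<in> carrier P"
  by (rule ring_hom_closed[OF indexed_const_hom])

lemma root_gens_closed:
  "{indexed_var j [^]\<^bsub>P\<^esub> p \<ominus>\<^bsub>P\<^esub> indexed_const (ys ! j) | j. j < length ys} \<subseteq> carrier P"
  using ys_nth by (auto intro!: P.minus_closed P.nat_pow_closed indexed_var_closed const_closed)

lemma root_ideal_eq: "Ideal =
    genideal P {indexed_var j [^]\<^bsub>P\<^esub> p \<ominus>\<^bsub>P\<^esub> indexed_const (ys ! j) | j. j < length ys}"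
  by (simp add: root_ideal_def Let_def)

sublocale I: ideal Ideal P
  unfolding root_ideal_eq by (rule P.genideal_ideal[OF root_gens_closed])

text \<open>A coset is nonempty, so the chosen representative belongs to it. As distinct cosets are
  disjoint, this also makes the renaming injective.\<close>

lemma rename_coset_mem:
  assumes "C \<in> carrier (P Quot Ideal)"
  shows "poly_rep (rename_coset C) \<in> C"
proof -
  obtain f where "f \<in> carrier P" "C = Ideal +>\<^bsub>P\<^esub> f"
    using assms by (auto simp: carrier_FactRing)
  then have "f \<in> C" using I.a_rcos_self by simp
  then have "(SOME f. f \<in> C) \<in> C" by (rule someI[where P = "\<lambda>f. f \<in> C"])
  then show ?thesis by (simp add: rename_coset_def)
qed

lemma rename_coset_inj: "inj_on rename_coset (carrier (P Quot Ideal))"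
proof (rule inj_onI)
  fix C D assume C: "C \<in> carrier (P Quot Ideal)" and D: "D \<in> carrier (P Quot Ideal)"
    and eq: "rename_coset C = rename_coset D"
  obtain f g where f: "f \<in> carrier P" "C = Ideal +>\<^bsub>P\<^esub> f" and g: "g \<in> carrier P" "D = Ideal +>\<^bsub>P\<^esub> g"
    using C D by (auto simp: carrier_FactRing)
  have "poly_rep (rename_coset C) \<in> C" "poly_rep (rename_coset C) \<in> D"
    using rename_coset_mem[OF C] rename_coset_mem[OF D] eq by simp_all
  then show "C = D"
    using f g by (metis P.a_repr_independence I.a_subgroup)
qed

lemma rename_coset_iso: "rename_coset \<in> ring_iso (P Quot Ideal) A"
  unfolding adjoin_roots_def by (rule inj_imp_image_ring_iso[OF rename_coset_inj])

lemma cring_adjoin_roots: "cring A"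
proof -
  interpret Q: cring "P Quot Ideal" by (rule I.quotient_is_cring[OF P.is_cring])
  have "cring (A \<lparr>zero := rename_coset \<zero>\<^bsub>P Quot Ideal\<^esub>\<rparr>)"
    by (rule Q.ring_iso_imp_img_cring[OF rename_coset_iso])
  \<comment> \<open>Transport along the isomorphism resets the zero to the image of zero;
    \<open>image_ring\<close> already has that zero, so the update changes nothing.\<close>
  moreover have "A \<lparr>zero := rename_coset \<zero>\<^bsub>P Quot Ideal\<^esub>\<rparr> = A"
    by (simp add: adjoin_roots_def image_ring_def image_group_def monoid.defs)
  ultimately show ?thesis by simp
qed

sublocale A: cring A by (rule cring_adjoin_roots)

lemma cls_hom: "cls \<in> ring_hom P A"
proof -
  have "rename_coset \<in> ring_hom (P Quot Ideal) A"
    using rename_coset_iso by (simp add: ring_iso_def)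
  then have "rename_coset \<circ> (+>\<^bsub>P\<^esub>) Ideal \<in> ring_hom P A"
    by (rule ring_hom_trans[OF I.rcos_ring_hom])
  moreover have "rename_coset \<circ> (+>\<^bsub>P\<^esub>) Ideal = cls"
    by (simp add: poly_class_def fun_eq_iff)
  ultimately show ?thesis by simp
qed

lemma cls_surj: "a \<in> carrier A \<Longrightarrow> \<exists>f\<in>carrier P. a = cls f"
  unfolding adjoin_roots_def image_ring_carrier poly_class_def by (auto simp: carrier_FactRing)

text \<open>The arbitrary choice made by \<open>rename_coset\<close> is invisible to every
  evaluation that vanishes on \<open>Ideal\<close>.\<close>

lemma poly_rep_cls:
  assumes "f \<in> carrier P"
  shows "\<exists>i\<in>Ideal. poly_rep (cls f) = i \<oplus>\<^bsub>P\<^esub> f"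
proof -
  have "Ideal +>\<^bsub>P\<^esub> f \<in> carrier (P Quot Ideal)" using assms by (auto simp: carrier_FactRing)
  then have "poly_rep (cls f) \<in> Ideal +>\<^bsub>P\<^esub> f"
    unfolding poly_class_def by (rule rename_coset_mem)
  then show ?thesis by (auto simp: a_r_coset_def r_coset_def)
qed

lemma cls_const_hom: "(\<lambda>c. cls (indexed_const c)) \<in> ring_hom S A"
  using ring_hom_trans[OF indexed_const_hom cls_hom] by (simp add: comp_def)

lemma cls_var_closed: "j < length ys \<Longrightarrow> cls (indexed_var j) \<in> carrier A"
  by (rule ring_hom_closed[OF cls_hom indexed_var_closed])

lemma cls_var_pow:
  assumes j: "j < length ys"
  shows "cls (indexed_var j) [^]\<^bsub>A\<^esub> p = cls (indexed_const (ys ! j))"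
proof -
  interpret h: ring_hom_ring P A cls
    by (intro ring_hom_ringI2 P.ring_axioms A.ring_axioms cls_hom)
  let ?g = "indexed_var j [^]\<^bsub>P\<^esub> p \<ominus>\<^bsub>P\<^esub> indexed_const (ys ! j)"
  have v: "indexed_var j \<in> carrier P" and c: "indexed_const (ys ! j) \<in> carrier P"
    using j ys_nth by (auto intro: indexed_var_closed const_closed)
  have g: "?g \<in> Ideal"
    unfolding root_ideal_eq using root_gens_closed P.genideal_self j by blast
  then have gc: "?g \<in> carrier P" by (rule I.a_Hcarr)
  have "Ideal +>\<^bsub>P\<^esub> ?g = Ideal" using g by (rule I.a_rcos_const)
  moreover have "Ideal +>\<^bsub>P\<^esub> \<zero>\<^bsub>P\<^esub> = Ideal" using I.zero_closed by (rule I.a_rcos_const)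
  ultimately have "cls ?g = cls \<zero>\<^bsub>P\<^esub>" by (simp add: poly_class_def)
  then have "cls ?g = \<zero>\<^bsub>A\<^esub>" by simp
  then have "cls (indexed_var j) [^]\<^bsub>A\<^esub> p \<ominus>\<^bsub>A\<^esub> cls (indexed_const (ys ! j)) = \<zero>\<^bsub>A\<^esub>"
    using v c by (simp add: a_minus_def h.hom_nat_pow)
  then show ?thesis using v c by simp
qed

lemma adjoin_roots_induct [consumes 1, case_names const add var]:
  assumes "a \<in> carrier A"
    and const: "\<And>c. c \<in> carrier S \<Longrightarrow> Q (cls (indexed_const c))"
    and add: "\<And>a b. a \<in> carrier A \<Longrightarrow> b \<in> carrier A \<Longrightarrow> Q a \<Longrightarrow> Q b \<Longrightarrow> Q (a \<oplus>\<^bsub>A\<^esub> b)"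
    and var: "\<And>a j. a \<in> carrier A \<Longrightarrow> j < length ys \<Longrightarrow> Q a \<Longrightarrow> Q (a \<otimes>\<^bsub>A\<^esub> cls (indexed_var j))"
  shows "Q a"
proof -
  obtain f where f: "f \<in> carrier P" "a = cls f" using cls_surj assms(1) by blast
  have "Q (cls f)"
    using f(1)
  proof (induction rule: mpoly_ring_induct)
    case (const c)
    then show ?case by (rule assms(2))
  next
    case (add f g)
    then show ?case
      using assms(3)[of "cls f" "cls g"] ring_hom_closed[OF cls_hom] ring_hom_add[OF cls_hom] by simp
  next
    case (var f j)
    then show ?case
      using assms(4)[of "cls f" j] ring_hom_closed[OF cls_hom] ring_hom_mult[OF cls_hom]
        indexed_var_closed by simp
  qed
  then show ?thesis using f(2) by simp
qed

section \<open>The universal property of adjoining p-th roots\<close>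

context
  fixes T :: "('c, 'd) ring_scheme" and h :: "'a tower \<Rightarrow> 'c" and zs :: "'c list"
  assumes T: "cring T" and h: "h \<in> ring_hom S T" and zs: "set zs \<subseteq> carrier T"
    and len: "length zs = length ys"
    and rel: "\<And>j. j < length ys \<Longrightarrow> (zs ! j) [^]\<^bsub>T\<^esub> p = h (ys ! j)"
begin

interpretation T: cring T by (rule T)

lemma eval_hom: "mpoly_eval S T h zs \<in> ring_hom P T"
  using mpoly_eval_hom[OF is_cring T h zs] by (simp add: len)

text \<open>By \<open>rel\<close> the evaluation kills each X_j^p - y_j, and its kernel is an ideal,
  hence contains the ideal these generate.\<close>

lemma eval_root_ideal:
  assumes "f \<in> Ideal"
  shows "mpoly_eval S T h zs f = \<zero>\<^bsub>T\<^esub>"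
proof -
  interpret h: ring_hom_ring P T "mpoly_eval S T h zs"
    by (intro ring_hom_ringI2 P.ring_axioms T.ring_axioms eval_hom)
  have zc: "zs ! j \<in> carrier T" if "j < length ys" for j
    using zs that len by (metis nth_mem subsetD)
  have *: "mpoly_eval S T h zs (indexed_var j [^]\<^bsub>P\<^esub> p \<ominus>\<^bsub>P\<^esub> indexed_const (ys ! j)) = \<zero>\<^bsub>T\<^esub>"
    if j: "j < length ys" for j
  proof -
    have v: "indexed_var j \<in> carrier P" and c: "indexed_const (ys ! j) \<in> carrier P"
      using j ys_nth by (auto intro: indexed_var_closed const_closed)
    have "h (ys ! j) \<in> carrier T" using ys_nth[OF j] h by (rule ring_hom_closed[rotated])
    then show ?thesis
      using v c j ys_nth[OF j] zc[OF j]
      by (simp add: a_minus_def h.hom_nat_pow len mpoly_eval_var[OF is_cring T h zs]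
          mpoly_eval_const[OF is_cring T h zs] rel T.r_neg)
  qed
  have "{indexed_var j [^]\<^bsub>P\<^esub> p \<ominus>\<^bsub>P\<^esub> indexed_const (ys ! j) | j. j < length ys}
      \<subseteq> a_kernel P T (mpoly_eval S T h zs)"
  proof clarify
    fix j assume j: "j < length ys"
    then have "indexed_var j [^]\<^bsub>P\<^esub> p \<ominus>\<^bsub>P\<^esub> indexed_const (ys ! j) \<in> carrier P"
      using root_gens_closed by blast
    then show "indexed_var j [^]\<^bsub>P\<^esub> p \<ominus>\<^bsub>P\<^esub> indexed_const (ys ! j)
        \<in> a_kernel P T (mpoly_eval S T h zs)"
      using *[OF j] unfolding a_kernel_def' by blast
  qed
  then have "Ideal \<subseteq> a_kernel P T (mpoly_eval S T h zs)"
    unfolding root_ideal_eq by (rule P.genideal_minimal[OF h.kernel_is_ideal])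
  then show ?thesis using assms unfolding a_kernel_def' by blast
qed

lemma adjoin_lift_cls:
  assumes f: "f \<in> carrier P"
  shows "adjoin_lift S T h zs (cls f) = mpoly_eval S T h zs f"
proof -
  obtain i where i: "i \<in> Ideal" "poly_rep (cls f) = i \<oplus>\<^bsub>P\<^esub> f" using poly_rep_cls[OF f] by blast
  then have "adjoin_lift S T h zs (cls f) = mpoly_eval S T h zs i \<oplus>\<^bsub>T\<^esub> mpoly_eval S T h zs f"
    using f I.a_Hcarr[OF i(1)] by (simp add: adjoin_lift_def ring_hom_add[OF eval_hom])
  then show ?thesis using ring_hom_closed[OF eval_hom f] by (simp add: eval_root_ideal[OF i(1)])
qed

lemma adjoin_lift_const:
  assumes "c \<in> carrier S"
  shows "adjoin_lift S T h zs (cls (indexed_const c)) = h c"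
  using assms by (simp add: adjoin_lift_cls const_closed mpoly_eval_const[OF is_cring T h zs])

lemma adjoin_lift_var:
  assumes "j < length ys"
  shows "adjoin_lift S T h zs (cls (indexed_var j)) = zs ! j"
  using assms by (simp add: adjoin_lift_cls indexed_var_closed mpoly_eval_var[OF is_cring T h zs] len)

lemma adjoin_lift_hom: "adjoin_lift S T h zs \<in> ring_hom A T"
proof (rule ring_hom_memI)
  fix a assume "a \<in> carrier A"
  then obtain f where f: "f \<in> carrier P" "a = cls f" using cls_surj by blast
  show "adjoin_lift S T h zs a \<in> carrier T"
    using f by (simp add: adjoin_lift_cls ring_hom_closed[OF eval_hom])
  fix b assume "b \<in> carrier A"
  then obtain g where g: "g \<in> carrier P" "b = cls g" using cls_surj by blast
  have "a \<otimes>\<^bsub>A\<^esub> b = cls (f \<otimes>\<^bsub>P\<^esub> g)" "a \<oplus>\<^bsub>A\<^esub> b = cls (f \<oplus>\<^bsub>P\<^esub> g)"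
    using f g by (simp_all add: ring_hom_mult[OF cls_hom] ring_hom_add[OF cls_hom])
  then show "adjoin_lift S T h zs (a \<otimes>\<^bsub>A\<^esub> b) = adjoin_lift S T h zs a \<otimes>\<^bsub>T\<^esub> adjoin_lift S T h zs b"
    "adjoin_lift S T h zs (a \<oplus>\<^bsub>A\<^esub> b) = adjoin_lift S T h zs a \<oplus>\<^bsub>T\<^esub> adjoin_lift S T h zs b"
    using f g by (simp_all add: adjoin_lift_cls ring_hom_mult[OF eval_hom] ring_hom_add[OF eval_hom])
next
  have "\<one>\<^bsub>A\<^esub> = cls (indexed_const \<one>)" using ring_hom_one[OF cls_const_hom] by simp
  then show "adjoin_lift S T h zs \<one>\<^bsub>A\<^esub> = \<one>\<^bsub>T\<^esub>"
    by (simp add: adjoin_lift_const ring_hom_one[OF h])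
qed

end

text \<open>The uniqueness half of the universal property. It is the tool for all identities between
  maps out of a stage: they are checked on constants and on the adjoined roots.\<close>

lemma adjoin_roots_hom_eqI:
  assumes "f \<in> ring_hom A T" "g \<in> ring_hom A T"
    and "\<And>c. c \<in> carrier S \<Longrightarrow> f (cls (indexed_const c)) = g (cls (indexed_const c))"
    and "\<And>j. j < length ys \<Longrightarrow> f (cls (indexed_var j)) = g (cls (indexed_var j))"
    and "a \<in> carrier A"
  shows "f a = g a"
  using assms(5)
proof (induction rule: adjoin_roots_induct)
  case (add a b)
  then show ?case by (simp add: ring_hom_add[OF assms(1)] ring_hom_add[OF assms(2)])
next
  case (var a j)
  then show ?case
    by (simp add: ring_hom_mult[OF assms(1)] ring_hom_mult[OF assms(2)] cls_var_closed assms(4))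
qed (rule assms(3))

end

section \<open>Inverse limits\<close>

locale inverse_system =
  fixes A :: "nat \<Rightarrow> ('a, 'b) ring_scheme" and f :: "nat \<Rightarrow> 'a \<Rightarrow> 'a"
  assumes cring_stage: "cring (A i)" and trans_hom: "f i \<in> ring_hom (A (Suc i)) (A i)"
begin

interpretation A: cring "A i" for i by (rule cring_stage)

abbreviation Lim where "Lim \<equiv> inv_lim A f"

lemma inv_lim_simps:
  "a \<in> carrier Lim \<longleftrightarrow> (\<forall>i. a i \<in> carrier (A i) \<and> f i (a (Suc i)) = a i)"
  "(a \<otimes>\<^bsub>Lim\<^esub> b) i = a i \<otimes>\<^bsub>A i\<^esub> b i"
  "(a \<oplus>\<^bsub>Lim\<^esub> b) i = a i \<oplus>\<^bsub>A i\<^esub> b i"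
  "\<one>\<^bsub>Lim\<^esub> i = \<one>\<^bsub>A i\<^esub>"
  "\<zero>\<^bsub>Lim\<^esub> i = \<zero>\<^bsub>A i\<^esub>"
  by (simp_all add: inv_lim_def)

lemma trans_zero: "f i \<zero>\<^bsub>A (Suc i)\<^esub> = \<zero>\<^bsub>A i\<^esub>"
  by (rule ring_hom_zero[OF trans_hom A.ring_axioms A.ring_axioms])

lemma trans_minus: "x \<in> carrier (A (Suc i)) \<Longrightarrow> f i (\<ominus>\<^bsub>A (Suc i)\<^esub> x) = \<ominus>\<^bsub>A i\<^esub> f i x"
proof -
  interpret h: ring_hom_ring "A (Suc i)" "A i" "f i"
    by (intro ring_hom_ringI2 A.ring_axioms trans_hom)
  show "x \<in> carrier (A (Suc i)) \<Longrightarrow> f i (\<ominus>\<^bsub>A (Suc i)\<^esub> x) = \<ominus>\<^bsub>A i\<^esub> f i x" by simp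
qed

lemma inv_lim_cring: "cring Lim"
proof (rule cringI)
  note hom = ring_hom_add[OF trans_hom] ring_hom_mult[OF trans_hom] ring_hom_one[OF trans_hom]
    trans_zero trans_minus
  show "abelian_group Lim"
  proof (rule abelian_groupI)
    fix x assume x: "x \<in> carrier Lim"
    let ?y = "\<lambda>i. \<ominus>\<^bsub>A i\<^esub> x i"
    have "?y \<in> carrier Lim" using x by (simp add: inv_lim_simps hom)
    moreover have "?y \<oplus>\<^bsub>Lim\<^esub> x = \<zero>\<^bsub>Lim\<^esub>"
      using x by (simp add: inv_lim_simps fun_eq_iff A.l_neg)
    ultimately show "\<exists>y\<in>carrier Lim. y \<oplus>\<^bsub>Lim\<^esub> x = \<zero>\<^bsub>Lim\<^esub>" by blast
  qed (auto simp: inv_lim_simps hom fun_eq_iff A.a_ac)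
  show "comm_monoid Lim"
    by (rule comm_monoidI) (auto simp: inv_lim_simps hom fun_eq_iff A.m_ac)
qed (auto simp: inv_lim_simps fun_eq_iff A.l_distr)

lemma inv_lim_proj_hom: "(\<lambda>a. a i) \<in> ring_hom Lim (A i)"
  by (rule ring_hom_memI) (auto simp: inv_lim_simps)

text \<open>Below i the coordinates are forced by the transition maps; above i preimages are chosen
  one after the other.\<close>

lemma inv_lim_proj_surj:
  assumes surj: "\<And>i y. y \<in> carrier (A i) \<Longrightarrow> \<exists>x\<in>carrier (A (Suc i)). f i x = y"
    and x: "x \<in> carrier (A i)"
  shows "\<exists>a\<in>carrier Lim. a i = x"
proof -
  have "\<exists>a. (\<forall>k\<le>i. a k \<in> carrier (A k)) \<and> (\<forall>k<i. f k (a (Suc k)) = a k) \<and> a i = x"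
    using x
  proof (induction i arbitrary: x)
    case 0
    then show ?case by (intro exI[of _ "\<lambda>_. x"]) auto
  next
    case (Suc i)
    from Suc.IH[OF ring_hom_closed[OF trans_hom Suc.prems]] obtain a where
      a: "\<forall>k\<le>i. a k \<in> carrier (A k)" "\<forall>k<i. f k (a (Suc k)) = a k" "a i = f i x"
      by blast
    then show ?case using Suc.prems
      by (intro exI[of _ "a(Suc i := x)"]) (auto simp: le_Suc_eq less_Suc_eq)
  qed
  then obtain a where a: "\<forall>k\<le>i. a k \<in> carrier (A k)" "\<forall>k<i. f k (a (Suc k)) = a k" "a i = x"
    by blast
  \<comment> \<open>The clause for n \<le> i pins the choice to the coordinates already found; only
    beyond i is a preimage really chosen.\<close>
  have "\<exists>b. \<forall>n. (b n \<in> carrier (A n) \<and> (n \<le> i \<longrightarrow> b n = a n)) \<and> f n (b (Suc n)) = b n"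
  proof (rule dependent_nat_choice)
    show "\<exists>x. x \<in> carrier (A 0) \<and> (0 \<le> i \<longrightarrow> x = a 0)" using a by auto
  next
    fix y n assume y: "y \<in> carrier (A n) \<and> (n \<le> i \<longrightarrow> y = a n)"
    show "\<exists>z. (z \<in> carrier (A (Suc n)) \<and> (Suc n \<le> i \<longrightarrow> z = a (Suc n))) \<and> f n z = y"
    proof (cases "Suc n \<le> i")
      case True
      then show ?thesis using a y by (intro exI[of _ "a (Suc n)"]) auto
    next
      case False
      then show ?thesis using surj y by blast
    qed
  qed
  then obtain b where "\<forall>n. (b n \<in> carrier (A n) \<and> (n \<le> i \<longrightarrow> b n = a n)) \<and> f n (b (Suc n)) = b n"
    by blast
  then show ?thesis using a(3) by (intro bexI[of _ b]) (auto simp: inv_lim_simps)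
qed

end

section \<open>The tower of Gabber's construction\<close>

lemma ring_hom_char:
  assumes "ring S" "ring T" "h \<in> ring_hom S T" "[p] \<cdot>\<^bsub>S\<^esub> \<one>\<^bsub>S\<^esub> = \<zero>\<^bsub>S\<^esub>"
  shows "[(p::nat)] \<cdot>\<^bsub>T\<^esub> \<one>\<^bsub>T\<^esub> = \<zero>\<^bsub>T\<^esub>"
proof -
  interpret S: ring S by fact
  interpret T: ring T by fact
  have "h ([n] \<cdot>\<^bsub>S\<^esub> \<one>\<^bsub>S\<^esub>) = [n] \<cdot>\<^bsub>T\<^esub> \<one>\<^bsub>T\<^esub>" for n :: nat
    by (induction n) (auto simp: ring_hom_zero[OF assms(3,1,2)] ring_hom_add[OF assms(3)] ring_hom_one[OF assms(3)])
  then show ?thesis using assms(4) ring_hom_zero[OF assms(3,1,2)] by metis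
qed

lemma hom_nat_pow:
  assumes "ring S" "ring T" "h \<in> ring_hom S T" "x \<in> carrier S"
  shows "h (x [^]\<^bsub>S\<^esub> (k::nat)) = h x [^]\<^bsub>T\<^esub> k"
  using ring_hom_ring.hom_nat_pow[OF ring_hom_ringI2[OF assms(1-3)] assms(4)] .

lemma gabber_ring_0: "gabber_ring p R xs 0 = image_ring Base R"
  and gabber_gens_0: "gabber_gens p R xs 0 = map Base xs"
  and gabber_ring_Suc: "gabber_ring p R xs (Suc i) = adjoin_roots p (gabber_ring p R xs i) (gabber_gens p R xs i)"
  and gabber_gens_Suc: "gabber_gens p R xs (Suc i) =
    map (\<lambda>j. poly_class p (gabber_ring p R xs i) (gabber_gens p R xs i) (ring.indexed_var (gabber_ring p R xs i) j))
      [0..<length (gabber_gens p R xs i)]"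
  by (simp_all add: gabber_ring_def gabber_gens_def Let_def split_beta)

locale gabber_tower = cring R for p :: nat and R :: "('a, 'b) ring_scheme" (structure) and xs :: "'a list" +
  assumes prime: "Factorial_Ring.prime p" and char: "[p] \<cdot>\<^bsub>R\<^esub> \<one> = \<zero>" and xs: "set xs \<subseteq> carrier R"
begin

abbreviation A where "A \<equiv> gabber_ring p R xs"
abbreviation Y where "Y \<equiv> gabber_gens p R xs"
abbreviation c where "c \<equiv> gabber_const p R xs"
abbreviation \<phi> where "\<phi> \<equiv> gabber_phi p R xs"
abbreviation n where "n \<equiv> length xs"
abbreviation G where "G \<equiv> gabber p R xs"

lemma Base_iso: "Base \<in> ring_iso R (A 0)"
  unfolding gabber_ring_0 by (rule inj_imp_image_ring_iso) (simp add: inj_on_def)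

lemma Base_hom: "Base \<in> ring_hom R (A 0)"
  using Base_iso by (simp add: ring_iso_def)

lemma carrier_A_0: "carrier (A 0) = Base ` carrier R"
  by (simp add: gabber_ring_0 image_ring_carrier)

lemma cring_A_0: "cring (A 0)"
proof -
  have "cring (A 0 \<lparr>zero := Base \<zero>\<rparr>)"
    by (rule ring_iso_imp_img_cring[OF Base_iso])
  moreover have "A 0 \<lparr>zero := Base \<zero>\<rparr> = A 0"
    by (simp add: gabber_ring_0 image_ring_def image_group_def monoid.defs)
  ultimately show ?thesis by simp
qed

text \<open>The induction carries the locale itself, since membership of the new roots in the next
  ring rests on \<open>root_adjunction\<close> at the current stage. The constant length gives one
  index range for all stages.\<close>

lemma stage: "root_adjunction (A i) (Y i) \<and> length (Y i) = n"
proof (induction i)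
  case 0
  interpret A0: cring "A 0" by (rule cring_A_0)
  show ?case
    using xs by (auto simp: gabber_gens_0 carrier_A_0 root_adjunction_def root_adjunction_axioms_def A0.is_cring)
next
  case (Suc i)
  then interpret B: root_adjunction p "A i" "Y i" by blast
  have "cring (A (Suc i))" unfolding gabber_ring_Suc by (rule B.cring_adjoin_roots)
  moreover have "set (Y (Suc i)) \<subseteq> carrier (A (Suc i))"
    unfolding gabber_ring_Suc gabber_gens_Suc by (auto intro: B.cls_var_closed)
  ultimately show ?case
    using Suc by (auto simp: root_adjunction_def root_adjunction_axioms_def gabber_gens_Suc)
qed

lemma length_Y [simp]: "length (Y i) = n"
  using stage by blast

sublocale adj: root_adjunction p "A i" "Y i" for i
  using stage by blast

lemma cring_A: "cring (A i)" by (rule adj.is_cring)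

lemma Y_closed: "j < n \<Longrightarrow> Y i ! j \<in> carrier (A i)"
  by (rule adj.ys_nth) simp

lemma Y_Suc: "j < n \<Longrightarrow> Y (Suc i) ! j = poly_class p (A i) (Y i) (ring.indexed_var (A i) j)"
  by (simp add: gabber_gens_Suc)

lemma c_hom: "c i \<in> ring_hom (A i) (A (Suc i))"
  using adj.cls_const_hom[of i] by (simp add: gabber_const_def[abs_def] gabber_ring_Suc)

lemma c_closed: "a \<in> carrier (A i) \<Longrightarrow> c i a \<in> carrier (A (Suc i))"
  by (rule ring_hom_closed[OF c_hom])

lemma Y_pow: "j < n \<Longrightarrow> (Y (Suc i) ! j) [^]\<^bsub>A (Suc i)\<^esub> p = c i (Y i ! j)"
  using adj.cls_var_pow[of j i] by (simp add: Y_Suc gabber_const_def gabber_ring_Suc)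

lemma A_Suc_induct [consumes 1, case_names const add var]:
  assumes "a \<in> carrier (A (Suc i))"
    and "\<And>b. b \<in> carrier (A i) \<Longrightarrow> Q (c i b)"
    and "\<And>a b. a \<in> carrier (A (Suc i)) \<Longrightarrow> b \<in> carrier (A (Suc i)) \<Longrightarrow> Q a \<Longrightarrow> Q b \<Longrightarrow>
      Q (a \<oplus>\<^bsub>A (Suc i)\<^esub> b)"
    and "\<And>a j. a \<in> carrier (A (Suc i)) \<Longrightarrow> j < n \<Longrightarrow> Q a \<Longrightarrow> Q (a \<otimes>\<^bsub>A (Suc i)\<^esub> Y (Suc i) ! j)"
  shows "Q a"
  using assms(1)[unfolded gabber_ring_Suc]
proof (induction rule: adj.adjoin_roots_induct)
  case (const b)
  then show ?case using assms(2) by (simp add: gabber_const_def)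
next
  case (add a b)
  then show ?case using assms(3) by (simp add: gabber_ring_Suc)
next
  case (var a j)
  then show ?case using assms(4)[of a j] by (simp add: gabber_ring_Suc Y_Suc)
qed

lemma A_Suc_hom_eqI:
  assumes "f \<in> ring_hom (A (Suc i)) T" "g \<in> ring_hom (A (Suc i)) T"
    and "\<And>b. b \<in> carrier (A i) \<Longrightarrow> f (c i b) = g (c i b)"
    and "\<And>j. j < n \<Longrightarrow> f (Y (Suc i) ! j) = g (Y (Suc i) ! j)"
    and "a \<in> carrier (A (Suc i))"
  shows "f a = g a"
  by (rule adj.adjoin_roots_hom_eqI[of f i T g])
    (use assms in \<open>auto simp: gabber_ring_Suc gabber_const_def Y_Suc\<close>)

context
  fixes T :: "('c, 'd) ring_scheme" and h :: "'a tower \<Rightarrow> 'c" and zs :: "'c list" and i :: nat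
  assumes lift: "cring T" "h \<in> ring_hom (A i) T" "set zs \<subseteq> carrier T" "length zs = n"
    "\<And>j. j < n \<Longrightarrow> (zs ! j) [^]\<^bsub>T\<^esub> p = h (Y i ! j)"
begin

lemma lift_hom: "adjoin_lift (A i) T h zs \<in> ring_hom (A (Suc i)) T"
  unfolding gabber_ring_Suc using lift by (intro adj.adjoin_lift_hom) auto

lemma lift_c: "a \<in> carrier (A i) \<Longrightarrow> adjoin_lift (A i) T h zs (c i a) = h a"
  unfolding gabber_const_def using lift by (intro adj.adjoin_lift_const) auto

lemma lift_Y: "j < n \<Longrightarrow> adjoin_lift (A i) T h zs (Y (Suc i) ! j) = zs ! j"
  using adj.adjoin_lift_var[of T h i zs j] lift by (simp add: Y_Suc)

end

lemma char_A: "[p] \<cdot>\<^bsub>A i\<^esub> \<one>\<^bsub>A i\<^esub> = \<zero>\<^bsub>A i\<^esub>"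
proof (induction i)
  case 0
  show ?case by (rule ring_hom_char[OF ring_axioms adj.ring_axioms Base_hom char])
next
  case (Suc i)
  show ?case by (rule ring_hom_char[OF adj.ring_axioms adj.ring_axioms c_hom Suc])
qed

lemma frob_A: "(\<lambda>r. r [^]\<^bsub>A i\<^esub> p) \<in> ring_hom (A i) (A i)"
  by (rule adj.frobenius_hom[OF prime char_A])

text \<open>The universal property with Frobenius as the map on constants. The required relation is
  immediate: the p-th power of \<open>Y i ! j\<close> is its image under Frobenius.\<close>

lemma phi_hom: "\<phi> i \<in> ring_hom (A (Suc i)) (A i)"
  unfolding gabber_phi_def using adj.ys by (intro lift_hom cring_A frob_A) auto

lemma phi_c: "a \<in> carrier (A i) \<Longrightarrow> \<phi> i (c i a) = a [^]\<^bsub>A i\<^esub> p"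
  unfolding gabber_phi_def using adj.ys by (subst lift_c[OF cring_A frob_A]) auto

lemma phi_Y: "j < n \<Longrightarrow> \<phi> i (Y (Suc i) ! j) = Y i ! j"
  unfolding gabber_phi_def using adj.ys by (subst lift_Y[OF cring_A frob_A]) auto

text \<open>Both sides are homomorphisms. On c(b) both give c(b)^p because \<phi>(c(b)) = b^p, and
  on a root both give c(Y_j), which is the p-th power of the new root by construction.\<close>

lemma c_phi: "a \<in> carrier (A (Suc i)) \<Longrightarrow> c i (\<phi> i a) = a [^]\<^bsub>A (Suc i)\<^esub> p"
proof (rule A_Suc_hom_eqI[of "\<lambda>a. c i (\<phi> i a)" i "A (Suc i)" "\<lambda>a. a [^]\<^bsub>A (Suc i)\<^esub> p"])
  show "(\<lambda>a. c i (\<phi> i a)) \<in> ring_hom (A (Suc i)) (A (Suc i))"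
    using ring_hom_trans[OF phi_hom c_hom] by (simp add: comp_def)
next
  fix b assume b: "b \<in> carrier (A i)"
  show "c i (\<phi> i (c i b)) = c i b [^]\<^bsub>A (Suc i)\<^esub> p"
    using b by (simp add: phi_c hom_nat_pow[OF adj.ring_axioms adj.ring_axioms c_hom])
qed (simp_all add: frob_A phi_Y Y_pow)

sublocale lim: inverse_system A \<phi>
  by unfold_locales (auto intro: cring_A[unfolded cring_def] phi_hom cring_A)

sublocale G: cring G
  unfolding gabber_def by (rule lim.inv_lim_cring)

lemma G_carrier: "g \<in> carrier G \<longleftrightarrow> (\<forall>i. g i \<in> carrier (A i) \<and> \<phi> i (g (Suc i)) = g i)"
  unfolding gabber_def by (rule lim.inv_lim_simps)

lemma G_closed: "g \<in> carrier G \<Longrightarrow> g i \<in> carrier (A i)"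
  and G_phi: "g \<in> carrier G \<Longrightarrow> \<phi> i (g (Suc i)) = g i"
  by (simp_all add: G_carrier)

lemma G_proj: "(\<lambda>g. g i) \<in> ring_hom G (A i)"
  unfolding gabber_def by (rule lim.inv_lim_proj_hom)

lemmas G_simps = lim.inv_lim_simps(2-5)[folded gabber_def]

lemma G_pow: "g \<in> carrier G \<Longrightarrow> (g [^]\<^bsub>G\<^esub> k) i = g i [^]\<^bsub>A i\<^esub> (k::nat)"
  by (rule hom_nat_pow[OF G.ring_axioms adj.ring_axioms G_proj])

text \<open>A compatible sequence has \<phi>(g_(i+1)) = g_i; applying \<open>c\<close> turns this
  into a p-th power. Every exponent p^i further on arises by iterating this identity.\<close>

lemma G_pow_p: "g \<in> carrier G \<Longrightarrow> g (Suc i) [^]\<^bsub>A (Suc i)\<^esub> p = c i (g i)"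
  using c_phi[of "g (Suc i)" i] by (simp add: G_closed G_phi)

end

section \<open>Finite generation of ideals in finite algebras\<close>

lemma (in cring) cring_idealI:
  assumes "I \<subseteq> carrier R" "\<zero> \<in> I" "\<And>a b. a \<in> I \<Longrightarrow> b \<in> I \<Longrightarrow> a \<oplus> b \<in> I"
    and mult: "\<And>a x. a \<in> I \<Longrightarrow> x \<in> carrier R \<Longrightarrow> x \<otimes> a \<in> I"
  shows "ideal I R"
proof (rule idealI[OF ring_axioms])
  show "subgroup I (add_monoid R)"
  proof (rule add.subgroupI)
    fix a assume a: "a \<in> I"
    then have "\<ominus> a = \<ominus> \<one> \<otimes> a" using assms(1) by (auto simp: l_minus)
    then show "\<ominus> a \<in> I" using mult[OF a, of "\<ominus> \<one>"] by simp
  qed (use assms in auto)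
  fix a x assume "a \<in> I" "x \<in> carrier R"
  then show "x \<otimes> a \<in> I" "a \<otimes> x \<in> I"
    using mult assms(1) m_comm[of a x] by auto
qed

text \<open>\<open>B\<close> is regarded as an S-module along \<open>c\<close>. Its submodules are
  plain subsets of \<open>B\<close>, so that ideals of \<open>B\<close> are among them
  directly.\<close>

locale coefficient_hom = S: cring S + B: cring B
  for S :: "('a, 'b) ring_scheme" and B :: "('c, 'd) ring_scheme" (structure) and c :: "'a \<Rightarrow> 'c" +
  assumes c_hom: "c \<in> ring_hom S B"
begin

definition submod :: "'c set \<Rightarrow> bool" where
  "submod N \<longleftrightarrow> N \<subseteq> carrier B \<and> \<zero> \<in> N \<and> (\<forall>x\<in>N. \<forall>y\<in>N. x \<oplus> y \<in> N) \<and>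
    (\<forall>s\<in>carrier S. \<forall>x\<in>N. c s \<otimes> x \<in> N)"

primrec lspan :: "'c list \<Rightarrow> 'c set" where
  "lspan [] = {\<zero>}"
| "lspan (e # es) = {c s \<otimes> e \<oplus> b | s b. s \<in> carrier S \<and> b \<in> lspan es}"

lemma c_closed [simp]: "s \<in> carrier S \<Longrightarrow> c s \<in> carrier B"
  by (rule ring_hom_closed[OF c_hom])

lemma c_zero: "c \<zero>\<^bsub>S\<^esub> = \<zero>"
  by (rule ring_hom_zero[OF c_hom S.ring_axioms B.ring_axioms])

lemma c_neg_one: "c (\<ominus>\<^bsub>S\<^esub> \<one>\<^bsub>S\<^esub>) = \<ominus> \<one>"
proof -
  interpret h: ring_hom_ring S B c by (intro ring_hom_ringI2 S.ring_axioms B.ring_axioms c_hom)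
  show ?thesis by simp
qed

lemma submodD:
  assumes "submod N"
  shows "N \<subseteq> carrier B" "\<zero> \<in> N" "x \<in> N \<Longrightarrow> y \<in> N \<Longrightarrow> x \<oplus> y \<in> N"
    "s \<in> carrier S \<Longrightarrow> x \<in> N \<Longrightarrow> c s \<otimes> x \<in> N" "x \<in> N \<Longrightarrow> y \<in> N \<Longrightarrow> x \<ominus> y \<in> N"
proof -
  show "x \<ominus> y \<in> N" if x: "x \<in> N" and y: "y \<in> N"
  proof -
    have "y \<in> carrier B" using y assms by (auto simp: submod_def)
    then have "\<ominus> y = c (\<ominus>\<^bsub>S\<^esub> \<one>\<^bsub>S\<^esub>) \<otimes> y"
      by (simp add: c_neg_one B.l_minus)
    then have "\<ominus> y \<in> N" using y assms by (simp add: submod_def)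
    then show ?thesis using x assms by (simp add: submod_def a_minus_def)
  qed
qed (use assms in \<open>auto simp: submod_def\<close>)

lemma submod_Int: "submod M \<Longrightarrow> submod N \<Longrightarrow> submod (M \<inter> N)"
  by (auto simp: submod_def)

lemma submod_lspan:
  assumes "set es \<subseteq> carrier B"
  shows "submod (lspan es)"
  using assms
proof (induction es)
  case Nil
  then show ?case by (simp add: submod_def)
next
  case (Cons e es)
  then have e: "e \<in> carrier B" and L: "submod (lspan es)" by auto
  note L' = submodD[OF L]
  show ?case
    unfolding submod_def
  proof (intro conjI ballI)
    show "lspan (e # es) \<subseteq> carrier B" using e L'(1) by auto
    show "\<zero> \<in> lspan (e # es)"
      using L'(2) e by (auto intro!: exI[of _ "\<zero>\<^bsub>S\<^esub>"] exI[of _ "\<zero>"] simp: c_zero)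
  next
    fix x y assume "x \<in> lspan (e # es)" "y \<in> lspan (e # es)"
    then obtain s b t d where *: "s \<in> carrier S" "b \<in> lspan es" "x = c s \<otimes> e \<oplus> b"
      "t \<in> carrier S" "d \<in> lspan es" "y = c t \<otimes> e \<oplus> d" by auto
    then have "b \<in> carrier B" "d \<in> carrier B" using L'(1) by auto
    then have "x \<oplus> y = c (s \<oplus>\<^bsub>S\<^esub> t) \<otimes> e \<oplus> (b \<oplus> d)"
      using * e by (simp add: ring_hom_add[OF c_hom] B.l_distr B.a_ac)
    then show "x \<oplus> y \<in> lspan (e # es)" using * L'(3) by auto
  next
    fix s x assume s: "s \<in> carrier S" and "x \<in> lspan (e # es)"
    then obtain t b where *: "t \<in> carrier S" "b \<in> lspan es" "x = c t \<otimes> e \<oplus> b" by auto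
    then have "b \<in> carrier B" using L'(1) by auto
    then have "c s \<otimes> x = c (s \<otimes>\<^bsub>S\<^esub> t) \<otimes> e \<oplus> c s \<otimes> b"
      using * e s by (simp add: ring_hom_mult[OF c_hom] B.r_distr B.m_assoc)
    then show "c s \<otimes> x \<in> lspan (e # es)" using * s L'(4) by auto
  qed
qed

lemma lspan_mem:
  assumes "set es \<subseteq> carrier B" "e \<in> set es"
  shows "e \<in> lspan es"
  using assms
proof (induction es)
  case (Cons e' es)
  have L: "submod (lspan es)" by (rule submod_lspan) (use Cons in simp)
  show ?case
  proof (cases "e = e'")
    case True
    then have "e = c \<one>\<^bsub>S\<^esub> \<otimes> e' \<oplus> \<zero>"
      using Cons.prems by (simp add: ring_hom_one[OF c_hom])
    then show ?thesis using submodD(2)[OF L] by auto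
  next
    case False
    then have "e \<in> lspan es" using Cons by simp
    moreover from this have "e = c \<zero>\<^bsub>S\<^esub> \<otimes> e' \<oplus> e"
      using Cons.prems submodD(1)[OF L] by (auto simp: c_zero)
    ultimately show ?thesis using S.zero_closed unfolding lspan.simps by blast
  qed
qed simp

lemma lspan_mult_closed:
  assumes es: "set es \<subseteq> carrier B" and y: "y \<in> carrier B" and N: "submod N"
    and "\<And>e. e \<in> set es \<Longrightarrow> e \<otimes> y \<in> N" and "a \<in> lspan es"
  shows "a \<otimes> y \<in> N"
  using assms(1,4,5)
proof (induction es arbitrary: a)
  case Nil
  then show ?case using y submodD(2)[OF N] by simp
next
  case (Cons e es)
  then obtain s b where sb: "s \<in> carrier S" "b \<in> lspan es" "a = c s \<otimes> e \<oplus> b" by auto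
  have "b \<in> carrier B" using sb submodD(1)[OF submod_lspan, of es] Cons.prems by auto
  then have "a \<otimes> y = c s \<otimes> (e \<otimes> y) \<oplus> b \<otimes> y"
    using sb y Cons.prems by (simp add: B.l_distr B.m_assoc)
  moreover have "b \<otimes> y \<in> N" using Cons sb by simp
  moreover have "c s \<otimes> (e \<otimes> y) \<in> N" using Cons.prems sb submodD(4)[OF N] by simp
  ultimately show ?case using submodD(3)[OF N] by simp
qed

text \<open>The ideal of leading coefficients: with L the span of the remaining generators, it
  collects the coefficients of e that occur in N modulo L.\<close>

lemma leading_ideal:
  assumes e: "e \<in> carrier B" and L: "submod L" and N: "submod N"
  shows "ideal {s \<in> carrier S. \<exists>b\<in>L. c s \<otimes> e \<oplus> b \<in> N} S" (is "ideal ?D S")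
proof (rule S.cring_idealI)
  note L' = submodD[OF L] and N' = submodD[OF N]
  show "\<zero>\<^bsub>S\<^esub> \<in> ?D"
    using L'(2) N'(2) e by (auto intro!: bexI[of _ "\<zero>"] simp: c_zero)
next
  note L' = submodD[OF L] and N' = submodD[OF N]
  fix s t assume "s \<in> ?D"
    "t \<in> ?D"
  then obtain b d where *: "s \<in> carrier S" "b \<in> L" "c s \<otimes> e \<oplus> b \<in> N"
      "t \<in> carrier S" "d \<in> L" "c t \<otimes> e \<oplus> d \<in> N" by auto
  then have "b \<in> carrier B" "d \<in> carrier B" using L'(1) by auto
  then have "c (s \<oplus>\<^bsub>S\<^esub> t) \<otimes> e \<oplus> (b \<oplus> d) = (c s \<otimes> e \<oplus> b) \<oplus> (c t \<otimes> e \<oplus> d)"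
    using * e by (simp add: ring_hom_add[OF c_hom] B.l_distr B.a_ac)
  then have "c (s \<oplus>\<^bsub>S\<^esub> t) \<otimes> e \<oplus> (b \<oplus> d) \<in> N" using * N'(3) by simp
  then show "s \<oplus>\<^bsub>S\<^esub> t \<in> ?D"
    using * L'(3) by blast
next
  note L' = submodD[OF L] and N' = submodD[OF N]
  fix t s assume "t \<in> ?D" and s: "s \<in> carrier S"
  then obtain b where *: "t \<in> carrier S" "b \<in> L" "c t \<otimes> e \<oplus> b \<in> N" by auto
  then have "b \<in> carrier B" using L'(1) by auto
  then have "c (s \<otimes>\<^bsub>S\<^esub> t) \<otimes> e \<oplus> c s \<otimes> b = c s \<otimes> (c t \<otimes> e \<oplus> b)"
    using * e s by (simp add: ring_hom_mult[OF c_hom] B.r_distr B.m_assoc)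
  then have "c (s \<otimes>\<^bsub>S\<^esub> t) \<otimes> e \<oplus> c s \<otimes> b \<in> N" using * s N'(4) by simp
  then show "s \<otimes>\<^bsub>S\<^esub> t \<in> ?D"
    using * s L'(4) by blast
qed auto

text \<open>Submodules of a finite module over a noetherian ring are finitely generated. Induction
  on the generators: lifts of finitely many leading coefficients at e are joined to generators of N
  \<inter> \<open>lspan es\<close>. Finite generation is phrased by minimality among submodules,
  which serves ideals as well.\<close>

lemma submod_finite:
  assumes noeth: "noetherian_ring S" and "set es \<subseteq> carrier B" "submod N" "N \<subseteq> lspan es"
  shows "\<exists>F. finite F \<and> F \<subseteq> N \<and> (\<forall>N'. submod N' \<and> F \<subseteq> N' \<longrightarrow> N \<subseteq> N')"
  using assms(2-)
proof (induction es arbitrary: N)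
  case Nil
  then show ?case by (intro exI[of _ "{}"]) (auto simp: submod_def)
next
  case (Cons e es)
  have e: "e \<in> carrier B" and es: "set es \<subseteq> carrier B" using Cons.prems by auto
  note N = Cons.prems(2)
  let ?L = "lspan es"
  have L: "submod ?L" by (rule submod_lspan[OF es])
  let ?D = "\<lambda>M. {s \<in> carrier S. \<exists>b\<in>?L. c s \<otimes> e \<oplus> b \<in> M}"
  obtain F0 where F0: "finite F0" "F0 \<subseteq> carrier S" "?D N = Idl\<^bsub>S\<^esub> F0"
    using noetherian_ring.finetely_gen[OF noeth leading_ideal[OF e L N]] by (elim exE conjE)
  have "F0 \<subseteq> ?D N" unfolding F0(3) by (rule S.genideal_self[OF F0(2)])
  then have "\<forall>d\<in>F0. \<exists>b\<in>?L. c d \<otimes> e \<oplus> b \<in> N" by auto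
  then obtain \<beta> where \<beta>: "\<And>d. d \<in> F0 \<Longrightarrow> \<beta> d \<in> ?L \<and> c d \<otimes> e \<oplus> \<beta> d \<in> N"
    using bchoice[of F0 "\<lambda>d b. b \<in> ?L \<and> c d \<otimes> e \<oplus> b \<in> N"] by blast
  obtain F1 where F1: "finite F1" "F1 \<subseteq> N \<inter> ?L"
    "\<forall>N'. submod N' \<and> F1 \<subseteq> N' \<longrightarrow> N \<inter> ?L \<subseteq> N'"
    using Cons.IH[OF es submod_Int[OF N L] Int_lower2] by (elim exE conjE)
  let ?F = "(\<lambda>d. c d \<otimes> e \<oplus> \<beta> d) ` F0 \<union> F1"
  have "N \<subseteq> M" if M: "submod M" and FM: "?F \<subseteq> M" for M
  proof
    fix x assume x: "x \<in> N"
    \<comment> \<open>Working in M \<inter> N ensures that the element found with the leading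
      coefficient of x also lies in N, so that its difference from x stays in N.\<close>
    let ?M = "M \<inter> N"
    have M': "submod ?M" by (rule submod_Int[OF M N])
    have FM': "?F \<subseteq> ?M" using FM \<beta> F1(2) by auto
    have "F0 \<subseteq> ?D ?M"
    proof
      fix d assume d: "d \<in> F0"
      then have "c d \<otimes> e \<oplus> \<beta> d \<in> ?M" using FM' by auto
      then show "d \<in> ?D ?M" using d \<beta> F0(2) by blast
    qed
    then have DD: "?D N \<subseteq> ?D ?M"
      unfolding F0(3) by (rule S.genideal_minimal[OF leading_ideal[OF e L M']])
    obtain s b where sb: "s \<in> carrier S" "b \<in> ?L" "x = c s \<otimes> e \<oplus> b"
      using x Cons.prems(3) by auto
    then have "s \<in> ?D N" using x by blast
    then obtain b' where b': "b' \<in> ?L" "c s \<otimes> e \<oplus> b' \<in> ?M" using DD by blast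
    have bc: "b \<in> carrier B" "b' \<in> carrier B" using sb b' submodD(1)[OF L] by auto
    \<comment> \<open>The two elements have the same coefficient s at e, so the difference falls
      into the span of the remaining generators.\<close>
    have diff: "x \<ominus> (c s \<otimes> e \<oplus> b') = b \<ominus> b'"
      unfolding sb(3) using bc e c_closed[OF sb(1)] by algebra
    have "b \<ominus> b' \<in> N"
      unfolding diff[symmetric] using x b' submodD(5)[OF N] by blast
    then have "b \<ominus> b' \<in> N \<inter> ?L" using sb b' submodD(5)[OF L] by blast
    moreover have "N \<inter> ?L \<subseteq> ?M" using F1(3) M' FM' by (meson Un_subset_iff)
    ultimately have "b \<ominus> b' \<in> ?M" by (rule subsetD[rotated])
    then have "(b \<ominus> b') \<oplus> (c s \<otimes> e \<oplus> b') \<in> ?M"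
      using b' submodD(3)[OF M'] by blast
    moreover have "(b \<ominus> b') \<oplus> (c s \<otimes> e \<oplus> b') = x"
      unfolding sb(3) using bc e c_closed[OF sb(1)] by algebra
    ultimately show "x \<in> M" by simp
  qed
  moreover have "finite ?F" using F0(1) F1(1) by simp
  moreover have "?F \<subseteq> N" using F1(2) \<beta> by blast
  ultimately show ?case by (intro exI[of _ ?F] conjI allI impI) simp_all
qed

text \<open>An ideal of \<open>B\<close> is an S-submodule, and so is \<open>Idl F\<close>;
  minimality of N among submodules containing F gives the nontrivial inclusion.\<close>

lemma ideal_finite:
  assumes noeth: "noetherian_ring S" and es: "set es \<subseteq> carrier B" "carrier B \<subseteq> lspan es"
    and N: "ideal N B"
  shows "\<exists>F. finite F \<and> F \<subseteq> N \<and> N = Idl F"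
proof -
  have sub: "submod M" if "ideal M B" for M
  proof -
    interpret ideal M B by fact
    show ?thesis unfolding submod_def using a_subset I_l_closed a_closed zero_closed by auto
  qed
  have Nc: "N \<subseteq> carrier B" using N by (meson additive_subgroup.a_subset ideal.axioms(1))
  then have NL: "N \<subseteq> lspan es" using es(2) by (rule order_trans)
  obtain F where F: "finite F" "F \<subseteq> N" "\<forall>M. submod M \<and> F \<subseteq> M \<longrightarrow> N \<subseteq> M"
    using submod_finite[OF noeth es(1) sub[OF N] NL] by (elim exE conjE)
  have Fc: "F \<subseteq> carrier B" using F(2) Nc by blast
  have "N \<subseteq> Idl F" by (rule F(3)[rule_format, OF conjI, OF sub[OF B.genideal_ideal[OF Fc]] B.genideal_self[OF Fc]])
  moreover have "Idl F \<subseteq> N" by (rule B.genideal_minimal[OF N F(2)])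
  ultimately show ?thesis using F by blast
qed

end

section \<open>The kernels of the projections of \<open>G\<close>\<close>

text \<open>Combinations are indexed by F and not by the image of u, because the family used later,
  f to f^(p^i), may identify different elements.\<close>

lemma (in cring) genideal_finite_family:
  assumes F: "finite F" and u: "u \<in> F \<rightarrow> carrier R" and x: "x \<in> Idl (u ` F)"
  shows "\<exists>a\<in>F \<rightarrow> carrier R. x = (\<Oplus>f\<in>F. a f \<otimes> u f)"
proof -
  let ?I = "{\<Oplus>f\<in>F. a f \<otimes> u f | a. a \<in> F \<rightarrow> carrier R}"
  have uc: "u f \<in> carrier R" if "f \<in> F" for f using u that by auto
  have "ideal ?I R"
  proof (rule cring_idealI)
    show "?I \<subseteq> carrier R" using uc by (auto intro!: finsum_closed)
    have "(\<Oplus>f\<in>F. \<zero> \<otimes> u f) = \<zero>" using uc by (intro add.finprod_one_eqI) auto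
    then show "\<zero> \<in> ?I" by (intro CollectI exI[of _ "\<lambda>_. \<zero>"]) auto
  next
    fix x y assume "x \<in> ?I" "y \<in> ?I"
    then obtain a b where ab: "a \<in> F \<rightarrow> carrier R" "x = (\<Oplus>f\<in>F. a f \<otimes> u f)"
      "b \<in> F \<rightarrow> carrier R" "y = (\<Oplus>f\<in>F. b f \<otimes> u f)" by blast
    have "x \<oplus> y = (\<Oplus>f\<in>F. a f \<otimes> u f \<oplus> b f \<otimes> u f)"
      unfolding ab by (rule finsum_addf[symmetric]) (use ab uc in auto)
    also have "\<dots> = (\<Oplus>f\<in>F. (a f \<oplus> b f) \<otimes> u f)"
      by (rule finsum_cong') (use ab uc in \<open>auto simp: l_distr Pi_iff\<close>)
    finally show "x \<oplus> y \<in> ?I" using ab by (intro CollectI exI[of _ "\<lambda>f. a f \<oplus> b f"]) auto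
  next
    fix x r assume "x \<in> ?I" and r: "r \<in> carrier R"
    then obtain a where a: "a \<in> F \<rightarrow> carrier R" "x = (\<Oplus>f\<in>F. a f \<otimes> u f)" by blast
    have "r \<otimes> x = (\<Oplus>f\<in>F. r \<otimes> (a f \<otimes> u f))"
      unfolding a by (rule finsum_rdistr) (use F a uc r in auto)
    also have "\<dots> = (\<Oplus>f\<in>F. (r \<otimes> a f) \<otimes> u f)"
      by (rule finsum_cong') (use a uc r in \<open>auto simp: m_assoc Pi_iff\<close>)
    finally show "r \<otimes> x \<in> ?I" using a r by (intro CollectI exI[of _ "\<lambda>f. r \<otimes> a f"]) auto
  qed
  moreover have "u ` F \<subseteq> ?I"
  proof clarify
    fix f assume f: "f \<in> F"
    let ?a = "\<lambda>g. if f = g then \<one> else \<zero>"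
    have "(\<Oplus>g\<in>F. ?a g \<otimes> u g) = (\<Oplus>g\<in>F. if f = g then u g else \<zero>)"
      by (rule finsum_cong') (use uc in auto)
    also have "\<dots> = u f" by (rule finsum_singleton[OF f F u])
    finally show "\<exists>a. u f = (\<Oplus>g\<in>F. a g \<otimes> u g) \<and> a \<in> F \<rightarrow> carrier R"
      by (intro exI[of _ ?a]) auto
  qed
  ultimately have "Idl (u ` F) \<subseteq> ?I" by (rule genideal_minimal)
  then show ?thesis using x by blast
qed

lemma (in cring) ideal_vimage_cring:
  assumes T: "cring T" and h: "h \<in> ring_hom R T" and I: "ideal I T"
  shows "ideal {x \<in> carrier R. h x \<in> I} R"
proof -
  interpret T: cring T by fact
  interpret I: ideal I T by fact
  show ?thesis
    by (rule cring_idealI)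
      (auto simp: ring_hom_zero[OF h ring_axioms T.ring_axioms] ring_hom_add[OF h] ring_hom_mult[OF h]
        ring_hom_closed[OF h] intro: I.a_closed I.I_l_closed)
qed

lemma (in cring) ideal_image_surj:
  assumes T: "cring T" and h: "h \<in> ring_hom R T" and I: "ideal I R"
    and surj: "\<And>t. t \<in> carrier T \<Longrightarrow> \<exists>x\<in>carrier R. h x = t"
  shows "ideal (h ` I) T"
proof -
  interpret T: cring T by fact
  interpret I: ideal I R by fact
  show ?thesis
  proof (rule T.cring_idealI)
    show "h ` I \<subseteq> carrier T" using ring_hom_closed[OF h] I.a_Hcarr by blast
    show "\<zero>\<^bsub>T\<^esub> \<in> h ` I"
      using ring_hom_zero[OF h ring_axioms T.ring_axioms] I.zero_closed by (metis imageI)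
  next
    fix a b assume "a \<in> h ` I" "b \<in> h ` I"
    then obtain x y where xy: "x \<in> I" "a = h x" "y \<in> I" "b = h y" by blast
    then have "a \<oplus>\<^bsub>T\<^esub> b = h (x \<oplus> y)" using I.a_Hcarr ring_hom_add[OF h] by simp
    then show "a \<oplus>\<^bsub>T\<^esub> b \<in> h ` I" using xy I.a_closed by simp
  next
    fix a t assume "a \<in> h ` I" and t: "t \<in> carrier T"
    then obtain x where x: "x \<in> I" "a = h x" by blast
    obtain y where y: "y \<in> carrier R" "h y = t" using surj[OF t] by blast
    have "t \<otimes>\<^bsub>T\<^esub> a = h (y \<otimes> x)" using x y I.a_Hcarr ring_hom_mult[OF h] by simp
    then show "t \<otimes>\<^bsub>T\<^esub> a \<in> h ` I" using x y I.I_l_closed by simp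
  qed
qed

lemma (in cring) ideal_kernel:
  assumes T: "ring T" and h: "h \<in> ring_hom R T"
  shows "ideal {x \<in> carrier R. h x = \<zero>\<^bsub>T\<^esub>} R"
  using ring_hom_ring.kernel_is_ideal[OF ring_hom_ringI2[OF ring_axioms T h]]
  by (simp add: a_kernel_def')

section \<open>Surjectivity and kernels of the transition maps\<close>

context gabber_tower
begin

text \<open>At stage 0 the image contains the p-th powers, as \<phi>(c(r)) = r^p, and the elements
  of \<open>xs\<close>, as images of the roots; these generate \<open>R\<close>. Later, if b =
  \<phi>(x), then c(b) = x^p = \<phi>(c(x)), and roots are images of roots.\<close>

lemma phi_surj:
  assumes gen: "p_generating p R xs" and "y \<in> carrier (A i)"
  shows "\<exists>x\<in>carrier (A (Suc i)). \<phi> i x = y"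
  using assms(2)
proof (induction i arbitrary: y)
  case 0
  interpret h: ring_hom_ring "A (Suc 0)" "A 0" "\<phi> 0"
    by (intro ring_hom_ringI2 adj.ring_axioms phi_hom)
  interpret B: ring_hom_ring R "A 0" Base
    by (intro ring_hom_ringI2 adj.ring_axioms ring_axioms Base_hom)
  obtain r where r: "r \<in> carrier R" "y = Base r" using 0 by (auto simp: carrier_A_0)
  let ?H = "(\<lambda>r. r [^] p) ` carrier R \<union> set xs"
  have H: "?H \<subseteq> carrier R" using xs by auto
  have "r \<in> generate_ring R ?H"
    using gen r(1) by (simp add: p_generating_def)
  then have "\<exists>x\<in>carrier (A (Suc 0)). \<phi> 0 x = Base r"
  proof (induction rule: generate_ring.induct)
    case one
    then show ?case by (intro bexI[of _ "\<one>\<^bsub>A (Suc 0)\<^esub>"]) auto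
  next
    case (incl r)
    then consider s where "s \<in> carrier R" "r = s [^] p" | j where "j < n" "r = xs ! j"
      by (auto simp: in_set_conv_nth)
    then show ?case
    proof cases
      case (1 s)
      then have "Base s \<in> carrier (A 0)" by (simp add: carrier_A_0)
      then show ?thesis
        using 1 by (intro bexI[of _ "c 0 (Base s)"]) (auto simp: phi_c c_closed B.hom_nat_pow)
    next
      case (2 j)
      then show ?thesis
        using Y_closed[of j 1] by (intro bexI[of _ "Y 1 ! j"]) (auto simp: phi_Y gabber_gens_0)
    qed
  next
    case (a_inv r)
    then obtain x where "x \<in> carrier (A (Suc 0))" "\<phi> 0 x = Base r" by blast
    then show ?case
      using generate_ring_in_carrier[OF H a_inv.hyps] by (intro bexI[of _ "\<ominus>\<^bsub>A (Suc 0)\<^esub> x"]) auto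
  next
    case (eng_add r s)
    then obtain x y where "x \<in> carrier (A (Suc 0))" "\<phi> 0 x = Base r"
      "y \<in> carrier (A (Suc 0))" "\<phi> 0 y = Base s" by blast
    then show ?case
      using generate_ring_in_carrier[OF H eng_add.hyps(1)] generate_ring_in_carrier[OF H eng_add.hyps(2)]
      by (intro bexI[of _ "x \<oplus>\<^bsub>A (Suc 0)\<^esub> y"]) auto
  next
    case (eng_mult r s)
    then obtain x y where "x \<in> carrier (A (Suc 0))" "\<phi> 0 x = Base r"
      "y \<in> carrier (A (Suc 0))" "\<phi> 0 y = Base s" by blast
    then show ?case
      using generate_ring_in_carrier[OF H eng_mult.hyps(1)] generate_ring_in_carrier[OF H eng_mult.hyps(2)]
      by (intro bexI[of _ "x \<otimes>\<^bsub>A (Suc 0)\<^esub> y"]) auto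
  qed
  then show ?case using r by simp
next
  case (Suc i)
  from Suc.prems show ?case
  proof (induction rule: A_Suc_induct)
    case (const b)
    then obtain x where x: "x \<in> carrier (A (Suc i))" "\<phi> i x = b" using Suc.IH by blast
    then have "\<phi> (Suc i) (c (Suc i) x) = c i b" by (simp add: phi_c c_phi[symmetric])
    then show ?case using x c_closed by blast
  next
    case (add a b)
    then obtain x y where "x \<in> carrier (A (Suc (Suc i)))" "\<phi> (Suc i) x = a"
      "y \<in> carrier (A (Suc (Suc i)))" "\<phi> (Suc i) y = b" by blast
    then show ?case
      by (intro bexI[of _ "x \<oplus>\<^bsub>A (Suc (Suc i))\<^esub> y"]) (auto simp: ring_hom_add[OF phi_hom])
  next
    case (var a j)
    then obtain x where "x \<in> carrier (A (Suc (Suc i)))" "\<phi> (Suc i) x = a" by blast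
    then show ?case
      using var Y_closed[of j "Suc (Suc i)"]
      by (intro bexI[of _ "x \<otimes>\<^bsub>A (Suc (Suc i))\<^esub> Y (Suc (Suc i)) ! j"])
        (auto simp: ring_hom_mult[OF phi_hom] phi_Y)
  qed
qed

text \<open>By the universal property, \<open>R\<^sub>i \<rightarrow> R\<^sub>i\<^sub>+\<^sub>2/(c(ker \<phi>\<^sub>i))\<close> extends to \<open>R\<^sub>i\<^sub>+\<^sub>1\<close>, and composing with
  \<open>\<phi>\<^sub>i\<^sub>+\<^sub>1\<close> gives the quotient map; this replaces an argument by flatness of \<open>R\<^sub>i\<^sub>+\<^sub>1\<close> over \<open>R\<^sub>i\<close>.\<close>

lemma ker_phi_Suc:
  assumes gen: "p_generating p R xs"
    and x: "x \<in> carrier (A (Suc (Suc i)))" "\<phi> (Suc i) x = \<zero>\<^bsub>A (Suc i)\<^esub>"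
  shows "x \<in> Idl\<^bsub>A (Suc (Suc i))\<^esub> (c (Suc i) ` {b \<in> carrier (A (Suc i)). \<phi> i b = \<zero>\<^bsub>A i\<^esub>})"
proof -
  let ?B = "A (Suc (Suc i))" and ?K = "{b \<in> carrier (A (Suc i)). \<phi> i b = \<zero>\<^bsub>A i\<^esub>}"
  let ?I = "Idl\<^bsub>?B\<^esub> (c (Suc i) ` ?K)"
  have Kc: "c (Suc i) ` ?K \<subseteq> carrier ?B" using c_closed by auto
  interpret I: ideal ?I ?B by (rule adj.genideal_ideal[OF Kc])
  interpret Q: cring "?B Quot ?I" by (rule I.quotient_is_cring[OF cring_A])
  let ?\<pi> = "(+>\<^bsub>?B\<^esub>) ?I"
  have pi: "?\<pi> \<in> ring_hom ?B (?B Quot ?I)" by (rule I.rcos_ring_hom)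
  have picm: "(\<lambda>a. ?\<pi> (c (Suc i) a)) \<in> ring_hom (A (Suc i)) (?B Quot ?I)"
    using ring_hom_trans[OF c_hom pi] by (simp add: comp_def)
  interpret pc: ring_hom_ring "A (Suc i)" "?B Quot ?I" "\<lambda>a. ?\<pi> (c (Suc i) a)"
    by (intro ring_hom_ringI2 adj.ring_axioms Q.ring_axioms picm)
  interpret ph: ring_hom_ring "A (Suc i)" "A i" "\<phi> i"
    by (intro ring_hom_ringI2 adj.ring_axioms phi_hom)
  \<comment> \<open>The class of c(a) is to be a function of \<phi>(a). It is, because c maps the
    kernel of \<phi> into \<open>?I\<close>; surjectivity of \<phi> makes the result a map on all of
    \<open>A i\<close>.\<close>
  define \<kappa> where "\<kappa> b = ?\<pi> (c (Suc i) (SOME a. a \<in> carrier (A (Suc i)) \<and> \<phi> i a = b))" for b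
  have kappa: "\<kappa> (\<phi> i a) = ?\<pi> (c (Suc i) a)" if a: "a \<in> carrier (A (Suc i))" for a
  proof -
    define a' where "a' = (SOME a'. a' \<in> carrier (A (Suc i)) \<and> \<phi> i a' = \<phi> i a)"
    have a': "a' \<in> carrier (A (Suc i)) \<and> \<phi> i a' = \<phi> i a"
      unfolding a'_def by (rule someI[of _ a]) (use a in auto)
    have "a' \<ominus>\<^bsub>A (Suc i)\<^esub> a \<in> ?K" using a a' adj.r_neg by (simp add: a_minus_def)
    then have "c (Suc i) (a' \<ominus>\<^bsub>A (Suc i)\<^esub> a) \<in> ?I" using adj.genideal_self[OF Kc] by blast
    then have "?\<pi> (c (Suc i) (a' \<ominus>\<^bsub>A (Suc i)\<^esub> a)) = \<zero>\<^bsub>?B Quot ?I\<^esub>"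
      by (simp add: I.a_rcos_const FactRing_def)
    moreover have "?\<pi> (c (Suc i) (a' \<ominus>\<^bsub>A (Suc i)\<^esub> a))
        = ?\<pi> (c (Suc i) a') \<oplus>\<^bsub>?B Quot ?I\<^esub> ?\<pi> (c (Suc i) (\<ominus>\<^bsub>A (Suc i)\<^esub> a))"
      unfolding a_minus_def by (rule pc.hom_add) (use a a' in auto)
    moreover have "?\<pi> (c (Suc i) (\<ominus>\<^bsub>A (Suc i)\<^esub> a)) = \<ominus>\<^bsub>?B Quot ?I\<^esub> ?\<pi> (c (Suc i) a)"
      by (rule pc.hom_a_inv[OF a])
    ultimately have "?\<pi> (c (Suc i) a') \<ominus>\<^bsub>?B Quot ?I\<^esub> ?\<pi> (c (Suc i) a) = \<zero>\<^bsub>?B Quot ?I\<^esub>"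
      by (simp only: a_minus_def)
    moreover have "?\<pi> (c (Suc i) a') \<in> carrier (?B Quot ?I)" "?\<pi> (c (Suc i) a) \<in> carrier (?B Quot ?I)"
      by (rule pc.hom_closed, use a a' in simp)+
    ultimately have "?\<pi> (c (Suc i) a') = ?\<pi> (c (Suc i) a)"
      by (simp only: Q.r_right_minus_eq)
    then show ?thesis by (simp add: \<kappa>_def a'_def)
  qed
  have surj: "\<exists>a\<in>carrier (A (Suc i)). \<phi> i a = b" if "b \<in> carrier (A i)" for b
    by (rule phi_surj[OF gen that])
  have kappa_hom: "\<kappa> \<in> ring_hom (A i) (?B Quot ?I)"
  proof (rule ring_hom_memI)
    fix b assume "b \<in> carrier (A i)"
    then obtain a where a: "a \<in> carrier (A (Suc i))" "b = \<phi> i a" using surj by blast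
    then show "\<kappa> b \<in> carrier (?B Quot ?I)" by (simp add: kappa)
    fix b' assume "b' \<in> carrier (A i)"
    then obtain a' where a': "a' \<in> carrier (A (Suc i))" "b' = \<phi> i a'" using surj by blast
    have "\<kappa> (b \<otimes>\<^bsub>A i\<^esub> b') = \<kappa> (\<phi> i (a \<otimes>\<^bsub>A (Suc i)\<^esub> a'))" using a a' by simp
    also have "\<dots> = ?\<pi> (c (Suc i) (a \<otimes>\<^bsub>A (Suc i)\<^esub> a'))" by (rule kappa) (use a a' in simp)
    also have "\<dots> = ?\<pi> (c (Suc i) a) \<otimes>\<^bsub>?B Quot ?I\<^esub> ?\<pi> (c (Suc i) a')"
      by (rule pc.hom_mult) (use a a' in auto)
    finally show "\<kappa> (b \<otimes>\<^bsub>A i\<^esub> b') = \<kappa> b \<otimes>\<^bsub>?B Quot ?I\<^esub> \<kappa> b'" using a a' by (simp add: kappa)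
    have "\<kappa> (b \<oplus>\<^bsub>A i\<^esub> b') = \<kappa> (\<phi> i (a \<oplus>\<^bsub>A (Suc i)\<^esub> a'))" using a a' by simp
    also have "\<dots> = ?\<pi> (c (Suc i) (a \<oplus>\<^bsub>A (Suc i)\<^esub> a'))" by (rule kappa) (use a a' in simp)
    also have "\<dots> = ?\<pi> (c (Suc i) a) \<oplus>\<^bsub>?B Quot ?I\<^esub> ?\<pi> (c (Suc i) a')"
      by (rule pc.hom_add) (use a a' in auto)
    finally show "\<kappa> (b \<oplus>\<^bsub>A i\<^esub> b') = \<kappa> b \<oplus>\<^bsub>?B Quot ?I\<^esub> \<kappa> b'" using a a' by (simp add: kappa)
  next
    have "\<one>\<^bsub>A i\<^esub> = \<phi> i \<one>\<^bsub>A (Suc i)\<^esub>" by simp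
    then show "\<kappa> \<one>\<^bsub>A i\<^esub> = \<one>\<^bsub>?B Quot ?I\<^esub>" using kappa[of "\<one>\<^bsub>A (Suc i)\<^esub>"] pc.hom_one by simp
  qed
  let ?zs = "map (\<lambda>j. ?\<pi> (Y (Suc (Suc i)) ! j)) [0..<n]"
  have zs: "set ?zs \<subseteq> carrier (?B Quot ?I)"
    using Y_closed ring_hom_closed[OF pi] by auto
  \<comment> \<open>The p-th power of a root at stage i+2 is c of the root at stage i+1, whose image
    under \<phi> is \<open>Y i ! j\<close>; this is the relation needed for the lift.\<close>
  have rel: "(?zs ! j) [^]\<^bsub>?B Quot ?I\<^esub> p = \<kappa> (Y i ! j)" if j: "j < n" for j
  proof -
    have "(?zs ! j) [^]\<^bsub>?B Quot ?I\<^esub> p = ?\<pi> (Y (Suc (Suc i)) ! j [^]\<^bsub>?B\<^esub> p)"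
      using j Y_closed[OF j] by (simp add: hom_nat_pow[OF adj.ring_axioms Q.ring_axioms pi])
    also have "\<dots> = \<kappa> (\<phi> i (Y (Suc i) ! j))" using j by (simp add: Y_pow kappa Y_closed)
    finally show ?thesis using j by (simp add: phi_Y)
  qed
  let ?L = "adjoin_lift (A i) (?B Quot ?I) \<kappa> ?zs"
  note lift = Q.is_cring kappa_hom zs _ rel
  have L: "?L \<in> ring_hom (A (Suc i)) (?B Quot ?I)" by (rule lift_hom[OF lift]) auto
  \<comment> \<open>On constants this rests on \<phi>(c(b)) = b^p = c(\<phi>(b)). Since the quotient
    map factors through \<phi>, the kernel of \<phi> is contained in \<open>?I\<close>.\<close>
  have "?L (\<phi> (Suc i) x) = ?\<pi> x"
  proof (rule A_Suc_hom_eqI[OF _ pi _ _ x(1), of "\<lambda>x. ?L (\<phi> (Suc i) x)"])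
    show "(\<lambda>x. ?L (\<phi> (Suc i) x)) \<in> ring_hom ?B (?B Quot ?I)"
      using ring_hom_trans[OF phi_hom L] by (simp add: comp_def)
  next
    fix b assume b: "b \<in> carrier (A (Suc i))"
    have "?L (\<phi> (Suc i) (c (Suc i) b)) = ?L (c i (\<phi> i b))" using b by (simp add: phi_c c_phi)
    also have "\<dots> = \<kappa> (\<phi> i b)" using b by (intro lift_c[OF lift]) auto
    finally show "?L (\<phi> (Suc i) (c (Suc i) b)) = ?\<pi> (c (Suc i) b)" using b by (simp add: kappa)
  next
    fix j assume j: "j < n"
    have "?L (Y (Suc i) ! j) = ?zs ! j" by (rule lift_Y[OF lift]) (use j in auto)
    then show "?L (\<phi> (Suc i) (Y (Suc (Suc i)) ! j)) = ?\<pi> (Y (Suc (Suc i)) ! j)"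
      using j by (simp add: phi_Y)
  qed
  then have "?\<pi> x = \<zero>\<^bsub>?B Quot ?I\<^esub>"
    using x(2) ring_hom_zero[OF L adj.ring_axioms Q.ring_axioms] by simp
  then have "?I +>\<^bsub>?B\<^esub> x = ?I" by (simp add: FactRing_def)
  then show ?thesis using I.a_rcos_self[OF x(1)] by simp
qed

definition monom_Y :: "(nat \<Rightarrow> nat) \<Rightarrow> 'a tower" where
  "monom_Y \<alpha> = (\<Otimes>\<^bsub>A 1\<^esub>j\<in>{..<n}. (Y 1 ! j) [^]\<^bsub>A 1\<^esub> \<alpha> j)"

text \<open>Over \<open>R\<close> the ring \<open>A 1\<close> is spanned by the finitely many
  monomials in the roots with all exponents below p, because the p-th power of a root comes from
  \<open>R\<close>. Its ideals are then finitely generated.\<close>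

lemma ker_phi_0_fg:
  assumes noeth: "noetherian_ring R"
  shows "\<exists>F. finite F \<and> F \<subseteq> {x \<in> carrier (A 1). \<phi> 0 x = \<zero>\<^bsub>A 0\<^esub>} \<and>
    {x \<in> carrier (A 1). \<phi> 0 x = \<zero>\<^bsub>A 0\<^esub>} = Idl\<^bsub>A 1\<^esub> F"
proof -
  \<comment> \<open>The scalars are taken in \<open>R\<close>, through \<open>Base\<close>, since it
    is \<open>R\<close> that is assumed noetherian.\<close>
  interpret C: coefficient_hom R "A 1" "\<lambda>r. c 0 (Base r)"
  proof (intro coefficient_hom.intro coefficient_hom_axioms.intro is_cring cring_A)
    show "(\<lambda>r. c 0 (Base r)) \<in> ring_hom R (A 1)"
      using ring_hom_trans[OF Base_hom c_hom[of 0]] by (simp add: comp_def)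
  qed
  have Yc: "Y 1 ! j \<in> carrier (A 1)" if "j < n" for j using Y_closed[OF that] .
  have mc: "monom_Y \<alpha> \<in> carrier (A 1)" for \<alpha>
    unfolding monom_Y_def using Yc by (intro adj.finprod_closed) auto
  have upd: "monom_Y (\<alpha>(j := k)) = (Y 1 ! j) [^]\<^bsub>A 1\<^esub> k \<otimes>\<^bsub>A 1\<^esub> monom_Y (\<alpha>(j := 0))"
    if j: "j < n" for \<alpha> j k
  proof -
    let ?J = "{..<n} - {j}" and ?g = "\<lambda>i. (Y 1 ! i) [^]\<^bsub>A 1\<^esub> \<alpha> i"
    have ins: "{..<n} = insert j ?J" using j by auto
    have rest: "monom_Y (\<alpha>(j := m)) = (Y 1 ! j) [^]\<^bsub>A 1\<^esub> m \<otimes>\<^bsub>A 1\<^esub> (\<Otimes>\<^bsub>A 1\<^esub>i\<in>?J. ?g i)" for m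
    proof -
      have "monom_Y (\<alpha>(j := m)) = (Y 1 ! j) [^]\<^bsub>A 1\<^esub> m
          \<otimes>\<^bsub>A 1\<^esub> (\<Otimes>\<^bsub>A 1\<^esub>i\<in>?J. (Y 1 ! i) [^]\<^bsub>A 1\<^esub> (\<alpha>(j := m)) i)"
        unfolding monom_Y_def by (subst ins, subst adj.finprod_insert) (use Yc j in auto)
      also have "(\<Otimes>\<^bsub>A 1\<^esub>i\<in>?J. (Y 1 ! i) [^]\<^bsub>A 1\<^esub> (\<alpha>(j := m)) i) = (\<Otimes>\<^bsub>A 1\<^esub>i\<in>?J. ?g i)"
        by (rule adj.finprod_cong') (use Yc in auto)
      finally show ?thesis .
    qed
    have "(\<Otimes>\<^bsub>A 1\<^esub>i\<in>?J. ?g i) \<in> carrier (A 1)" using Yc by (intro adj.finprod_closed) auto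
    then show ?thesis by (simp add: rest)
  qed
  have p0: "0 < p" using prime by (simp add: prime_gt_0_nat)
  have fin: "finite (monom_Y ` ({..<n} \<rightarrow>\<^sub>E {..<p}))" by (intro finite_imageI finite_PiE) auto
  then obtain es where es: "set es = monom_Y ` ({..<n} \<rightarrow>\<^sub>E {..<p})" using finite_list by metis
  have esc: "set es \<subseteq> carrier (A 1)" using es mc by auto
  have L: "C.submod (C.lspan es)" by (rule C.submod_lspan[OF esc])
  have mem: "monom_Y \<alpha> \<in> C.lspan es" if "\<alpha> \<in> {..<n} \<rightarrow>\<^sub>E {..<p}" for \<alpha>
    by (rule C.lspan_mem[OF esc]) (use that es in auto)
  \<comment> \<open>Multiplication by a root raises one exponent. If the exponent reaches p, the
    power is traded for the scalar \<open>xs ! j\<close> and the exponent returns to 0.\<close>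
  have step: "e \<otimes>\<^bsub>A 1\<^esub> Y 1 ! j \<in> C.lspan es" if e: "e \<in> set es" and j: "j < n" for e j
  proof -
    obtain \<alpha> where \<alpha>: "\<alpha> \<in> {..<n} \<rightarrow>\<^sub>E {..<p}" "e = monom_Y \<alpha>" using e es by auto
    have pow: "e \<otimes>\<^bsub>A 1\<^esub> Y 1 ! j = (Y 1 ! j) [^]\<^bsub>A 1\<^esub> Suc (\<alpha> j) \<otimes>\<^bsub>A 1\<^esub> monom_Y (\<alpha>(j := 0))"
      using upd[OF j, of \<alpha> "\<alpha> j"] \<alpha>(2) Yc[OF j] mc[of "\<alpha>(j := 0)"] by (simp add: adj.m_ac)
    show ?thesis
    proof (cases "Suc (\<alpha> j) < p")
      case True
      then have "\<alpha>(j := Suc (\<alpha> j)) \<in> {..<n} \<rightarrow>\<^sub>E {..<p}" using \<alpha>(1) j by (auto simp: PiE_iff extensional_def)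
      moreover have "e \<otimes>\<^bsub>A 1\<^esub> Y 1 ! j = monom_Y (\<alpha>(j := Suc (\<alpha> j)))"
        using pow upd[OF j, of \<alpha> "Suc (\<alpha> j)"] by simp
      ultimately show ?thesis using mem by metis
    next
      case False
      moreover have "\<alpha> j < p" using \<alpha>(1) j by (auto simp: PiE_iff)
      ultimately have "Suc (\<alpha> j) = p" by simp
      then have "e \<otimes>\<^bsub>A 1\<^esub> Y 1 ! j = c 0 (Base (xs ! j)) \<otimes>\<^bsub>A 1\<^esub> monom_Y (\<alpha>(j := 0))"
        using pow Y_pow[OF j, of 0] j by (simp add: gabber_gens_0)
      moreover have "\<alpha>(j := 0) \<in> {..<n} \<rightarrow>\<^sub>E {..<p}" using \<alpha>(1) j p0 by (auto simp: PiE_iff extensional_def)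
      moreover have "xs ! j \<in> carrier R" using xs j by (meson nth_mem subsetD)
      ultimately show ?thesis using mem C.submodD(4)[OF L] by simp
    qed
  qed
  have one: "\<one>\<^bsub>A 1\<^esub> \<in> C.lspan es"
  proof -
    \<comment> \<open>The zero exponent is restricted because \<open>\<rightarrow>\<^sub>E\<close>
      admits only functions that are \<open>undefined\<close> outside \<open>{..<n}\<close>.\<close>
    let ?\<alpha> = "restrict (\<lambda>_. 0) {..<n} :: nat \<Rightarrow> nat"
    have "monom_Y ?\<alpha> = \<one>\<^bsub>A 1\<^esub>"
      unfolding monom_Y_def by (rule adj.finprod_one_eqI) auto
    moreover have "?\<alpha> \<in> {..<n} \<rightarrow>\<^sub>E {..<p}" using p0 by auto
    ultimately show ?thesis using mem by metis
  qed
  have "a \<in> C.lspan es" if "a \<in> carrier (A (Suc 0))" for a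
    using that
  proof (induction rule: A_Suc_induct)
    case (const b)
    then obtain r where r: "r \<in> carrier R" "b = Base r" by (auto simp: carrier_A_0)
    then have "c 0 b = c 0 (Base r) \<otimes>\<^bsub>A 1\<^esub> \<one>\<^bsub>A 1\<^esub>" using c_closed[OF const] by simp
    then show ?case using C.submodD(4)[OF L r(1) one] by simp
  next
    case (add a b)
    then show ?case using C.submodD(3)[OF L] by simp
  next
    case (var a j)
    then show ?case using C.lspan_mult_closed[OF esc Yc L step] by simp
  qed
  then have "carrier (A 1) \<subseteq> C.lspan es" by auto
  moreover have "ideal {x \<in> carrier (A 1). \<phi> 0 x = \<zero>\<^bsub>A 0\<^esub>} (A 1)"
    using adj.ideal_kernel[OF adj.ring_axioms phi_hom[of 0, simplified One_nat_def[symmetric]]] by simp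
  ultimately show ?thesis by (rule C.ideal_finite[OF noeth esc])
qed

end

context gabber_tower
begin

lemma G_proj_surj:
  assumes "p_generating p R xs" "x \<in> carrier (A i)"
  shows "\<exists>g\<in>carrier G. g i = x"
  unfolding gabber_def by (rule lim.inv_lim_proj_surj[OF phi_surj[OF assms(1)] assms(2)])

lemma phi_zero: "\<phi> i \<zero>\<^bsub>A (Suc i)\<^esub> = \<zero>\<^bsub>A i\<^esub>"
  by (rule ring_hom_zero[OF phi_hom adj.ring_axioms adj.ring_axioms])

lemma c_zero: "c i \<zero>\<^bsub>A i\<^esub> = \<zero>\<^bsub>A (Suc i)\<^esub>"
  by (rule ring_hom_zero[OF c_hom adj.ring_axioms adj.ring_axioms])

lemma G_zero_down:
  assumes "g \<in> carrier G" "g m = \<zero>\<^bsub>A m\<^esub>" "k \<le> m"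
  shows "g k = \<zero>\<^bsub>A k\<^esub>"
  using assms(3,2)
proof (induction rule: dec_induct)
  case (step m)
  then show ?case using G_phi[OF assms(1), of m] by (simp add: phi_zero)
qed

lemma G_minus: "g \<in> carrier G \<Longrightarrow> h \<in> carrier G \<Longrightarrow> (g \<ominus>\<^bsub>G\<^esub> h) i = g i \<ominus>\<^bsub>A i\<^esub> h i"
proof -
  interpret h: ring_hom_ring G "A i" "\<lambda>g. g i"
    by (intro ring_hom_ringI2 G.ring_axioms adj.ring_axioms G_proj)
  show "g \<in> carrier G \<Longrightarrow> h \<in> carrier G \<Longrightarrow> (g \<ominus>\<^bsub>G\<^esub> h) i = g i \<ominus>\<^bsub>A i\<^esub> h i"
    by (simp add: a_minus_def)
qed

lemma G_finsum:
  assumes "u \<in> F \<rightarrow> carrier G"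
  shows "(\<Oplus>\<^bsub>G\<^esub>f\<in>F. u f) i = (\<Oplus>\<^bsub>A i\<^esub>f\<in>F. u f i)"
proof -
  interpret h: ring_hom_cring G "A i" "\<lambda>g. g i"
    by (intro ring_hom_cringI G.is_cring cring_A ring_hom_ringI2 G.ring_axioms adj.ring_axioms G_proj)
  show ?thesis using h.hom_finsum[OF assms] by (simp add: comp_def)
qed

lemma char_G: "[p] \<cdot>\<^bsub>G\<^esub> \<one>\<^bsub>G\<^esub> = \<zero>\<^bsub>G\<^esub>"
proof
  fix i
  have "([m] \<cdot>\<^bsub>G\<^esub> \<one>\<^bsub>G\<^esub>) i = [m] \<cdot>\<^bsub>A i\<^esub> \<one>\<^bsub>A i\<^esub>" for m :: nat
    by (induction m) (simp_all add: G_simps)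
  then show "([p] \<cdot>\<^bsub>G\<^esub> \<one>\<^bsub>G\<^esub>) i = \<zero>\<^bsub>G\<^esub> i" by (simp add: G_simps char_A)
qed

text \<open>Each extraction of a p-th power lowers the stage by one, so f_t^(p^t) is the image of
  f_0 = 0. Elements of J are thus topologically nilpotent, with an explicit bound at each
  coordinate.\<close>

lemma G_nilpotent:
  assumes f: "f \<in> carrier G" "f 0 = \<zero>\<^bsub>A 0\<^esub>" and k: "p ^ t \<le> k"
  shows "f t [^]\<^bsub>A t\<^esub> k = \<zero>\<^bsub>A t\<^esub>"
proof -
  have ft: "f t \<in> carrier (A t)" for t using f(1) by (rule G_closed)
  have base: "f t [^]\<^bsub>A t\<^esub> (p ^ t) = \<zero>\<^bsub>A t\<^esub>"
  proof (induction t)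
    case 0
    then show ?case using f(2) by simp
  next
    case (Suc t)
    have "f (Suc t) [^]\<^bsub>A (Suc t)\<^esub> (p ^ Suc t) = (f (Suc t) [^]\<^bsub>A (Suc t)\<^esub> p) [^]\<^bsub>A (Suc t)\<^esub> (p ^ t)"
      using ft by (simp add: adj.nat_pow_pow)
    also have "\<dots> = c t (f t [^]\<^bsub>A t\<^esub> (p ^ t))"
      using ft by (simp add: G_pow_p[OF f(1)] hom_nat_pow[OF adj.ring_axioms adj.ring_axioms c_hom])
    finally show ?case by (simp add: Suc c_zero)
  qed
  have "f t [^]\<^bsub>A t\<^esub> k = f t [^]\<^bsub>A t\<^esub> (p ^ t) \<otimes>\<^bsub>A t\<^esub> f t [^]\<^bsub>A t\<^esub> (k - p ^ t)"
    using k ft by (simp add: adj.nat_pow_mult)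
  then show ?thesis using base ft by simp
qed

text \<open>Finitely many generators of ker \<phi>_0 are lifted along the surjection from
  \<open>G\<close> to \<open>A 1\<close>; a lift lies in J because its coordinate 0 is \<phi> of its
  coordinate 1.\<close>

lemma ker_gens:
  assumes gen: "p_generating p R xs" and noeth: "noetherian_ring R"
  shows "\<exists>F. finite F \<and> F \<subseteq> {g \<in> carrier G. g 0 = \<zero>\<^bsub>A 0\<^esub>} \<and>
    (\<forall>x\<in>carrier (A 1). \<phi> 0 x = \<zero>\<^bsub>A 0\<^esub> \<longrightarrow> x \<in> Idl\<^bsub>A 1\<^esub> ((\<lambda>g. g 1) ` F))"
proof -
  let ?K = "{x \<in> carrier (A 1). \<phi> 0 x = \<zero>\<^bsub>A 0\<^esub>}"
  obtain F where F: "finite F" "F \<subseteq> ?K" "?K = Idl\<^bsub>A 1\<^esub> F"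
    using ker_phi_0_fg[OF noeth] by (elim exE conjE)
  have "\<forall>x\<in>F. \<exists>g. g \<in> carrier G \<and> g 1 = x"
    using F(2) G_proj_surj[OF gen, of _ 1] by blast
  then obtain \<gamma> where \<gamma>: "\<forall>x\<in>F. \<gamma> x \<in> carrier G \<and> \<gamma> x 1 = x" by (rule bchoice[THEN exE])
  have "\<gamma> x 0 = \<zero>\<^bsub>A 0\<^esub>" if "x \<in> F" for x
  proof -
    have "\<gamma> x 0 = \<phi> 0 x" using \<gamma> that G_phi[of "\<gamma> x" 0] by simp
    then show ?thesis using F(2) that by auto
  qed
  moreover have "(\<lambda>g. g 1) ` \<gamma> ` F = id ` F"
    unfolding image_image by (rule image_cong) (use \<gamma> in auto)
  ultimately show ?thesis using F(1,3) \<gamma> by (intro exI[of _ "\<gamma> ` F"]) auto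
qed

section \<open>The kernels J_i generated by p^i-th powers\<close>

context
  fixes F
  assumes gen: "p_generating p R xs" and F: "finite F" "F \<subseteq> {g \<in> carrier G. g 0 = \<zero>\<^bsub>A 0\<^esub>}"
    and Fgen: "\<And>x. x \<in> carrier (A 1) \<Longrightarrow> \<phi> 0 x = \<zero>\<^bsub>A 0\<^esub> \<Longrightarrow> x \<in> Idl\<^bsub>A 1\<^esub> ((\<lambda>g. g 1) ` F)"
begin

lemma F_closed: "f \<in> F \<Longrightarrow> f \<in> carrier G" and F_zero: "f \<in> F \<Longrightarrow> f 0 = \<zero>\<^bsub>A 0\<^esub>"
  using F(2) by auto

text \<open>The Frobenius power of the ideal generated by F, usually written with the exponent
  [p^i].\<close>

definition frob_ideal :: "nat \<Rightarrow> (nat \<Rightarrow> 'a tower) set" where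
  "frob_ideal i = Idl\<^bsub>G\<^esub> ((\<lambda>f. f [^]\<^bsub>G\<^esub> (p ^ i)) ` F)"

lemma frob_gens_closed: "(\<lambda>f. f [^]\<^bsub>G\<^esub> (p ^ i)) ` F \<subseteq> carrier G"
  using F_closed by auto

lemma frob_ideal_ideal: "ideal (frob_ideal i) G"
  unfolding frob_ideal_def by (rule G.genideal_ideal[OF frob_gens_closed])

lemma frob_ideal_gen: "f \<in> F \<Longrightarrow> f [^]\<^bsub>G\<^esub> (p ^ i) \<in> frob_ideal i"
  unfolding frob_ideal_def using G.genideal_self[OF frob_gens_closed] by blast

lemma frob_ideal_image: "ideal ((\<lambda>g. g j) ` frob_ideal i) (A j)"
  by (rule G.ideal_image_surj[OF cring_A G_proj frob_ideal_ideal]) (use G_proj_surj[OF gen] in blast)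

text \<open>Frobenius is a ring homomorphism of \<open>G\<close>, so the elements whose p-th power
  lies in the next Frobenius power form an ideal; it contains the generators.\<close>

lemma frob_ideal_pow:
  assumes "e \<in> frob_ideal i"
  shows "e [^]\<^bsub>G\<^esub> p \<in> frob_ideal (Suc i)"
proof -
  let ?V = "{e \<in> carrier G. e [^]\<^bsub>G\<^esub> p \<in> frob_ideal (Suc i)}"
  have "ideal ?V G"
    by (rule G.ideal_vimage_cring[OF G.is_cring G.frobenius_hom[OF prime char_G] frob_ideal_ideal])
  moreover have "(\<lambda>f. f [^]\<^bsub>G\<^esub> (p ^ i)) ` F \<subseteq> ?V"
  proof clarify
    fix f assume f: "f \<in> F"
    have "(f [^]\<^bsub>G\<^esub> (p ^ i)) [^]\<^bsub>G\<^esub> p = f [^]\<^bsub>G\<^esub> (p ^ Suc i)"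
      using F_closed[OF f] by (simp add: G.nat_pow_pow mult.commute)
    then show "f [^]\<^bsub>G\<^esub> (p ^ i) \<in> carrier G \<and> (f [^]\<^bsub>G\<^esub> (p ^ i)) [^]\<^bsub>G\<^esub> p \<in> frob_ideal (Suc i)"
      using frob_ideal_gen[OF f, of "Suc i"] F_closed[OF f] by simp
  qed
  ultimately have "frob_ideal i \<subseteq> ?V" unfolding frob_ideal_def[of i] by (rule G.genideal_minimal)
  then show ?thesis using assms by blast
qed

text \<open>The induction trades a p-th power for a stage. Modulo the next kernel, g is a
  combination of elements c(b) with b in ker \<phi>_i; b lifts to J_i and there agrees at stage i+1
  with some e from the Frobenius power, and c(b) is coordinate i+2 of e^p.\<close>

lemma kernel_approx:
  assumes "g \<in> carrier G" "g i = \<zero>\<^bsub>A i\<^esub>"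
  shows "\<exists>e\<in>frob_ideal i. g (Suc i) = e (Suc i)"
  using assms
proof (induction i arbitrary: g)
  case 0
  have "\<phi> 0 (g 1) = \<zero>\<^bsub>A 0\<^esub>" using G_phi[OF 0(1), of 0] 0(2) by simp
  then have "g 1 \<in> Idl\<^bsub>A 1\<^esub> ((\<lambda>g. g 1) ` F)" using Fgen G_closed[OF 0(1)] by blast
  moreover have "(\<lambda>g. g 1) ` F \<subseteq> (\<lambda>g. g 1) ` frob_ideal 0"
    using frob_ideal_gen[of _ 0] F_closed by auto
  then have "Idl\<^bsub>A 1\<^esub> ((\<lambda>g. g 1) ` F) \<subseteq> (\<lambda>g. g 1) ` frob_ideal 0"
    by (rule adj.genideal_minimal[OF frob_ideal_image])
  ultimately show ?case by auto
next
  case (Suc i)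
  let ?B = "A (Suc (Suc i))" and ?K = "{b \<in> carrier (A (Suc i)). \<phi> i b = \<zero>\<^bsub>A i\<^esub>}"
  let ?M = "(\<lambda>g. g (Suc (Suc i))) ` frob_ideal (Suc i)"
  have "g (Suc (Suc i)) \<in> Idl\<^bsub>?B\<^esub> (c (Suc i) ` ?K)"
    by (rule ker_phi_Suc[OF gen G_closed[OF Suc.prems(1)]]) (simp add: G_phi Suc.prems)
  moreover have "c (Suc i) ` ?K \<subseteq> ?M"
  proof clarify
    fix b assume b: "b \<in> carrier (A (Suc i))" "\<phi> i b = \<zero>\<^bsub>A i\<^esub>"
    obtain g' where g': "g' \<in> carrier G" "g' (Suc i) = b" using G_proj_surj[OF gen b(1)] by blast
    then have "g' i = \<zero>\<^bsub>A i\<^esub>" using G_phi[OF g'(1), of i] b(2) by simp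
    then obtain e where e: "e \<in> frob_ideal i" "g' (Suc i) = e (Suc i)" using Suc.IH g' by blast
    have ec: "e \<in> carrier G" by (rule ideal.Icarr[OF frob_ideal_ideal e(1)])
    have "c (Suc i) b = (e [^]\<^bsub>G\<^esub> p) (Suc (Suc i))"
      using e(2) g'(2) by (simp add: G_pow[OF ec] G_pow_p[OF ec])
    then show "c (Suc i) b \<in> ?M" using frob_ideal_pow[OF e(1)] by blast
  qed
  then have "Idl\<^bsub>?B\<^esub> (c (Suc i) ` ?K) \<subseteq> ?M" by (rule adj.genideal_minimal[OF frob_ideal_image])
  ultimately show ?case by auto
qed

definition frob_comb :: "nat \<Rightarrow> ((nat \<Rightarrow> 'a tower) \<Rightarrow> nat \<Rightarrow> 'a tower) \<Rightarrow> nat \<Rightarrow> 'a tower" where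
  "frob_comb i \<beta> = (\<Oplus>\<^bsub>G\<^esub>f\<in>F. \<beta> f \<otimes>\<^bsub>G\<^esub> f [^]\<^bsub>G\<^esub> (p ^ i))"

lemma frob_comb_closed: "\<beta> \<in> F \<rightarrow> carrier G \<Longrightarrow> frob_comb i \<beta> \<in> carrier G"
  unfolding frob_comb_def using F_closed by (intro G.finsum_closed) auto

lemma frob_comb_nth:
  assumes "\<beta> \<in> F \<rightarrow> carrier G"
  shows "frob_comb i \<beta> t = (\<Oplus>\<^bsub>A t\<^esub>f\<in>F. \<beta> f t \<otimes>\<^bsub>A t\<^esub> f t [^]\<^bsub>A t\<^esub> (p ^ i))"
proof -
  have cl: "(\<lambda>f. \<beta> f \<otimes>\<^bsub>G\<^esub> f [^]\<^bsub>G\<^esub> (p ^ i)) \<in> F \<rightarrow> carrier G" using assms F_closed by auto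
  have "(\<Oplus>\<^bsub>A t\<^esub>f\<in>F. (\<beta> f \<otimes>\<^bsub>G\<^esub> f [^]\<^bsub>G\<^esub> (p ^ i)) t) = (\<Oplus>\<^bsub>A t\<^esub>f\<in>F. \<beta> f t \<otimes>\<^bsub>A t\<^esub> f t [^]\<^bsub>A t\<^esub> (p ^ i))"
    by (rule adj.finsum_cong') (use assms F_closed G_closed in \<open>auto simp: G_simps G_pow Pi_iff\<close>)
  then show ?thesis unfolding frob_comb_def G_finsum[OF cl] .
qed

lemma kernel_approx_comb:
  assumes "g \<in> carrier G" "g i = \<zero>\<^bsub>A i\<^esub>"
  shows "\<exists>a\<in>F \<rightarrow> carrier G. (g \<ominus>\<^bsub>G\<^esub> frob_comb i a) (Suc i) = \<zero>\<^bsub>A (Suc i)\<^esub>"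
proof -
  obtain e where e: "e \<in> frob_ideal i" "g (Suc i) = e (Suc i)" using kernel_approx[OF assms] by blast
  obtain a where a: "a \<in> F \<rightarrow> carrier G" "e = frob_comb i a"
    using G.genideal_finite_family[OF F(1) _ e(1)[unfolded frob_ideal_def]] F_closed
    unfolding frob_comb_def by auto
  have "(g \<ominus>\<^bsub>G\<^esub> frob_comb i a) (Suc i) = \<zero>\<^bsub>A (Suc i)\<^esub>"
    using G_minus[OF assms(1) frob_comb_closed[OF a(1)]] e(2) a(2) G_closed[OF assms(1), of "Suc i"]
    by (simp add: adj.r_neg a_minus_def)
  then show ?thesis using a(1) by blast
qed

text \<open>A correction by p^(i+l)-th powers can be absorbed into the coefficients at level i, by
  splitting off f^(p^i). The remaining exponent is a genuine difference since p^i \<le>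
  p^(i+l).\<close>

lemma frob_comb_step:
  assumes \<beta>: "\<beta> \<in> F \<rightarrow> carrier G" and a: "a \<in> F \<rightarrow> carrier G"
  shows "frob_comb i (\<lambda>f. \<beta> f \<oplus>\<^bsub>G\<^esub> a f \<otimes>\<^bsub>G\<^esub> f [^]\<^bsub>G\<^esub> (p ^ (i + l) - p ^ i))
    = frob_comb i \<beta> \<oplus>\<^bsub>G\<^esub> frob_comb (i + l) a"
proof -
  have le: "p ^ i \<le> p ^ (i + l)"
    using prime_ge_1_nat[OF prime] by (intro power_increasing) auto
  have "frob_comb i (\<lambda>f. \<beta> f \<oplus>\<^bsub>G\<^esub> a f \<otimes>\<^bsub>G\<^esub> f [^]\<^bsub>G\<^esub> (p ^ (i + l) - p ^ i))
      = (\<Oplus>\<^bsub>G\<^esub>f\<in>F. \<beta> f \<otimes>\<^bsub>G\<^esub> f [^]\<^bsub>G\<^esub> (p ^ i) \<oplus>\<^bsub>G\<^esub> a f \<otimes>\<^bsub>G\<^esub> f [^]\<^bsub>G\<^esub> (p ^ (i + l)))"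
    unfolding frob_comb_def
  proof (rule G.finsum_cong')
    fix f assume f: "f \<in> F"
    then have fc: "f \<in> carrier G" "\<beta> f \<in> carrier G" "a f \<in> carrier G" using F_closed \<beta> a by auto
    have "f [^]\<^bsub>G\<^esub> (p ^ (i + l) - p ^ i) \<otimes>\<^bsub>G\<^esub> f [^]\<^bsub>G\<^esub> (p ^ i) = f [^]\<^bsub>G\<^esub> (p ^ (i + l))"
      using fc le by (simp add: G.nat_pow_mult)
    then show "(\<beta> f \<oplus>\<^bsub>G\<^esub> a f \<otimes>\<^bsub>G\<^esub> f [^]\<^bsub>G\<^esub> (p ^ (i + l) - p ^ i)) \<otimes>\<^bsub>G\<^esub> f [^]\<^bsub>G\<^esub> (p ^ i)
        = \<beta> f \<otimes>\<^bsub>G\<^esub> f [^]\<^bsub>G\<^esub> (p ^ i) \<oplus>\<^bsub>G\<^esub> a f \<otimes>\<^bsub>G\<^esub> f [^]\<^bsub>G\<^esub> (p ^ (i + l))"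
      using fc by (simp add: G.l_distr G.m_assoc)
  qed (use funcset_mem[OF \<beta>] funcset_mem[OF a] F_closed in auto)
  also have "\<dots> = frob_comb i \<beta> \<oplus>\<^bsub>G\<^esub> frob_comb (i + l) a"
    unfolding frob_comb_def
    by (rule G.finsum_addf) (use funcset_mem[OF \<beta>] funcset_mem[OF a] F_closed in auto)
  finally show ?thesis .
qed

text \<open>The coefficients are found by successive approximation; it converges because the elements of
  \<open>F\<close> are topologically nilpotent.\<close>

lemma kernel_eq_comb:
  assumes g: "g \<in> carrier G" "g i = \<zero>\<^bsub>A i\<^esub>"
  shows "\<exists>\<beta>\<in>F \<rightarrow> carrier G. g = frob_comb i \<beta>"
proof -
  have p1: "1 < p" using prime by (rule prime_gt_1_nat)
  \<comment> \<open>The last clause freezes the coordinates t < l of the coefficients from step l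
    on; this is what makes the approximations converge coordinatewise.\<close>
  have "\<exists>B. \<forall>l. (B l \<in> F \<rightarrow> carrier G \<and> (g \<ominus>\<^bsub>G\<^esub> frob_comb i (B l)) (i + l) = \<zero>\<^bsub>A (i + l)\<^esub>)
      \<and> (\<forall>f\<in>F. \<forall>t<l. B (Suc l) f t = B l f t)"
  proof (rule dependent_nat_choice)
    have "frob_comb i (\<lambda>_. \<zero>\<^bsub>G\<^esub>) = \<zero>\<^bsub>G\<^esub>"
      unfolding frob_comb_def by (rule G.add.finprod_one_eqI) (simp add: F_closed)
    then have "(g \<ominus>\<^bsub>G\<^esub> frob_comb i (\<lambda>_. \<zero>\<^bsub>G\<^esub>)) (i + 0) = \<zero>\<^bsub>A (i + 0)\<^esub>"
      using g by (simp add: a_minus_def)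
    then show "\<exists>\<beta>. \<beta> \<in> F \<rightarrow> carrier G \<and> (g \<ominus>\<^bsub>G\<^esub> frob_comb i \<beta>) (i + 0) = \<zero>\<^bsub>A (i + 0)\<^esub>"
      by (intro exI[of _ "\<lambda>_. \<zero>\<^bsub>G\<^esub>"]) simp
  next
    fix \<beta> l assume "\<beta> \<in> F \<rightarrow> carrier G \<and> (g \<ominus>\<^bsub>G\<^esub> frob_comb i \<beta>) (i + l) = \<zero>\<^bsub>A (i + l)\<^esub>"
    then have \<beta>: "\<beta> \<in> F \<rightarrow> carrier G" and z: "(g \<ominus>\<^bsub>G\<^esub> frob_comb i \<beta>) (i + l) = \<zero>\<^bsub>A (i + l)\<^esub>" by auto
    note cb = frob_comb_closed[OF \<beta>]
    obtain a where a: "a \<in> F \<rightarrow> carrier G"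
      "((g \<ominus>\<^bsub>G\<^esub> frob_comb i \<beta>) \<ominus>\<^bsub>G\<^esub> frob_comb (i + l) a) (Suc (i + l)) = \<zero>\<^bsub>A (Suc (i + l))\<^esub>"
      using kernel_approx_comb[of "g \<ominus>\<^bsub>G\<^esub> frob_comb i \<beta>" "i + l"] g(1) cb z by auto
    note ca = frob_comb_closed[OF a(1)]
    let ?\<beta>' = "\<lambda>f. \<beta> f \<oplus>\<^bsub>G\<^esub> a f \<otimes>\<^bsub>G\<^esub> f [^]\<^bsub>G\<^esub> (p ^ (i + l) - p ^ i)"
    have "g \<ominus>\<^bsub>G\<^esub> frob_comb i ?\<beta>' = (g \<ominus>\<^bsub>G\<^esub> frob_comb i \<beta>) \<ominus>\<^bsub>G\<^esub> frob_comb (i + l) a"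
      unfolding frob_comb_step[OF \<beta> a(1)] using g(1) cb ca
      by (simp add: a_minus_def G.minus_add G.a_assoc)
    then have "(g \<ominus>\<^bsub>G\<^esub> frob_comb i ?\<beta>') (i + Suc l) = \<zero>\<^bsub>A (i + Suc l)\<^esub>" using a(2) by simp
    moreover have "?\<beta>' \<in> F \<rightarrow> carrier G"
      using funcset_mem[OF \<beta>] funcset_mem[OF a(1)] F_closed by auto
    moreover have "?\<beta>' f t = \<beta> f t" if f: "f \<in> F" and t: "t < l" for f t
    proof -
      \<comment> \<open>As p \<ge> 2 and t < l, the power p^(i+l) is at least twice p^(i+l-1), hence
        at least p^t + p^i. The exponent of f in the correction is therefore at least p^t and kills
        coordinate t.\<close>
      have "p ^ t \<le> p ^ (i + (l - 1))" using t p1 by (intro power_increasing) auto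
      moreover have "p ^ i \<le> p ^ (i + (l - 1))" using p1 by (intro power_increasing) auto
      moreover have "p ^ (i + l) = p * p ^ (i + (l - 1))"
        using t by (cases l) auto
      moreover have "2 * p ^ (i + (l - 1)) \<le> p * p ^ (i + (l - 1))" using p1 by (intro mult_right_mono) auto
      ultimately have "p ^ t \<le> p ^ (i + l) - p ^ i" by linarith
      then have "f t [^]\<^bsub>A t\<^esub> (p ^ (i + l) - p ^ i) = \<zero>\<^bsub>A t\<^esub>"
        by (rule G_nilpotent[OF F_closed[OF f] F_zero[OF f]])
      moreover have "\<beta> f t \<in> carrier (A t)" "a f t \<in> carrier (A t)"
        using \<beta> a(1) f G_closed by (auto simp: Pi_iff)
      ultimately show ?thesis by (simp add: G_simps G_pow F_closed[OF f])
    qed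
    ultimately show "\<exists>\<beta>'. (\<beta>' \<in> F \<rightarrow> carrier G \<and>
        (g \<ominus>\<^bsub>G\<^esub> frob_comb i \<beta>') (i + Suc l) = \<zero>\<^bsub>A (i + Suc l)\<^esub>) \<and> (\<forall>f\<in>F. \<forall>t<l. \<beta>' f t = \<beta> f t)"
      by (intro exI[of _ ?\<beta>']) blast
  qed
  then obtain B where B: "\<And>l. B l \<in> F \<rightarrow> carrier G"
    "\<And>l. (g \<ominus>\<^bsub>G\<^esub> frob_comb i (B l)) (i + l) = \<zero>\<^bsub>A (i + l)\<^esub>"
    "\<And>l f t. f \<in> F \<Longrightarrow> t < l \<Longrightarrow> B (Suc l) f t = B l f t" by blast
  \<comment> \<open>Coordinate t is stable from step t+1 on, and not necessarily from step t, since
    stability is known only for t < l.\<close>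
  define \<beta> where "\<beta> f t = B (Suc t) f t" for f t
  have Bc: "B l f \<in> carrier G" if "f \<in> F" for l f using B(1) that by blast
  have \<beta>: "\<beta> f \<in> carrier G" if f: "f \<in> F" for f
    unfolding G_carrier
  proof (intro allI conjI)
    fix t
    show "\<beta> f t \<in> carrier (A t)" using Bc[OF f] G_closed by (simp add: \<beta>_def)
    have "\<phi> t (\<beta> f (Suc t)) = B (Suc (Suc t)) f t"
      unfolding \<beta>_def by (rule G_phi[OF Bc[OF f]])
    then show "\<phi> t (\<beta> f (Suc t)) = \<beta> f t" using B(3)[OF f, of t "Suc t"] by (simp add: \<beta>_def)
  qed
  then have \<beta>F: "\<beta> \<in> F \<rightarrow> carrier G" by blast
  have "g t = frob_comb i \<beta> t" for t
  proof -
    note cb = frob_comb_closed[OF B(1)]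
    \<comment> \<open>Step t+1 is exact at coordinate i+t+1; the vanishing is then pushed down to
      coordinate t, where the coefficients already have their limit values.\<close>
    have "(g \<ominus>\<^bsub>G\<^esub> frob_comb i (B (Suc t))) t = \<zero>\<^bsub>A t\<^esub>"
      by (rule G_zero_down[where m = "i + Suc t"]) (use B(2)[of "Suc t"] g(1) cb in auto)
    then have "g t = frob_comb i (B (Suc t)) t"
      using G_minus[OF g(1) cb] G_closed[OF g(1)] G_closed[OF cb] by simp
    also have "\<dots> = frob_comb i \<beta> t"
      unfolding frob_comb_nth[OF B(1)] frob_comb_nth[OF \<beta>F] \<beta>_def ..
    finally show ?thesis .
  qed
  then show ?thesis using \<beta>F by blast
qed

end

lemma kernel_generators:
  assumes gen: "p_generating p R xs" and noeth: "noetherian_ring R"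
  shows "\<exists>F. finite F \<and> F \<subseteq> {g \<in> carrier G. g 0 = \<zero>\<^bsub>A 0\<^esub>} \<and>
    (\<forall>i g. g \<in> carrier G \<longrightarrow> g i = \<zero>\<^bsub>A i\<^esub> \<longrightarrow>
      (\<exists>\<beta>\<in>F \<rightarrow> carrier G. g = (\<Oplus>\<^bsub>G\<^esub>f\<in>F. \<beta> f \<otimes>\<^bsub>G\<^esub> f [^]\<^bsub>G\<^esub> (p ^ i))))"
proof -
  obtain F where F: "finite F" "F \<subseteq> {g \<in> carrier G. g 0 = \<zero>\<^bsub>A 0\<^esub>}"
    "\<forall>x\<in>carrier (A 1). \<phi> 0 x = \<zero>\<^bsub>A 0\<^esub> \<longrightarrow> x \<in> Idl\<^bsub>A 1\<^esub> ((\<lambda>g. g 1) ` F)"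
    using ker_gens[OF assms] by (elim exE conjE)
  have Fgen: "x \<in> Idl\<^bsub>A 1\<^esub> ((\<lambda>g. g 1) ` F)" if "x \<in> carrier (A 1)" "\<phi> 0 x = \<zero>\<^bsub>A 0\<^esub>" for x
    using F(3) that by blast
  show ?thesis
    using F(1,2) kernel_eq_comb[OF gen F(1,2) Fgen] frob_comb_def[OF gen F(1,2) Fgen]
    by (intro exI[of _ F]) auto
qed

end

section \<open>Localization\<close>

lemma (in cring) Units_cancel_eq:
  assumes "u \<in> Units R" "v \<in> Units R" "a \<in> carrier R" "b \<in> carrier R" "a \<otimes> v = b \<otimes> u"
  shows "a \<otimes> inv u = b \<otimes> inv v"
proof -
  have c: "u \<in> carrier R" "v \<in> carrier R" "inv u \<in> carrier R" "inv v \<in> carrier R"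
    using assms by auto
  have "a \<otimes> inv u = (a \<otimes> v) \<otimes> (inv u \<otimes> inv v)"
    using assms(2-4) c Units_r_inv[OF assms(2)] by (simp add: m_assoc m_lcomm[of v "inv u"])
  also have "\<dots> = (b \<otimes> u) \<otimes> (inv u \<otimes> inv v)" by (simp only: assms(5))
  also have "\<dots> = b \<otimes> ((u \<otimes> inv u) \<otimes> inv v)" using assms(3,4) c by (simp add: m_assoc)
  also have "\<dots> = b \<otimes> inv v" using assms(1) c by simp
  finally show ?thesis .
qed

lemma (in cring) Units_of_mult:
  assumes "a \<in> carrier R" "b \<in> carrier R" "a \<otimes> b \<in> Units R"
  shows "a \<in> Units R"
proof -
  have "a \<otimes> (b \<otimes> inv (a \<otimes> b)) = \<one>"
    using assms Units_r_inv[OF assms(3)] by (simp add: m_assoc[symmetric])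
  moreover from this have "(b \<otimes> inv (a \<otimes> b)) \<otimes> a = \<one>"
    using assms by (simp add: m_comm)
  moreover have "b \<otimes> inv (a \<otimes> b) \<in> carrier R" using assms by simp
  ultimately show ?thesis using assms(1) unfolding Units_def by blast
qed

lemma hom_Units:
  assumes "cring S" "cring T" "h \<in> ring_hom S T" "u \<in> Units S"
  shows "h u \<in> Units T"
proof -
  interpret S: cring S by fact
  interpret T: cring T by fact
  have c: "u \<in> carrier S" "inv\<^bsub>S\<^esub> u \<in> carrier S" using assms(4) by auto
  then have "h u \<otimes>\<^bsub>T\<^esub> h (inv\<^bsub>S\<^esub> u) = h (u \<otimes>\<^bsub>S\<^esub> inv\<^bsub>S\<^esub> u)"
    by (rule ring_hom_mult[OF assms(3), symmetric])
  also have "\<dots> = \<one>\<^bsub>T\<^esub>"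
    unfolding S.Units_r_inv[OF assms(4)] by (rule ring_hom_one[OF assms(3)])
  finally have "h u \<otimes>\<^bsub>T\<^esub> h (inv\<^bsub>S\<^esub> u) \<in> Units T" by simp
  then show ?thesis
    by (rule T.Units_of_mult[OF ring_hom_closed[OF assms(3) c(1)] ring_hom_closed[OF assms(3) c(2)]])
qed

locale localize = cring R for R (structure) and S +
  assumes submonoid: "submonoid S R"
begin

abbreviation L where "L \<equiv> localization R S"

lemma S_closed: "s \<in> S \<Longrightarrow> s \<in> carrier R"
  and S_mult: "s \<in> S \<Longrightarrow> t \<in> S \<Longrightarrow> s \<otimes> t \<in> S"
  and S_one: "\<one> \<in> S"
  using submonoid by (auto simp: submonoid_def)

lemma S_pow: "s \<in> S \<Longrightarrow> s [^] (k::nat) \<in> S"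
  by (induction k) (simp_all add: S_one S_mult)

lemma frac_rel_iff: "((a, s), (b, t)) \<in> frac_rel R S \<longleftrightarrow>
    a \<in> carrier R \<and> s \<in> S \<and> b \<in> carrier R \<and> t \<in> S \<and> (\<exists>u\<in>S. u \<otimes> (a \<otimes> t) = u \<otimes> (b \<otimes> s))"
  by (simp add: frac_rel_def)

lemma frac_rel_equiv: "equiv (carrier R \<times> S) (frac_rel R S)"
proof (rule equivI)
  show "refl_on (carrier R \<times> S) (frac_rel R S)"
    using S_one by (auto simp: refl_on_def frac_rel_iff)
  show "sym (frac_rel R S)" by (rule symI) (auto simp: frac_rel_def dest: sym)
  show "trans (frac_rel R S)"
  proof (rule transI)
    fix x y z assume xy: "(x, y) \<in> frac_rel R S" and yz: "(y, z) \<in> frac_rel R S"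
    obtain a s b t c r where [simp]: "x = (a, s)" "y = (b, t)" "z = (c, r)" by (cases x; cases y; cases z)
    obtain u v where u: "u \<in> S" "u \<otimes> (a \<otimes> t) = u \<otimes> (b \<otimes> s)"
      and v: "v \<in> S" "v \<otimes> (b \<otimes> r) = v \<otimes> (c \<otimes> t)"
      using xy yz by (auto simp: frac_rel_iff)
    have cl: "a \<in> carrier R" "b \<in> carrier R" "c \<in> carrier R" "s \<in> carrier R" "t \<in> carrier R"
      "r \<in> carrier R" "u \<in> carrier R" "v \<in> carrier R"
      using xy yz u(1) v(1) S_closed by (auto simp: frac_rel_iff)
    \<comment> \<open>The witness for transitivity has to include the middle denominator t, besides
      the two given witnesses.\<close>
    have "(u \<otimes> v \<otimes> t) \<otimes> (a \<otimes> r) = (u \<otimes> (a \<otimes> t)) \<otimes> (v \<otimes> r)" using cl by algebra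
    also have "\<dots> = (v \<otimes> (b \<otimes> r)) \<otimes> (u \<otimes> s)" unfolding u(2) using cl by algebra
    also have "\<dots> = (u \<otimes> v \<otimes> t) \<otimes> (c \<otimes> s)" unfolding v(2) using cl by algebra
    finally have "(u \<otimes> v \<otimes> t) \<otimes> (a \<otimes> r) = (u \<otimes> v \<otimes> t) \<otimes> (c \<otimes> s)" .
    moreover have "u \<otimes> v \<otimes> t \<in> S" using u v xy S_mult by (auto simp: frac_rel_iff)
    ultimately show "(x, z) \<in> frac_rel R S" using xy yz by (auto simp: frac_rel_iff)
  qed
qed (auto simp: frac_rel_def)

lemma frac_eq_iff:
  assumes "a \<in> carrier R" "s \<in> S" "b \<in> carrier R" "t \<in> S"
  shows "frac R S a s = frac R S b t \<longleftrightarrow> (\<exists>u\<in>S. u \<otimes> (a \<otimes> t) = u \<otimes> (b \<otimes> s))"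
  using eq_equiv_class_iff[OF frac_rel_equiv, of "(a, s)" "(b, t)"] assms
  by (simp add: frac_def frac_rel_iff)

lemma frac_eqI:
  assumes "a \<in> carrier R" "s \<in> S" "b \<in> carrier R" "t \<in> S" "a \<otimes> t = b \<otimes> s"
  shows "frac R S a s = frac R S b t"
  using assms S_one by (auto simp: frac_eq_iff)

lemma carrier_localization: "carrier L = {frac R S a s | a s. a \<in> carrier R \<and> s \<in> S}"
  by (auto simp: localization_def quotient_def frac_def)

lemma frac_closed: "a \<in> carrier R \<Longrightarrow> s \<in> S \<Longrightarrow> frac R S a s \<in> carrier L"
  by (auto simp: carrier_localization)

lemma frac_cases:
  assumes "x \<in> carrier L"
  obtains a s where "a \<in> carrier R" "s \<in> S" "x = frac R S a s"
  using assms by (auto simp: carrier_localization)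

lemma mem_frac:
  "(a', s') \<in> frac R S a s \<longleftrightarrow>
    a \<in> carrier R \<and> s \<in> S \<and> a' \<in> carrier R \<and> s' \<in> S \<and> (\<exists>u\<in>S. u \<otimes> (a \<otimes> s') = u \<otimes> (a' \<otimes> s))"
  by (auto simp: frac_def frac_rel_iff)

lemma frac_self: "a \<in> carrier R \<Longrightarrow> s \<in> S \<Longrightarrow> (a, s) \<in> frac R S a s"
  using S_one by (auto simp: mem_frac)

text \<open>The operations of \<open>localization\<close> are unions over all representatives. If
  the value does not depend on them, the union is that one value.\<close>

lemma UN_frac:
  assumes "a \<in> carrier R" "s \<in> S" "b \<in> carrier R" "t \<in> S"
    and "\<And>a' s' b' t'. (a', s') \<in> frac R S a s \<Longrightarrow> (b', t') \<in> frac R S b t \<Longrightarrow> f a' s' b' t' = f a s b t"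
  shows "(\<Union>(a', s')\<in>frac R S a s. \<Union>(b', t')\<in>frac R S b t. f a' s' b' t') = f a s b t"
proof (intro subset_antisym subsetI)
  fix x assume "x \<in> (\<Union>(a', s')\<in>frac R S a s. \<Union>(b', t')\<in>frac R S b t. f a' s' b' t')"
  then obtain a' s' b' t' where m: "(a', s') \<in> frac R S a s" "(b', t') \<in> frac R S b t"
    and x: "x \<in> f a' s' b' t'" by blast
  show "x \<in> f a s b t" using x unfolding assms(5)[OF m] .
next
  fix x assume "x \<in> f a s b t"
  then show "x \<in> (\<Union>(a', s')\<in>frac R S a s. \<Union>(b', t')\<in>frac R S b t. f a' s' b' t')"
    using frac_self[OF assms(1,2)] frac_self[OF assms(3,4)] by blast
qed

lemma frac_mult:
  assumes "a \<in> carrier R" "s \<in> S" "b \<in> carrier R" "t \<in> S"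
  shows "frac R S a s \<otimes>\<^bsub>L\<^esub> frac R S b t = frac R S (a \<otimes> b) (s \<otimes> t)"
proof -
  have "frac R S (a' \<otimes> b') (s' \<otimes> t') = frac R S (a \<otimes> b) (s \<otimes> t)"
    if 1: "(a', s') \<in> frac R S a s" and 2: "(b', t') \<in> frac R S b t" for a' s' b' t'
  proof -
    obtain u v where u: "u \<in> S" "u \<otimes> (a \<otimes> s') = u \<otimes> (a' \<otimes> s)"
      and v: "v \<in> S" "v \<otimes> (b \<otimes> t') = v \<otimes> (b' \<otimes> t)"
      using 1 2 by (auto simp: mem_frac)
    have m: "a' \<in> carrier R" "s' \<in> S" "b' \<in> carrier R" "t' \<in> S" using 1 2 by (auto simp: mem_frac)
    note cl = assms(1,3) m(1,3) S_closed[OF assms(2)] S_closed[OF assms(4)] S_closed[OF m(2)]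
      S_closed[OF m(4)] S_closed[OF u(1)] S_closed[OF v(1)]
    have "(u \<otimes> v) \<otimes> ((a' \<otimes> b') \<otimes> (s \<otimes> t)) = (u \<otimes> (a' \<otimes> s)) \<otimes> (v \<otimes> (b' \<otimes> t))"
      using cl by algebra
    also have "\<dots> = (u \<otimes> v) \<otimes> ((a \<otimes> b) \<otimes> (s' \<otimes> t'))"
      unfolding u(2)[symmetric] v(2)[symmetric] using cl by algebra
    finally show ?thesis using u v m assms S_mult by (subst frac_eq_iff) auto
  qed
  then show ?thesis
    using UN_frac[OF assms, of "\<lambda>a s b t. frac R S (a \<otimes> b) (s \<otimes> t)"] by (simp add: localization_def)
qed

lemma frac_add:
  assumes "a \<in> carrier R" "s \<in> S" "b \<in> carrier R" "t \<in> S"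
  shows "frac R S a s \<oplus>\<^bsub>L\<^esub> frac R S b t = frac R S (a \<otimes> t \<oplus> b \<otimes> s) (s \<otimes> t)"
proof -
  have "frac R S (a' \<otimes> t' \<oplus> b' \<otimes> s') (s' \<otimes> t') = frac R S (a \<otimes> t \<oplus> b \<otimes> s) (s \<otimes> t)"
    if 1: "(a', s') \<in> frac R S a s" and 2: "(b', t') \<in> frac R S b t" for a' s' b' t'
  proof -
    obtain u v where u: "u \<in> S" "u \<otimes> (a \<otimes> s') = u \<otimes> (a' \<otimes> s)"
      and v: "v \<in> S" "v \<otimes> (b \<otimes> t') = v \<otimes> (b' \<otimes> t)"
      using 1 2 by (auto simp: mem_frac)
    have m: "a' \<in> carrier R" "s' \<in> S" "b' \<in> carrier R" "t' \<in> S" using 1 2 by (auto simp: mem_frac)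
    note cl = assms(1,3) m(1,3) S_closed[OF assms(2)] S_closed[OF assms(4)] S_closed[OF m(2)]
      S_closed[OF m(4)] S_closed[OF u(1)] S_closed[OF v(1)]
    have "(u \<otimes> v) \<otimes> ((a' \<otimes> t' \<oplus> b' \<otimes> s') \<otimes> (s \<otimes> t))
        = (u \<otimes> (a' \<otimes> s)) \<otimes> (v \<otimes> t \<otimes> t') \<oplus> (v \<otimes> (b' \<otimes> t)) \<otimes> (u \<otimes> s \<otimes> s')"
      using cl by algebra
    also have "\<dots> = (u \<otimes> v) \<otimes> ((a \<otimes> t \<oplus> b \<otimes> s) \<otimes> (s' \<otimes> t'))"
      unfolding u(2)[symmetric] v(2)[symmetric] using cl by algebra
    finally show ?thesis using u v m assms S_mult cl by (subst frac_eq_iff) auto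
  qed
  then show ?thesis
    using UN_frac[OF assms, of "\<lambda>a s b t. frac R S (a \<otimes> t \<oplus> b \<otimes> s) (s \<otimes> t)"]
    by (simp add: localization_def)
qed

lemma localization_one: "\<one>\<^bsub>L\<^esub> = frac R S \<one> \<one>"
  and localization_zero: "\<zero>\<^bsub>L\<^esub> = frac R S \<zero> \<one>"
  by (simp_all add: localization_def)

lemmas frac_simps = frac_mult frac_add localization_one localization_zero

lemma cring_localization: "cring L"
proof (rule cringI)
  show "abelian_group L"
  proof (rule abelian_groupI)
    fix x y z assume "x \<in> carrier L" "y \<in> carrier L" "z \<in> carrier L"
    then obtain a s b t c r where m: "a \<in> carrier R" "s \<in> S" "b \<in> carrier R" "t \<in> S" "c \<in> carrier R" "r \<in> S"
      and xyz: "x = frac R S a s" "y = frac R S b t" "z = frac R S c r" by (metis frac_cases)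
    note cl = m(1,3,5) m(2,4,6)[THEN S_closed]
    show "x \<oplus>\<^bsub>L\<^esub> y \<oplus>\<^bsub>L\<^esub> z = x \<oplus>\<^bsub>L\<^esub> (y \<oplus>\<^bsub>L\<^esub> z)"
      unfolding xyz using m cl S_mult
      by (simp add: frac_simps, intro frac_eqI) (simp_all, algebra)
  next
    fix x y assume "x \<in> carrier L" "y \<in> carrier L"
    then obtain a s b t where m: "a \<in> carrier R" "s \<in> S" "b \<in> carrier R" "t \<in> S"
      and xy: "x = frac R S a s" "y = frac R S b t" by (metis frac_cases)
    note cl = m(1,3) m(2,4)[THEN S_closed]
    show "x \<oplus>\<^bsub>L\<^esub> y \<in> carrier L"
      unfolding xy using m cl S_mult by (simp add: frac_simps frac_closed)
    show "x \<oplus>\<^bsub>L\<^esub> y = y \<oplus>\<^bsub>L\<^esub> x"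
      unfolding xy using m cl S_mult by (simp add: frac_simps m_comm a_comm)
  next
    fix x assume "x \<in> carrier L"
    then obtain a s where m: "a \<in> carrier R" "s \<in> S" and x: "x = frac R S a s" by (metis frac_cases)
    note cl = m(1) m(2)[THEN S_closed]
    show "\<zero>\<^bsub>L\<^esub> \<oplus>\<^bsub>L\<^esub> x = x" unfolding x using m cl S_one by (simp add: frac_simps)
    have "frac R S (\<ominus> a) s \<oplus>\<^bsub>L\<^esub> x = \<zero>\<^bsub>L\<^esub>"
      unfolding x using m cl S_mult S_one
      by (simp add: frac_simps, intro frac_eqI) (simp_all add: l_minus l_neg)
    then show "\<exists>y\<in>carrier L. y \<oplus>\<^bsub>L\<^esub> x = \<zero>\<^bsub>L\<^esub>" using m frac_closed[of "\<ominus> a" s] by auto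
  qed (use S_one in \<open>auto simp: frac_simps intro: frac_closed\<close>)
  show "comm_monoid L"
  proof (rule comm_monoidI)
    fix x y z assume "x \<in> carrier L" "y \<in> carrier L" "z \<in> carrier L"
    then obtain a s b t c r where m: "a \<in> carrier R" "s \<in> S" "b \<in> carrier R" "t \<in> S" "c \<in> carrier R" "r \<in> S"
      and xyz: "x = frac R S a s" "y = frac R S b t" "z = frac R S c r" by (metis frac_cases)
    show "x \<otimes>\<^bsub>L\<^esub> y \<otimes>\<^bsub>L\<^esub> z = x \<otimes>\<^bsub>L\<^esub> (y \<otimes>\<^bsub>L\<^esub> z)"
      unfolding xyz using m S_mult S_closed by (simp add: frac_simps m_assoc)
  next
    fix x y assume "x \<in> carrier L" "y \<in> carrier L"
    then obtain a s b t where m: "a \<in> carrier R" "s \<in> S" "b \<in> carrier R" "t \<in> S"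
      and xy: "x = frac R S a s" "y = frac R S b t" by (metis frac_cases)
    show "x \<otimes>\<^bsub>L\<^esub> y \<in> carrier L"
      unfolding xy using m S_mult by (simp add: frac_simps frac_closed)
    show "x \<otimes>\<^bsub>L\<^esub> y = y \<otimes>\<^bsub>L\<^esub> x"
      unfolding xy using m S_closed by (simp add: frac_simps m_comm)
  next
    fix x assume "x \<in> carrier L"
    then obtain a s where m: "a \<in> carrier R" "s \<in> S" and x: "x = frac R S a s" by (metis frac_cases)
    show "\<one>\<^bsub>L\<^esub> \<otimes>\<^bsub>L\<^esub> x = x" unfolding x using m S_closed S_one by (simp add: frac_simps)
  qed (use S_one in \<open>auto simp: frac_simps intro: frac_closed\<close>)
  fix x y z assume "x \<in> carrier L" "y \<in> carrier L" "z \<in> carrier L"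
  then obtain a s b t c r where m: "a \<in> carrier R" "s \<in> S" "b \<in> carrier R" "t \<in> S" "c \<in> carrier R" "r \<in> S"
    and xyz: "x = frac R S a s" "y = frac R S b t" "z = frac R S c r" by (metis frac_cases)
  note cl = m(1,3,5) m(2,4,6)[THEN S_closed]
  show "(x \<oplus>\<^bsub>L\<^esub> y) \<otimes>\<^bsub>L\<^esub> z = x \<otimes>\<^bsub>L\<^esub> z \<oplus>\<^bsub>L\<^esub> y \<otimes>\<^bsub>L\<^esub> z"
    unfolding xyz using m cl S_mult
    by (simp add: frac_simps, intro frac_eqI) (simp_all, algebra)
qed

sublocale L: cring L by (rule cring_localization)

lemma loc_map_hom: "loc_map R S \<in> ring_hom R L"
  by (rule ring_hom_memI)
    (use S_one in \<open>auto simp: loc_map_def frac_simps intro: frac_closed\<close>)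

lemma loc_map_eq_zero:
  assumes "a \<in> carrier R"
  shows "loc_map R S a = \<zero>\<^bsub>L\<^esub> \<longleftrightarrow> (\<exists>u\<in>S. u \<otimes> a = \<zero>)"
  using assms S_one S_closed by (auto simp: loc_map_def localization_zero frac_eq_iff)

lemma frac_mult_loc_map:
  assumes "a \<in> carrier R" "s \<in> S"
  shows "frac R S a s \<otimes>\<^bsub>L\<^esub> loc_map R S s = loc_map R S a"
  unfolding loc_map_def using assms S_closed S_one S_mult
  by (simp add: frac_mult) (rule frac_eqI, auto)

lemma loc_map_unit:
  assumes "s \<in> S"
  shows "loc_map R S s \<in> Units L"
proof (rule L.Units_of_mult)
  show "loc_map R S s \<otimes>\<^bsub>L\<^esub> frac R S \<one> s \<in> Units L"
    using frac_mult_loc_map[OF one_closed assms] assms frac_closed[OF one_closed assms]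
      ring_hom_closed[OF loc_map_hom S_closed[OF assms]] ring_hom_one[OF loc_map_hom]
    by (simp add: L.m_comm)
qed (use assms in \<open>auto intro: frac_closed ring_hom_closed[OF loc_map_hom] S_closed\<close>)

section \<open>The universal property of localization\<close>

definition loc_lift :: "('c, 'd) ring_scheme \<Rightarrow> ('a \<Rightarrow> 'c) \<Rightarrow> ('a \<times> 'a) set \<Rightarrow> 'c" where
  "loc_lift T h x = (case SOME q. q \<in> x of (a, s) \<Rightarrow> h a \<otimes>\<^bsub>T\<^esub> inv\<^bsub>T\<^esub> h s)"

context
  fixes T :: "('c, 'd) ring_scheme" and h :: "'a \<Rightarrow> 'c"
  assumes T: "cring T" and h: "h \<in> ring_hom R T" and units: "\<And>s. s \<in> S \<Longrightarrow> h s \<in> Units T"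
begin

interpretation T: cring T by (rule T)

text \<open>The chosen representative b/t is linked to a/s by a witness u; h(u) is a unit of T and
  can be cancelled.\<close>

lemma loc_lift_frac:
  assumes a: "a \<in> carrier R" and s: "s \<in> S"
  shows "loc_lift T h (frac R S a s) = h a \<otimes>\<^bsub>T\<^esub> inv\<^bsub>T\<^esub> h s"
proof -
  obtain b t where bt: "(SOME q. q \<in> frac R S a s) = (b, t)" by (cases "SOME q. q \<in> frac R S a s")
  have "(SOME q. q \<in> frac R S a s) \<in> frac R S a s"
    by (rule someI[where P = "\<lambda>q. q \<in> frac R S a s", OF frac_self[OF a s]])
  then have "(b, t) \<in> frac R S a s" by (simp only: bt)
  then obtain u where m: "b \<in> carrier R" "t \<in> S" "u \<in> S" "u \<otimes> (a \<otimes> t) = u \<otimes> (b \<otimes> s)"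
    by (auto simp: mem_frac)
  have cl: "s \<in> carrier R" "t \<in> carrier R" "u \<in> carrier R" using s m S_closed by auto
  have hc: "h a \<in> carrier T" "h b \<in> carrier T" "h s \<in> carrier T" "h t \<in> carrier T" "h u \<in> carrier T"
    using a m cl ring_hom_closed[OF h] by auto
  have "h u \<otimes>\<^bsub>T\<^esub> (h a \<otimes>\<^bsub>T\<^esub> h t) = h (u \<otimes> (a \<otimes> t))"
    using a cl by (simp add: ring_hom_mult[OF h])
  also have "\<dots> = h (u \<otimes> (b \<otimes> s))" by (simp only: m(4))
  also have "\<dots> = h u \<otimes>\<^bsub>T\<^esub> (h b \<otimes>\<^bsub>T\<^esub> h s)" using m(1) cl by (simp add: ring_hom_mult[OF h])
  finally have "h u \<otimes>\<^bsub>T\<^esub> (h a \<otimes>\<^bsub>T\<^esub> h t) = h u \<otimes>\<^bsub>T\<^esub> (h b \<otimes>\<^bsub>T\<^esub> h s)" .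
  then have "h a \<otimes>\<^bsub>T\<^esub> h t = h b \<otimes>\<^bsub>T\<^esub> h s" using units[OF m(3)] hc by simp
  then have "h b \<otimes>\<^bsub>T\<^esub> inv\<^bsub>T\<^esub> h t = h a \<otimes>\<^bsub>T\<^esub> inv\<^bsub>T\<^esub> h s"
    using hc units s m by (intro T.Units_cancel_eq) auto
  then show ?thesis by (simp add: loc_lift_def bt)
qed

lemma loc_lift_loc_map: "a \<in> carrier R \<Longrightarrow> loc_lift T h (loc_map R S a) = h a"
  unfolding loc_map_def using S_one ring_hom_closed[OF h]
  by (simp add: loc_lift_frac ring_hom_one[OF h])

lemma loc_lift_hom: "loc_lift T h \<in> ring_hom L T"
proof (rule ring_hom_memI)
  fix x assume "x \<in> carrier L"
  then obtain a s where m: "a \<in> carrier R" "s \<in> S" and x: "x = frac R S a s" by (rule frac_cases)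
  have hc: "h a \<in> carrier T" "h s \<in> Units T" "h s \<in> carrier T" using m ring_hom_closed[OF h] units S_closed by auto
  show "loc_lift T h x \<in> carrier T" using m hc by (simp add: x loc_lift_frac)
  fix y assume "y \<in> carrier L"
  then obtain b t where n: "b \<in> carrier R" "t \<in> S" and y: "y = frac R S b t" by (rule frac_cases)
  have hd: "h b \<in> carrier T" "h t \<in> Units T" "h t \<in> carrier T" using n ring_hom_closed[OF h] units S_closed by auto
  have cl: "s \<in> carrier R" "t \<in> carrier R" using m n S_closed by auto
  let ?i = "inv\<^bsub>T\<^esub> h s" and ?j = "inv\<^bsub>T\<^esub> h t"
  have ij: "?i \<in> carrier T" "?j \<in> carrier T" using hc hd by auto
  have inv: "inv\<^bsub>T\<^esub> (h s \<otimes>\<^bsub>T\<^esub> h t) = ?i \<otimes>\<^bsub>T\<^esub> ?j"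
  proof (rule T.comm_inv_char[symmetric, THEN sym])
    have "h s \<otimes>\<^bsub>T\<^esub> h t \<otimes>\<^bsub>T\<^esub> (?i \<otimes>\<^bsub>T\<^esub> ?j) = (h s \<otimes>\<^bsub>T\<^esub> ?i) \<otimes>\<^bsub>T\<^esub> (h t \<otimes>\<^bsub>T\<^esub> ?j)"
      using hc hd ij by algebra
    then show "h s \<otimes>\<^bsub>T\<^esub> h t \<otimes>\<^bsub>T\<^esub> (?i \<otimes>\<^bsub>T\<^esub> ?j) = \<one>\<^bsub>T\<^esub>" using hc hd by simp
  qed (use hc hd ij in auto)
  have "loc_lift T h (x \<otimes>\<^bsub>L\<^esub> y) = (h a \<otimes>\<^bsub>T\<^esub> h b) \<otimes>\<^bsub>T\<^esub> (?i \<otimes>\<^bsub>T\<^esub> ?j)"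
    unfolding x y using m n cl S_mult by (simp add: frac_mult loc_lift_frac ring_hom_mult[OF h] inv)
  also have "\<dots> = (h a \<otimes>\<^bsub>T\<^esub> ?i) \<otimes>\<^bsub>T\<^esub> (h b \<otimes>\<^bsub>T\<^esub> ?j)" using hc(1) hd(1) ij by algebra
  finally show "loc_lift T h (x \<otimes>\<^bsub>L\<^esub> y) = loc_lift T h x \<otimes>\<^bsub>T\<^esub> loc_lift T h y"
    using m n by (simp add: x y loc_lift_frac)
  have "loc_lift T h (x \<oplus>\<^bsub>L\<^esub> y) = (h a \<otimes>\<^bsub>T\<^esub> h t \<oplus>\<^bsub>T\<^esub> h b \<otimes>\<^bsub>T\<^esub> h s) \<otimes>\<^bsub>T\<^esub> (?i \<otimes>\<^bsub>T\<^esub> ?j)"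
    unfolding x y using m n cl S_mult
    by (simp add: frac_add loc_lift_frac ring_hom_mult[OF h] ring_hom_add[OF h] inv)
  also have "\<dots> = (h a \<otimes>\<^bsub>T\<^esub> ?i) \<otimes>\<^bsub>T\<^esub> (h t \<otimes>\<^bsub>T\<^esub> ?j) \<oplus>\<^bsub>T\<^esub> (h b \<otimes>\<^bsub>T\<^esub> ?j) \<otimes>\<^bsub>T\<^esub> (h s \<otimes>\<^bsub>T\<^esub> ?i)"
    using hc(1,3) hd(1,3) ij by algebra
  also have "\<dots> = (h a \<otimes>\<^bsub>T\<^esub> ?i) \<oplus>\<^bsub>T\<^esub> (h b \<otimes>\<^bsub>T\<^esub> ?j)" using hc hd ij by simp
  finally show "loc_lift T h (x \<oplus>\<^bsub>L\<^esub> y) = loc_lift T h x \<oplus>\<^bsub>T\<^esub> loc_lift T h y"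
    using m n by (simp add: x y loc_lift_frac)
next
  show "loc_lift T h \<one>\<^bsub>L\<^esub> = \<one>\<^bsub>T\<^esub>"
    using S_one by (simp add: localization_one loc_lift_frac ring_hom_one[OF h])
qed

end

end

section \<open>Powers of ideals and completions\<close>

context cring
begin

abbreviation ipow :: "'a set \<Rightarrow> nat \<Rightarrow> 'a set" where
  "ipow I m \<equiv> I [^]\<^bsub>ideals_set R\<^esub> m"

text \<open>The zeroth power is the whole ring, so level 0 of a completion is the zero ring.\<close>

lemma ipow_0: "ipow I 0 = carrier R"
  and ipow_Suc: "ipow I (Suc m) = ideal_prod R (ipow I m) I"
  by (simp_all add: ideals_set_def)

lemma one_ideals_set [simp]: "\<one>\<^bsub>ideals_set R\<^esub> = carrier R"
  by (simp add: ideals_set_def)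

lemma ideal_prod_subsetI:
  assumes "ideal K R" "\<And>i j. i \<in> I \<Longrightarrow> j \<in> J \<Longrightarrow> i \<otimes> j \<in> K"
  shows "ideal_prod R I J \<subseteq> K"
proof
  interpret K: ideal K R by fact
  fix x assume "x \<in> ideal_prod R I J"
  then show "x \<in> K" by (induction rule: ideal_prod.induct) (use assms(2) in auto)
qed

lemma ipow_ideal: "ideal I R \<Longrightarrow> ideal (ipow I m) R"
  by (induction m) (simp_all only: ipow_0 ipow_Suc oneideal ideal_prod_is_ideal)

lemma ipow_antimono:
  assumes "ideal I R" "m \<le> k"
  shows "ipow I k \<subseteq> ipow I m"
  using assms(2)
proof (induction rule: dec_induct)
  case (step k)
  then show ?case
    using ideal_prod_inter[OF ipow_ideal[OF assms(1)] assms(1), of k] by (simp only: ipow_Suc) blast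
qed simp

lemma ipow_mono:
  assumes "I \<subseteq> J" "ideal I R" "ideal J R"
  shows "ipow I m \<subseteq> ipow J m"
proof (induction m)
  case (Suc m)
  show ?case
    unfolding ipow_Suc
    by (rule ideal_prod_subsetI[OF ideal_prod_is_ideal[OF ipow_ideal[OF assms(3)] assms(3)]])
      (use Suc assms(1) in \<open>auto intro: ideal_prod.prod\<close>)
qed (simp add: ipow_0)

lemma pow_mem_ipow:
  assumes "ideal I R" "x \<in> I"
  shows "x [^] m \<in> ipow I m"
proof (induction m)
  case (Suc m)
  then show ?case using assms(2) by (simp only: ipow_Suc nat_pow_Suc ideal_prod.prod)
qed (simp add: ipow_0)

lemma set_add_mem_iff: "x \<in> I <+> J \<longleftrightarrow> (\<exists>i\<in>I. \<exists>j\<in>J. x = i \<oplus> j)"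
  by (auto simp: set_add_def')

text \<open>Of a + b factors from N + M, at least a come from N or at least b from M. Formally, one
  factor is split off: its part in N raises exponent a - 1 to a, its part in M raises b - 1 to
  b.\<close>

lemma ipow_add_subset:
  assumes N: "ideal N R" and M: "ideal M R"
  shows "ipow (N <+> M) (a + b) \<subseteq> ipow N a <+> ipow M b"
proof (induction "a + b" arbitrary: a b)
  case 0
  have "x \<in> carrier R <+> carrier R" if "x \<in> carrier R" for x :: 'a
    unfolding set_add_mem_iff using that by (intro bexI[of _ \<zero>] bexI[of _ x]) auto
  then show ?case using 0 by auto
next
  case (Suc k)
  have NM: "ideal (N <+> M) R" by (rule add_ideals[OF N M])
  have sub: "ipow (N <+> M) (a + b) \<subseteq> carrier R"
    by (rule additive_subgroup.a_subset[OF ideal.axioms(1)[OF ipow_ideal[OF NM]]])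
  consider "a = 0" | "b = 0" | a' b' where "a = Suc a'" "b = Suc b'" by (meson not0_implies_Suc)
  then show ?case
  proof cases
    case 1
    interpret Mb: ideal "ipow M b" R by (rule ipow_ideal[OF M])
    show ?thesis
    proof
      fix x assume "x \<in> ipow (N <+> M) (a + b)"
      then have "x = x \<oplus> \<zero>" "x \<in> carrier R" using sub by auto
      then show "x \<in> ipow N a <+> ipow M b"
        unfolding set_add_mem_iff 1 ipow_0 using Mb.zero_closed by blast
    qed
  next
    case 2
    interpret Na: ideal "ipow N a" R by (rule ipow_ideal[OF N])
    show ?thesis
    proof
      fix x assume "x \<in> ipow (N <+> M) (a + b)"
      then have "x = \<zero> \<oplus> x" "x \<in> carrier R" using sub by auto
      then show "x \<in> ipow N a <+> ipow M b"
        unfolding set_add_mem_iff 2 ipow_0 using Na.zero_closed by blast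
    qed
  next
    case (3 a' b')
    interpret Na: ideal "ipow N a" R by (rule ipow_ideal[OF N])
    interpret Mb: ideal "ipow M b" R by (rule ipow_ideal[OF M])
    interpret N: ideal N R by fact
    interpret M: ideal M R by fact
    have K: "ideal (ipow N a <+> ipow M b) R" by (rule add_ideals[OF ipow_ideal[OF N] ipow_ideal[OF M]])
    interpret K: ideal "set_add R (ipow N a) (ipow M b)" R by (rule K)
    have IH1: "ipow (N <+> M) k \<subseteq> ipow N a' <+> ipow M b" using Suc(1)[of a' b] Suc(2) 3 by simp
    have IH2: "ipow (N <+> M) k \<subseteq> ipow N a <+> ipow M b'" using Suc(1)[of a b'] Suc(2) 3 by simp
    have l: "u \<otimes> x \<in> ipow N a <+> ipow M b" if u: "u \<in> ipow (N <+> M) k" and x: "x \<in> N" for u x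
    proof -
      obtain i j where ij: "i \<in> ipow N a'" "j \<in> ipow M b" "u = i \<oplus> j"
        using u IH1 set_add_mem_iff by blast
      have c: "i \<in> carrier R" "j \<in> carrier R" "x \<in> carrier R"
        using ij x N.a_Hcarr Mb.a_Hcarr ideal.Icarr[OF ipow_ideal[OF N]] by auto
      have "i \<otimes> x \<in> ipow N a" unfolding 3 ipow_Suc using ij x by (rule_tac ideal_prod.prod)
      moreover have "j \<otimes> x \<in> ipow M b" using ij c Mb.I_r_closed by simp
      moreover have "u \<otimes> x = i \<otimes> x \<oplus> j \<otimes> x" using ij(3) c by (simp add: l_distr)
      ultimately show ?thesis unfolding set_add_mem_iff by blast
    qed
    have r: "u \<otimes> x \<in> ipow N a <+> ipow M b" if u: "u \<in> ipow (N <+> M) k" and x: "x \<in> M" for u x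
    proof -
      obtain i j where ij: "i \<in> ipow N a" "j \<in> ipow M b'" "u = i \<oplus> j"
        using u IH2 set_add_mem_iff by blast
      have c: "i \<in> carrier R" "j \<in> carrier R" "x \<in> carrier R"
        using ij x M.a_Hcarr Na.a_Hcarr ideal.Icarr[OF ipow_ideal[OF M]] by auto
      have "j \<otimes> x \<in> ipow M b" unfolding 3 ipow_Suc using ij x by (rule_tac ideal_prod.prod)
      moreover have "i \<otimes> x \<in> ipow N a" using ij c Na.I_r_closed by simp
      moreover have "u \<otimes> x = i \<otimes> x \<oplus> j \<otimes> x" using ij(3) c by (simp add: l_distr)
      ultimately show ?thesis unfolding set_add_mem_iff by blast
    qed
    have "ideal_prod R (ipow (N <+> M) k) (N <+> M) \<subseteq> ipow N a <+> ipow M b"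
    proof (rule ideal_prod_subsetI[OF K])
      fix u v :: 'a assume u: "u \<in> ipow (N <+> M) k" and "v \<in> N <+> M"
      then obtain x y where xy: "x \<in> N" "y \<in> M" "v = x \<oplus> y" using set_add_mem_iff by blast
      have "u \<in> carrier R" using u ideal.Icarr[OF ipow_ideal[OF NM]] by blast
      then have "u \<otimes> v = u \<otimes> x \<oplus> u \<otimes> y" using xy N.a_Hcarr M.a_Hcarr by (simp add: r_distr)
      then show "u \<otimes> v \<in> ipow N a <+> ipow M b" using l[OF u xy(1)] r[OF u xy(2)] K.a_closed by simp
    qed
    then show ?thesis using Suc(2) by (metis ipow_Suc)
  qed
qed

lemma ipow_Idl_single:
  assumes f: "f \<in> carrier R"
  shows "ipow (Idl {f}) k \<subseteq> Idl {f [^] k}"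
proof (induction k)
  case 0
  have "x \<in> PIdl (f [^] (0::nat))" if "x \<in> carrier R" for x
    using that unfolding cgenideal_def by (auto intro!: exI[of _ x])
  then show ?case using f cgenideal_eq_genideal[of "f [^] (0::nat)"] by auto
next
  case (Suc k)
  have fk: "f [^] k \<in> carrier R" "f [^] Suc k \<in> carrier R" using f by auto
  show ?case
    unfolding ipow_Suc
  proof (rule ideal_prod_subsetI)
    show "ideal (Idl {f [^] Suc k}) R" using fk by (intro genideal_ideal) simp
    fix i j assume "i \<in> ipow (Idl {f}) k" "j \<in> Idl {f}"
    then have "i \<in> PIdl (f [^] k)" "j \<in> PIdl f" using Suc f fk cgenideal_eq_genideal by blast+
    then obtain x y where "x \<in> carrier R" "i = x \<otimes> f [^] k" "y \<in> carrier R" "j = y \<otimes> f"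
      unfolding cgenideal_def by auto
    then have "i \<otimes> j = (x \<otimes> y) \<otimes> f [^] Suc k" "x \<otimes> y \<in> carrier R" using f fk by (auto simp: m_ac)
    then have "i \<otimes> j \<in> PIdl (f [^] Suc k)" unfolding cgenideal_def by blast
    then show "i \<otimes> j \<in> Idl {f [^] Suc k}" using fk cgenideal_eq_genideal by blast
  qed
qed

text \<open>A pigeonhole on exponents: each generator adds q to the required power. The construction
  gives 1 + q|F|, the 1 coming from the empty set, whose ideal is zero but whose zeroth power is the
  whole ring.\<close>

lemma ipow_Idl_finite:
  assumes "finite F" "F \<subseteq> carrier R" "ideal K R" "\<And>f. f \<in> F \<Longrightarrow> f [^] (q::nat) \<in> K"
  shows "\<exists>m. ipow (Idl F) m \<subseteq> K"
  using assms(1,2,4)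
proof (induction F)
  case empty
  interpret K: ideal K R by fact
  have Z: "Idl {} \<subseteq> {\<zero>}" by (rule genideal_minimal[OF zeroideal]) simp
  have "ideal_prod R (ipow (Idl {}) 0) (Idl {}) \<subseteq> K"
  proof (rule ideal_prod_subsetI[OF assms(3)])
    fix i j assume "i \<in> ipow (Idl {}) 0" "j \<in> Idl {}"
    then have "i \<in> carrier R" "j = \<zero>" using Z by auto
    then show "i \<otimes> j \<in> K" by simp
  qed
  then show ?case by (metis ipow_Suc)
next
  case (insert f F)
  interpret K: ideal K R by fact
  have c: "f \<in> carrier R" "F \<subseteq> carrier R" using insert.prems by auto
  have iF: "ideal (Idl F) R" and i_f: "ideal (Idl {f}) R" using c by (auto intro: genideal_ideal)
  interpret iF: ideal "Idl F" R by (rule iF)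
  interpret i_f: ideal "Idl {f}" R by (rule i_f)
  have add: "ideal (Idl F <+> Idl {f}) R" by (rule add_ideals[OF iF i_f])
  obtain m where m: "ipow (Idl F) m \<subseteq> K" using insert.IH insert.prems c by auto
  have q: "ipow (Idl {f}) q \<subseteq> K"
    using ipow_Idl_single[OF c(1), of q] genideal_minimal[OF assms(3), of "{f [^] q}"] insert.prems
    by blast
  have "insert f F \<subseteq> Idl F <+> Idl {f}"
  proof
    fix x assume "x \<in> insert f F"
    then consider "x \<in> {f}" | "x \<in> F" by blast
    then show "x \<in> Idl F <+> Idl {f}"
    proof cases
      case 1
      then have "x = \<zero> \<oplus> x" "x \<in> Idl {f}" using c genideal_self'[OF c(1)] by auto
      then show ?thesis using iF.zero_closed unfolding set_add_mem_iff by blast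
    next
      case 2
      then have "x = x \<oplus> \<zero>" "x \<in> Idl F" using c genideal_self[OF c(2)] by auto
      then show ?thesis using i_f.zero_closed unfolding set_add_mem_iff by blast
    qed
  qed
  then have "Idl (insert f F) \<subseteq> Idl F <+> Idl {f}" by (rule genideal_minimal[OF add])
  then have "ipow (Idl (insert f F)) (m + q) \<subseteq> ipow (Idl F <+> Idl {f}) (m + q)"
    by (rule ipow_mono[OF _ genideal_ideal[OF insert.prems(1)] add])
  also have "\<dots> \<subseteq> ipow (Idl F) m <+> ipow (Idl {f}) q" by (rule ipow_add_subset[OF iF i_f])
  also have "\<dots> \<subseteq> K" using K.a_closed[OF subsetD[OF m] subsetD[OF q]] by (auto simp: set_add_mem_iff)
  finally show ?case by blast
qed

lemma coset_eq_iff: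
  assumes "ideal I R" "x \<in> carrier R" "y \<in> carrier R"
  shows "I +> x = I +> y \<longleftrightarrow> x \<ominus> y \<in> I"
proof -
  interpret I: ideal I R by fact
  show ?thesis
    using quotient_eq_iff_same_a_r_cos[OF assms(1-3)] by blast
qed

text \<open>With I and J consecutive powers of an ideal, this computes the transition map of the
  completion on a coset.\<close>

lemma set_add_coset:
  assumes I: "ideal I R" and J: "ideal J R" and "J \<subseteq> I" "y \<in> carrier R"
  shows "I <+> (J +> y) = I +> y"
proof -
  interpret I: ideal I R by fact
  interpret J: ideal J R by fact
  show ?thesis
  proof (intro subset_antisym subsetI)
    fix x :: 'a assume "x \<in> I <+> (J +> y)"
    then obtain i j where ij: "i \<in> I" "j \<in> J" "x = i \<oplus> (j \<oplus> y)"
      by (auto simp: set_add_mem_iff a_r_coset_def')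
    then have "x = (i \<oplus> j) \<oplus> y" "i \<oplus> j \<in> I"
      using assms(3,4) I.a_Hcarr J.a_Hcarr I.a_closed by (auto simp: a_assoc)
    then show "x \<in> I +> y" by (auto simp: a_r_coset_def')
  next
    fix x assume "x \<in> I +> y"
    then obtain i where i: "i \<in> I" "x = i \<oplus> y" by (auto simp: a_r_coset_def')
    then show "x \<in> I <+> (J +> y)" using J.a_rcos_self[OF assms(4)] by (auto simp: set_add_mem_iff)
  qed
qed

end

text \<open>An abstract criterion. As I^(m i) \<subseteq> ker \<open>\<sigma> i\<close> \<subseteq>
  I^i, the kernels and the powers of I are cofinal, so the I-adic completion is the limit of the
  quotients by the kernels, that is, of the rings \<open>B i\<close>.\<close>

locale adic_comparison = cring R + lim: inverse_system B f
  for R :: "('a, 'b) ring_scheme" (structure) and I :: "'a set" and B :: "nat \<Rightarrow> ('c, 'd) ring_scheme" and f and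
    \<sigma> :: "nat \<Rightarrow> 'a \<Rightarrow> 'c" and m :: "nat \<Rightarrow> nat" +
  assumes I: "ideal I R" and \<sigma>_hom: "\<sigma> i \<in> ring_hom R (B i)"
    and \<sigma>_compat: "a \<in> carrier R \<Longrightarrow> f i (\<sigma> (Suc i) a) = \<sigma> i a"
    and \<sigma>_surj: "b \<in> carrier (B i) \<Longrightarrow> \<exists>a\<in>carrier R. \<sigma> i a = b"
    and \<sigma>_ker: "a \<in> carrier R \<Longrightarrow> \<sigma> i a = \<zero>\<^bsub>B i\<^esub> \<Longrightarrow> a \<in> ipow I i"
    and \<sigma>_ipow: "a \<in> ipow I (m i) \<Longrightarrow> \<sigma> i a = \<zero>\<^bsub>B i\<^esub>"
begin

interpretation \<sigma>: ring_hom_ring R "B i" "\<sigma> i" for i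
  by (intro ring_hom_ringI2 ring_axioms cring.axioms(1)[OF lim.cring_stage] \<sigma>_hom)

abbreviation C where "C \<equiv> completion R I"

text \<open>\<open>\<sigma> i\<close> is constant on cosets of I^(m i), so the element chosen from
  the coset at level m i does not matter.\<close>

definition comparison :: "(nat \<Rightarrow> 'a set) \<Rightarrow> nat \<Rightarrow> 'c" where
  "comparison a = (\<lambda>i. \<sigma> i (SOME x. x \<in> a (m i)))"

lemma ipow_id: "ideal (ipow I k) R" by (rule ipow_ideal[OF I])

lemma completion_carrier: "a \<in> carrier C \<longleftrightarrow>
    (\<forall>k. a k \<in> carrier (R Quot ipow I k) \<and> ipow I k <+> a (Suc k) = a k)"
  by (simp add: completion_def inv_lim_def)

lemma completion_coset:
  assumes "a \<in> carrier C" "x \<in> a k"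
  shows "x \<in> carrier R" "a k = ipow I k +> x"
proof -
  interpret Ik: ideal "ipow I k" R by (rule ipow_id)
  have "a k \<in> carrier (R Quot ipow I k)" using assms(1) by (simp add: completion_carrier)
  then obtain y where y: "y \<in> carrier R" "a k = ipow I k +> y" by (auto simp: carrier_FactRing)
  show x: "x \<in> carrier R" using assms(2) y Ik.a_Hcarr by (auto simp: a_r_coset_def')
  show "a k = ipow I k +> x"
    using a_repr_independence[OF _ y(1) Ik.a_subgroup, of x] assms(2) y(2) by simp
qed

lemma completion_nonempty:
  assumes "a \<in> carrier C"
  shows "\<exists>x. x \<in> a k"
proof -
  interpret Ik: ideal "ipow I k" R by (rule ipow_id)
  have "a k \<in> carrier (R Quot ipow I k)" using assms by (simp add: completion_carrier)
  then obtain y where y: "y \<in> carrier R" "a k = ipow I k +> y" by (auto simp: carrier_FactRing)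
  then show ?thesis using Ik.a_rcos_self by blast
qed

lemma completion_down:
  assumes "a \<in> carrier C" "x \<in> a k'" "k \<le> k'"
  shows "x \<in> a k"
  using assms(3,2)
proof (induction rule: dec_induct)
  case (step k')
  interpret Ik: ideal "ipow I k'" R by (rule ipow_id)
  have "x = \<zero> \<oplus> x" using completion_coset(1)[OF assms(1) step.prems] by simp
  then have "x \<in> ipow I k' <+> a (Suc k')" using step.prems Ik.zero_closed unfolding set_add_mem_iff by blast
  then have "x \<in> a k'" using assms(1) completion_carrier by blast
  then show ?case by (rule step.IH)
qed

text \<open>Elements of a deeper coset also lie in the coset at level m i. One representative taken
  deep enough thus computes several coordinates at once.\<close>

lemma comparison_eq:
  assumes a: "a \<in> carrier C" and x: "x \<in> a k" and k: "m i \<le> k"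
  shows "comparison a i = \<sigma> i x"
proof -
  let ?y = "SOME x. x \<in> a (m i)"
  have xm: "x \<in> a (m i)" by (rule completion_down[OF a x k])
  then have y: "?y \<in> a (m i)" by (rule someI[where P = "\<lambda>x. x \<in> a (m i)"])
  have c: "x \<in> carrier R" "?y \<in> carrier R" using completion_coset(1)[OF a] xm y by auto
  have "ipow I (m i) +> ?y = ipow I (m i) +> x" using completion_coset(2)[OF a] xm y by simp
  then have "?y \<ominus> x \<in> ipow I (m i)" using c by (simp add: coset_eq_iff[OF ipow_id])
  then have "\<sigma> i (?y \<ominus> x) = \<zero>\<^bsub>B i\<^esub>" by (rule \<sigma>_ipow)
  then have "\<sigma> i ?y \<ominus>\<^bsub>B i\<^esub> \<sigma> i x = \<zero>\<^bsub>B i\<^esub>" using c by (simp add: a_minus_def)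
  then show ?thesis using c by (simp add: comparison_def)
qed

lemma comparison_completion_map:
  assumes a: "a \<in> carrier R"
  shows "completion_map R I a \<in> carrier C"
    and "comparison (completion_map R I a) = (\<lambda>i. \<sigma> i a)"
proof -
  show c: "completion_map R I a \<in> carrier C"
    unfolding completion_carrier completion_map_def
  proof (intro allI conjI)
    fix k
    show "ipow I k +> a \<in> carrier (R Quot ipow I k)" using a by (simp add: carrier_FactRing)
    show "ipow I k <+> (ipow I (Suc k) +> a) = ipow I k +> a"
      by (rule set_add_coset[OF ipow_id ipow_id ipow_antimono[OF I] a]) simp
  qed
  show "comparison (completion_map R I a) = (\<lambda>i. \<sigma> i a)"
  proof
    fix i
    interpret Ik: ideal "ipow I (m i)" R by (rule ipow_id)
    show "comparison (completion_map R I a) i = \<sigma> i a"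
      by (rule comparison_eq[OF c, of a "m i"]) (use a Ik.a_rcos_self in \<open>auto simp: completion_map_def\<close>)
  qed
qed

text \<open>The continuity required of the canonical isomorphism: coordinate i is controlled by
  level m i alone.\<close>

lemma comparison_zero:
  assumes a: "a \<in> carrier C" and "a (m i) = \<zero>\<^bsub>R Quot ipow I (m i)\<^esub>"
  shows "comparison a i = \<zero>\<^bsub>B i\<^esub>"
proof -
  interpret Ik: ideal "ipow I (m i)" R by (rule ipow_id)
  have "\<zero> \<in> a (m i)" using assms(2) Ik.zero_closed by (simp add: FactRing_def)
  then show ?thesis using comparison_eq[OF a, of \<zero> "m i" i] by simp
qed

lemma comparison_closed:
  assumes a: "a \<in> carrier C"
  shows "comparison a \<in> carrier (inv_lim B f)"
  unfolding lim.inv_lim_simps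
proof (intro allI conjI)
  fix i
  obtain x where x: "x \<in> a (max (m i) (m (Suc i)))" using completion_nonempty[OF a] by blast
  have "comparison a i = \<sigma> i x" "comparison a (Suc i) = \<sigma> (Suc i) x"
    by (rule comparison_eq[OF a x], simp)+
  then show "comparison a i \<in> carrier (B i)" "f i (comparison a (Suc i)) = comparison a i"
    using completion_coset(1)[OF a x] \<sigma>_compat by simp_all
qed

lemma comparison_hom: "comparison \<in> ring_hom C (inv_lim B f)"
proof (rule ring_hom_memI)
  fix a b assume a: "a \<in> carrier C" and b: "b \<in> carrier C"
  show "comparison a \<in> carrier (inv_lim B f)" by (rule comparison_closed[OF a])
  have op: "(a \<otimes>\<^bsub>C\<^esub> b) k = a k \<otimes>\<^bsub>R Quot ipow I k\<^esub> b k"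
    "(a \<oplus>\<^bsub>C\<^esub> b) k = a k \<oplus>\<^bsub>R Quot ipow I k\<^esub> b k" for k
    by (simp_all add: completion_def inv_lim_def)
  have rep: "(a \<otimes>\<^bsub>C\<^esub> b) k = ipow I k +> (x \<otimes> y)"
    "(a \<oplus>\<^bsub>C\<^esub> b) k = ipow I k +> (x \<oplus> y)" if "x \<in> a k" "y \<in> b k" for k x y
  proof -
    interpret Ik: ideal "ipow I k" R by (rule ipow_id)
    have c: "x \<in> carrier R" "y \<in> carrier R" using completion_coset(1)[OF a that(1)] completion_coset(1)[OF b that(2)] .
    show "(a \<otimes>\<^bsub>C\<^esub> b) k = ipow I k +> (x \<otimes> y)"
      unfolding op completion_coset(2)[OF a that(1)] completion_coset(2)[OF b that(2)]
      using ring_hom_mult[OF Ik.rcos_ring_hom c] by simp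
    show "(a \<oplus>\<^bsub>C\<^esub> b) k = ipow I k +> (x \<oplus> y)"
      unfolding op completion_coset(2)[OF a that(1)] completion_coset(2)[OF b that(2)]
      using ring_hom_add[OF Ik.rcos_ring_hom c] by simp
  qed
  have down: "ipow I k <+> (ipow I (Suc k) +> x) = ipow I k +> x" if "x \<in> carrier R" for k x
    by (rule set_add_coset[OF ipow_id ipow_id ipow_antimono[OF I] that]) simp
  have closed: "a \<otimes>\<^bsub>C\<^esub> b \<in> carrier C"
    "a \<oplus>\<^bsub>C\<^esub> b \<in> carrier C"
    unfolding completion_carrier
  proof -
    \<comment> \<open>Representatives at level k+1 also represent level k, so both levels of a sum
      or product can be computed from the same two elements.\<close>
    have "\<exists>x y. x \<in> carrier R \<and> y \<in> carrier R \<and> x \<in> a k \<and> y \<in> b k \<and> x \<in> a (Suc k) \<and> y \<in> b (Suc k)" for k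
    proof -
      obtain x y where "x \<in> a (Suc k)" "y \<in> b (Suc k)"
        using completion_nonempty[OF a] completion_nonempty[OF b] by blast
      then show ?thesis
        using completion_down[OF a, of x "Suc k" k] completion_down[OF b, of y "Suc k" k]
          completion_coset(1)[OF a] completion_coset(1)[OF b]
        by (intro exI[of _ x] exI[of _ y]) auto
    qed
    then show "\<forall>k. (a \<otimes>\<^bsub>C\<^esub> b) k \<in> carrier (R Quot ipow I k) \<and>
        ipow I k <+> (a \<otimes>\<^bsub>C\<^esub> b) (Suc k) = (a \<otimes>\<^bsub>C\<^esub> b) k"
      "\<forall>k. (a \<oplus>\<^bsub>C\<^esub> b) k \<in> carrier (R Quot ipow I k) \<and>
        ipow I k <+> (a \<oplus>\<^bsub>C\<^esub> b) (Suc k) = (a \<oplus>\<^bsub>C\<^esub> b) k"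
      using rep down by (metis carrier_FactRing imageI m_closed, metis carrier_FactRing imageI a_closed)
  qed
  have "comparison (a \<otimes>\<^bsub>C\<^esub> b) i = comparison a i \<otimes>\<^bsub>B i\<^esub> comparison b i \<and>
    comparison (a \<oplus>\<^bsub>C\<^esub> b) i = comparison a i \<oplus>\<^bsub>B i\<^esub> comparison b i" for i
  proof -
    interpret Ik: ideal "ipow I (m i)" R by (rule ipow_id)
    obtain x y where xy: "x \<in> a (m i)" "y \<in> b (m i)"
      using completion_nonempty[OF a] completion_nonempty[OF b] by blast
    have c: "x \<in> carrier R" "y \<in> carrier R" using completion_coset(1)[OF a xy(1)] completion_coset(1)[OF b xy(2)] .
    have "x \<otimes> y \<in> (a \<otimes>\<^bsub>C\<^esub> b) (m i)" "x \<oplus> y \<in> (a \<oplus>\<^bsub>C\<^esub> b) (m i)"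
      unfolding rep[OF xy] using c by (auto intro: Ik.a_rcos_self)
    then show ?thesis
      using comparison_eq[OF closed(1), of "x \<otimes> y" "m i" i] comparison_eq[OF closed(2), of "x \<oplus> y" "m i" i]
        comparison_eq[OF a xy(1), of i] comparison_eq[OF b xy(2), of i] c by simp
  qed
  then show "comparison (a \<otimes>\<^bsub>C\<^esub> b) = comparison a \<otimes>\<^bsub>inv_lim B f\<^esub> comparison b"
    "comparison (a \<oplus>\<^bsub>C\<^esub> b) = comparison a \<oplus>\<^bsub>inv_lim B f\<^esub> comparison b"
    by (simp_all add: fun_eq_iff lim.inv_lim_simps)
next
  have "\<one>\<^bsub>C\<^esub> = completion_map R I \<one>"
    by (simp add: completion_def inv_lim_def completion_map_def FactRing_def)
  moreover have "comparison (completion_map R I \<one>) = \<one>\<^bsub>inv_lim B f\<^esub>"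
    by (simp add: comparison_completion_map(2)) (simp add: fun_eq_iff lim.inv_lim_simps)
  ultimately show "comparison \<one>\<^bsub>C\<^esub> = \<one>\<^bsub>inv_lim B f\<^esub>" by simp
qed

lemma comparison_inj: "inj_on comparison (carrier C)"
proof (rule inj_onI)
  fix a b assume a: "a \<in> carrier C" and b: "b \<in> carrier C"
    and eq: "comparison a = comparison b"
  show "a = b"
  proof
    fix k
    \<comment> \<open>Level m k is needed to evaluate \<open>\<sigma> k\<close>, level k to recover
      the cosets from the conclusion; the maximum serves both.\<close>
    obtain x y where xy: "x \<in> a (max (m k) k)" "y \<in> b (max (m k) k)"
      using completion_nonempty[OF a] completion_nonempty[OF b] by blast
    have c: "x \<in> carrier R" "y \<in> carrier R" using completion_coset(1)[OF a xy(1)] completion_coset(1)[OF b xy(2)] .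
    have "\<sigma> k x = \<sigma> k y"
      using comparison_eq[OF a xy(1), of k] comparison_eq[OF b xy(2), of k] eq by simp
    then have "\<sigma> k (x \<ominus> y) = \<zero>\<^bsub>B k\<^esub>" using c by (simp add: a_minus_def \<sigma>.S.r_neg)
    then have "x \<ominus> y \<in> ipow I k" using c by (intro \<sigma>_ker) auto
    then have "ipow I k +> x = ipow I k +> y" using c by (simp add: coset_eq_iff[OF ipow_id])
    moreover have "x \<in> a k" "y \<in> b k"
      using completion_down[OF a xy(1), of k] completion_down[OF b xy(2), of k] by auto
    ultimately show "a k = b k" using completion_coset(2)[OF a] completion_coset(2)[OF b] by metis
  qed
qed

text \<open>The coordinates of b are lifted independently of each other. Two consecutive lifts agree
  under \<open>\<sigma> k\<close>, so they differ by an element of I^k and their cosets form a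
  compatible sequence.\<close>

lemma comparison_surj:
  assumes b: "b \<in> carrier (inv_lim B f)"
  shows "\<exists>a\<in>carrier C. comparison a = b"
proof -
  have bc: "b i \<in> carrier (B i)" "f i (b (Suc i)) = b i" for i
    using b by (auto simp: lim.inv_lim_simps)
  have "\<exists>x. x \<in> carrier R \<and> \<sigma> i x = b i" for i using \<sigma>_surj[OF bc(1)] by blast
  then obtain x where x: "\<And>i. x i \<in> carrier R" "\<And>i. \<sigma> i (x i) = b i" by metis
  have xdown: "\<sigma> i (x k) = b i" if "i \<le> k" for i k
  proof -
    have "\<sigma> i y = b i" if "i \<le> k" "\<sigma> k y = b k" "y \<in> carrier R" for y
      using that
    proof (induction rule: dec_induct)
      case (step k)
      then show ?case using \<sigma>_compat[of y k] bc(2)[of k] by simp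
    qed
    then show ?thesis using that x by blast
  qed
  define a where "a k = ipow I k +> x k" for k
  have a: "a \<in> carrier C"
    unfolding completion_carrier
  proof (intro allI conjI)
    fix k
    show "a k \<in> carrier (R Quot ipow I k)" using x by (simp add: carrier_FactRing a_def)
    have "\<sigma> k (x (Suc k) \<ominus> x k) = \<zero>\<^bsub>B k\<^esub>"
      using xdown[of k "Suc k"] x bc(1) by (simp add: a_minus_def \<sigma>.S.r_neg)
    then have "x (Suc k) \<ominus> x k \<in> ipow I k" using x by (intro \<sigma>_ker) auto
    then have "ipow I k +> x (Suc k) = a k" using x by (simp add: coset_eq_iff[OF ipow_id] a_def)
    moreover have "ipow I k <+> a (Suc k) = ipow I k +> x (Suc k)"
      unfolding a_def by (rule set_add_coset[OF ipow_id ipow_id ipow_antimono[OF I] x(1)]) simp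
    ultimately show "ipow I k <+> a (Suc k) = a k" by simp
  qed
  have "comparison a i = b i" for i
  proof -
    let ?k = "max (m i) i"
    interpret Ik: ideal "ipow I ?k" R by (rule ipow_id)
    have "x ?k \<in> a ?k" unfolding a_def by (rule Ik.a_rcos_self[OF x(1)])
    then have "comparison a i = \<sigma> i (x ?k)" by (rule comparison_eq[OF a]) simp
    then show ?thesis using xdown[of i ?k] by simp
  qed
  then show ?thesis using a by blast
qed

lemma comparison_iso: "comparison \<in> ring_iso C (inv_lim B f)"
  using comparison_hom comparison_inj comparison_surj comparison_closed
  unfolding ring_iso_def bij_betw_def by blast

end

section \<open>Localizing the tower\<close>

text \<open>A fraction a/s is determined by its product with s, and f(s) = g(s) is a unit of T that
  can be cancelled.\<close>

lemma (in localize) loc_hom_eqI: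
  assumes T: "cring T" and f: "f \<in> ring_hom L T" and g: "g \<in> ring_hom L T"
    and eq: "\<And>a. a \<in> carrier R \<Longrightarrow> f (loc_map R S a) = g (loc_map R S a)" and x: "x \<in> carrier L"
  shows "f x = g x"
proof -
  interpret T: cring T by fact
  obtain a s where as: "a \<in> carrier R" "s \<in> S" "x = frac R S a s" using x by (rule frac_cases)
  have c: "loc_map R S s \<in> carrier L" using loc_map_unit[OF as(2)] by blast
  have xs: "x \<otimes>\<^bsub>L\<^esub> loc_map R S s = loc_map R S a" using as by (simp add: frac_mult_loc_map)
  have "f x \<otimes>\<^bsub>T\<^esub> f (loc_map R S s) = f (loc_map R S a)"
    using ring_hom_mult[OF f x c] xs by simp
  also have "\<dots> = g x \<otimes>\<^bsub>T\<^esub> g (loc_map R S s)"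
    using ring_hom_mult[OF g x c] xs eq[OF as(1)] by simp
  finally have "f x \<otimes>\<^bsub>T\<^esub> f (loc_map R S s) = g x \<otimes>\<^bsub>T\<^esub> f (loc_map R S s)"
    using eq[OF S_closed[OF as(2)]] by simp
  moreover have "f (loc_map R S s) \<in> Units T"
    by (rule hom_Units[OF cring_localization T f loc_map_unit[OF as(2)]])
  ultimately show ?thesis
    using ring_hom_closed[OF f x] ring_hom_closed[OF g x]
    by (metis T.Units_closed T.Units_l_cancel T.m_comm)
qed

lemma (in localize) loc_ideal_ideal:
  assumes J: "ideal J R"
  shows "ideal (loc_ideal R S J) L"
proof (rule L.cring_idealI)
  interpret J: ideal J R by fact
  show "loc_ideal R S J \<subseteq> carrier L"
    unfolding loc_ideal_def using J.a_Hcarr by (auto intro: frac_closed)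
  show "\<zero>\<^bsub>L\<^esub> \<in> loc_ideal R S J"
    unfolding loc_ideal_def localization_zero using J.zero_closed S_one by blast
next
  interpret J: ideal J R by fact
  fix x y assume "x \<in> loc_ideal R S J" "y \<in> loc_ideal R S J"
  then obtain j s k t where m: "j \<in> J" "s \<in> S" "x = frac R S j s" "k \<in> J" "t \<in> S" "y = frac R S k t"
    unfolding loc_ideal_def by blast
  then have "x \<oplus>\<^bsub>L\<^esub> y = frac R S (j \<otimes> t \<oplus> k \<otimes> s) (s \<otimes> t)" using J.a_Hcarr by (simp add: frac_add)
  moreover have "j \<otimes> t \<oplus> k \<otimes> s \<in> J" using m J.I_r_closed J.a_closed S_closed by simp
  ultimately show "x \<oplus>\<^bsub>L\<^esub> y \<in> loc_ideal R S J"
    unfolding loc_ideal_def using S_mult[OF m(2,5)] by blast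
next
  interpret J: ideal J R by fact
  fix x y assume x: "x \<in> loc_ideal R S J" and y: "y \<in> carrier L"
  obtain j s where js: "j \<in> J" "s \<in> S" "x = frac R S j s" using x unfolding loc_ideal_def by blast
  obtain a t where at: "a \<in> carrier R" "t \<in> S" "y = frac R S a t" using y by (rule frac_cases)
  note m = js at
  have "y \<otimes>\<^bsub>L\<^esub> x = frac R S (a \<otimes> j) (t \<otimes> s)" using m J.a_Hcarr by (simp add: frac_mult)
  moreover have "a \<otimes> j \<in> J" using m J.I_l_closed by simp
  ultimately show "y \<otimes>\<^bsub>L\<^esub> x \<in> loc_ideal R S J"
    unfolding loc_ideal_def using S_mult[OF m(5,2)] by blast
qed

text \<open>The fraction a/s is the multiple of ua by 1/(us); membership may be tested after
  multiplication by any element of S.\<close>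

lemma (in localize) frac_mem_ideal:
  assumes K: "ideal K L" and as: "a \<in> carrier R" "s \<in> S" and u: "u \<in> S" "loc_map R S (u \<otimes> a) \<in> K"
  shows "frac R S a s \<in> K"
proof -
  interpret K: ideal K L by fact
  have "frac R S a s = frac R S \<one> (u \<otimes> s) \<otimes>\<^bsub>L\<^esub> loc_map R S (u \<otimes> a)"
    unfolding loc_map_def using as u(1) S_mult S_one S_closed
    by (simp add: frac_mult) (rule frac_eqI, auto simp: m_ac)
  then show ?thesis using K.I_l_closed[OF u(2) frac_closed[OF one_closed S_mult[OF u(1) as(2)]]] by simp
qed

lemma (in ideal) finsum_mem:
  assumes "finite F" "\<And>f. f \<in> F \<Longrightarrow> u f \<in> I"
  shows "(\<Oplus>f\<in>F. u f) \<in> I"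
  using assms
proof (induction F)
  case (insert f F)
  then have "(\<Oplus>f\<in>insert f F. u f) = u f \<oplus> (\<Oplus>f\<in>F. u f)"
    using Icarr by (intro finsum_insert) auto
  then show ?case using insert a_closed by simp
qed (simp add: zero_closed)

context gabber_tower
begin

text \<open>The structure map by which stage i is an \<open>R\<close>-algebra; along it, W is
  inverted in \<open>A i\<close>.\<close>

primrec kappa :: "nat \<Rightarrow> 'a \<Rightarrow> 'a tower" where
  "kappa 0 r = Base r"
| "kappa (Suc i) r = c i (kappa i r)"

lemma kappa_hom: "kappa i \<in> ring_hom R (A i)"
proof (induction i)
  case 0
  have "kappa 0 = Base" by (rule ext) simp
  then show ?case using Base_hom by simp
next
  case (Suc i)
  have "kappa (Suc i) = c i \<circ> kappa i" by (rule ext) simp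
  then show ?case using ring_hom_trans[OF Suc c_hom] by (simp only:)
qed

lemma kappa_closed: "r \<in> carrier R \<Longrightarrow> kappa i r \<in> carrier (A i)"
  by (rule ring_hom_closed[OF kappa_hom])

lemma base_val_hom: "base_val \<in> ring_hom (A 0) R"
  by (rule ring_hom_memI)
    (auto simp: carrier_A_0 ring_hom_mult[OF Base_hom, symmetric] ring_hom_add[OF Base_hom, symmetric]
      ring_hom_one[OF Base_hom, symmetric] simp del: One_nat_def)

lemma G_0: "g \<in> carrier G \<Longrightarrow> g 0 = Base (gabber_proj g) \<and> gabber_proj g \<in> carrier R"
  using G_closed[of g 0] by (auto simp: carrier_A_0 gabber_proj_def)

text \<open>Repeated extraction of p-th powers descends to stage 0. Although an element of V need
  not be the image of an element of W at stage i, its p^i-th power is.\<close>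

lemma G_pow_kappa:
  assumes g: "g \<in> carrier G"
  shows "g i [^]\<^bsub>A i\<^esub> (p ^ i) = kappa i (gabber_proj g)"
proof (induction i)
  case 0
  then show ?case using G_0[OF g] G_closed[OF g, of 0] by simp
next
  case (Suc i)
  have gc: "g i \<in> carrier (A i)" for i using g by (rule G_closed)
  have "g (Suc i) [^]\<^bsub>A (Suc i)\<^esub> (p ^ Suc i) = (g (Suc i) [^]\<^bsub>A (Suc i)\<^esub> p) [^]\<^bsub>A (Suc i)\<^esub> (p ^ i)"
    using gc by (simp add: adj.nat_pow_pow)
  also have "\<dots> = c i (g i [^]\<^bsub>A i\<^esub> (p ^ i))"
    using gc by (simp add: G_pow_p[OF g] hom_nat_pow[OF adj.ring_axioms adj.ring_axioms c_hom])
  finally show ?case by (simp add: Suc)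
qed

end

locale gabber_localization = gabber_tower p R xs for p :: nat and R :: "('a, 'b) ring_scheme" (structure) and xs +
  fixes W :: "'a set"
  assumes W: "submonoid W R"
begin

sublocale loc: localize R W
  by (intro localize.intro localize_axioms.intro is_cring W)

abbreviation R' where "R' \<equiv> localization R W"
abbreviation h where "h \<equiv> loc_map R W"

sublocale T: gabber_tower p R' "map h xs"
proof (intro gabber_tower.intro gabber_tower_axioms.intro loc.cring_localization prime)
  show "[p] \<cdot>\<^bsub>R'\<^esub> \<one>\<^bsub>R'\<^esub> = \<zero>\<^bsub>R'\<^esub>"
    by (rule ring_hom_char[OF ring_axioms loc.L.ring_axioms loc.loc_map_hom char])
  show "set (map h xs) \<subseteq> carrier R'"
    using xs ring_hom_closed[OF loc.loc_map_hom] by auto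
qed

abbreviation M where "M \<equiv> gabber_stage_map p R xs R' h"

lemma M_0_hom: "M 0 \<in> ring_hom (A 0) (T.A 0)"
proof -
  have "M 0 = Base \<circ> (h \<circ> base_val)" by (simp add: fun_eq_iff)
  then show ?thesis
    using ring_hom_trans[OF ring_hom_trans[OF base_val_hom loc.loc_map_hom] T.Base_hom] by simp
qed

text \<open>Both claims are needed together: the lift to the next stage exists because the current
  map sends the roots to the corresponding roots.\<close>

lemma M_stage: "M i \<in> ring_hom (A i) (T.A i) \<and> (\<forall>j<n. M i (Y i ! j) = T.Y i ! j)"
proof (induction i)
  case 0
  have "M 0 (Y 0 ! j) = T.Y 0 ! j" if "j < n" for j
    using that by (simp add: gabber_gens_0)
  then show ?case using M_0_hom by blast
next
  case (Suc i)
  have hom: "(\<lambda>r. T.c i (M i r)) \<in> ring_hom (A i) (T.A (Suc i))"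
    using ring_hom_trans[OF conjunct1[OF Suc] T.c_hom] by (simp add: comp_def)
  have rel: "T.Y (Suc i) ! j [^]\<^bsub>T.A (Suc i)\<^esub> p = T.c i (M i (Y i ! j))" if "j < n" for j
    using that T.Y_pow[of j i] Suc by simp
  note lift = T.cring_A hom T.adj.ys _ rel
  have "M (Suc i) \<in> ring_hom (A (Suc i)) (T.A (Suc i))"
    unfolding gabber_stage_map.simps by (rule lift_hom[OF lift]) auto
  moreover have "M (Suc i) (Y (Suc i) ! j) = T.Y (Suc i) ! j" if "j < n" for j
    unfolding gabber_stage_map.simps by (rule lift_Y[OF lift]) (use that in auto)
  ultimately show ?case by blast
qed

lemma M_hom: "M i \<in> ring_hom (A i) (T.A i)"
  and M_Y: "j < n \<Longrightarrow> M i (Y i ! j) = T.Y i ! j"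
  using M_stage by auto

lemma M_closed: "a \<in> carrier (A i) \<Longrightarrow> M i a \<in> carrier (T.A i)"
  by (rule ring_hom_closed[OF M_hom])

lemma M_c:
  assumes "a \<in> carrier (A i)"
  shows "M (Suc i) (c i a) = T.c i (M i a)"
proof -
  have hom: "(\<lambda>r. T.c i (M i r)) \<in> ring_hom (A i) (T.A (Suc i))"
    using ring_hom_trans[OF M_hom T.c_hom] by (simp add: comp_def)
  have rel: "T.Y (Suc i) ! j [^]\<^bsub>T.A (Suc i)\<^esub> p = T.c i (M i (Y i ! j))" if "j < n" for j
    using that T.Y_pow[of j i] M_Y by simp
  show ?thesis
    unfolding gabber_stage_map.simps by (rule lift_c[OF T.cring_A hom T.adj.ys _ rel assms]) auto
qed

lemma M_phi:
  assumes "a \<in> carrier (A (Suc i))"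
  shows "T.\<phi> i (M (Suc i) a) = M i (\<phi> i a)"
proof (rule A_Suc_hom_eqI[OF _ _ _ _ assms, of "\<lambda>a. T.\<phi> i (M (Suc i) a)" "T.A i" "\<lambda>a. M i (\<phi> i a)"])
  show "(\<lambda>a. T.\<phi> i (M (Suc i) a)) \<in> ring_hom (A (Suc i)) (T.A i)"
    using ring_hom_trans[OF M_hom T.phi_hom] by (simp add: comp_def)
  show "(\<lambda>a. M i (\<phi> i a)) \<in> ring_hom (A (Suc i)) (T.A i)"
    using ring_hom_trans[OF phi_hom M_hom] by (simp add: comp_def)
next
  fix b assume b: "b \<in> carrier (A i)"
  show "T.\<phi> i (M (Suc i) (c i b)) = M i (\<phi> i (c i b))"
    using b M_closed[OF b]
    by (simp only: M_c T.phi_c phi_c hom_nat_pow[OF adj.ring_axioms T.adj.ring_axioms M_hom])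
next
  fix j assume "j < n"
  then show "T.\<phi> i (M (Suc i) (Y (Suc i) ! j)) = M i (\<phi> i (Y (Suc i) ! j))"
    using T.phi_Y[of j i] by (simp only: M_Y phi_Y length_map)
qed

lemma M_kappa: "r \<in> carrier R \<Longrightarrow> M i (kappa i r) = T.kappa i (h r)"
proof (induction i)
  case (Suc i)
  then show ?case
    using M_c[OF kappa_closed[OF Suc.prems]] by (simp only: kappa.simps T.kappa.simps)
qed simp

text \<open>\<open>M i\<close> has the factorization property of a localization at W. At stage 0 it
  is that of fractions; afterwards f composed with \<open>c\<close> factors by induction, hence the
  generality in f, and the universal property of adjoined roots extends the factor.\<close>

lemma M_factor:
  assumes "cring U" "f \<in> ring_hom (A i) U" "\<And>w. w \<in> W \<Longrightarrow> f (kappa i w) \<in> Units U"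
  shows "\<exists>k\<in>ring_hom (T.A i) U. \<forall>a\<in>carrier (A i). k (M i a) = f a"
  using assms(2,3)
proof (induction i arbitrary: f)
  case 0
  have fB: "(\<lambda>r. f (Base r)) \<in> ring_hom R U"
    using ring_hom_trans[OF Base_hom 0(1)] by (simp add: comp_def)
  have u: "f (Base w) \<in> Units U" if "w \<in> W" for w using 0(2)[OF that] by simp
  let ?k = "\<lambda>t. loc.loc_lift U (\<lambda>r. f (Base r)) (base_val t)"
  have k1: "?k \<in> ring_hom (T.A 0) U"
    using ring_hom_trans[OF T.base_val_hom loc.loc_lift_hom[OF assms(1) fB u]] by (simp add: comp_def)
  have k2: "?k (M 0 a) = f a" if a: "a \<in> carrier (A 0)" for a
  proof -
    obtain r where r: "r \<in> carrier R" "a = Base r" using a by (auto simp: carrier_A_0)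
    have "?k (M 0 a) = loc.loc_lift U (\<lambda>r. f (Base r)) (h r)"
      unfolding r(2) gabber_stage_map.simps base_val.simps ..
    also have "\<dots> = f (Base r)" by (rule loc.loc_lift_loc_map[OF assms(1) fB u r(1)])
    finally show ?thesis unfolding r(2) .
  qed
  show ?case
  proof (rule bexI[of _ ?k])
    show "\<forall>a\<in>carrier (A 0). ?k (M 0 a) = f a" by (rule ballI) (rule k2)
  qed (rule k1)
next
  case (Suc i)
  have fc: "(\<lambda>a. f (c i a)) \<in> ring_hom (A i) U"
    using ring_hom_trans[OF c_hom Suc.prems(1)] by (simp add: comp_def)
  obtain k where k: "k \<in> ring_hom (T.A i) U" "\<forall>a\<in>carrier (A i). k (M i a) = f (c i a)"
    using Suc.IH[OF fc] Suc.prems(2) by auto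
  interpret U: cring U by fact
  let ?zs = "map (\<lambda>j. f (Y (Suc i) ! j)) [0..<n]"
  have zs: "set ?zs \<subseteq> carrier U"
    using ring_hom_closed[OF Suc.prems(1) Y_closed] by auto
  have rel: "(?zs ! j) [^]\<^bsub>U\<^esub> p = k (T.Y i ! j)" if j: "j < length (map h xs)" for j
  proof -
    have j': "j < n" using j by simp
    have "(?zs ! j) [^]\<^bsub>U\<^esub> p = f (Y (Suc i) ! j [^]\<^bsub>A (Suc i)\<^esub> p)"
      using j' by (simp add: hom_nat_pow[OF adj.ring_axioms U.ring_axioms Suc.prems(1) Y_closed])
    also have "\<dots> = k (M i (Y i ! j))" using j' k(2) by (simp add: Y_pow Y_closed)
    finally show ?thesis using j' by (simp only: M_Y)
  qed
  note lift = assms(1) k(1) zs _ rel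
  let ?k = "adjoin_lift (T.A i) U k ?zs"
  have k': "?k \<in> ring_hom (T.A (Suc i)) U" by (rule T.lift_hom[OF lift]) auto
  have k2: "?k (M (Suc i) a) = f a" if a: "a \<in> carrier (A (Suc i))" for a
  proof (rule A_Suc_hom_eqI[OF _ Suc.prems(1) _ _ a, of "\<lambda>a. ?k (M (Suc i) a)"])
    show "(\<lambda>a. ?k (M (Suc i) a)) \<in> ring_hom (A (Suc i)) U"
      using ring_hom_trans[OF M_hom k'] by (simp add: comp_def)
  next
    fix b assume b: "b \<in> carrier (A i)"
    have "?k (T.c i (M i b)) = k (M i b)" by (rule T.lift_c[OF lift]) (use M_closed[OF b] in auto)
    then show "?k (M (Suc i) (c i b)) = f (c i b)" using b k(2) by (simp only: M_c)
  next
    fix j assume j: "j < n"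
    have "?k (T.Y (Suc i) ! j) = ?zs ! j" by (rule T.lift_Y[OF lift]) (use j in auto)
    then show "?k (M (Suc i) (Y (Suc i) ! j)) = f (Y (Suc i) ! j)"
      using j by (simp only: M_Y) simp
  qed
  show ?case
  proof (rule bexI[of _ ?k])
    show "\<forall>a\<in>carrier (A (Suc i)). ?k (M (Suc i) a) = f a" by (rule ballI) (rule k2)
  qed (rule k')
qed

lemma submonoid_kappa: "submonoid (kappa i ` W) (A i)"
proof (rule submonoid.intro)
  show "kappa i ` W \<subseteq> carrier (A i)" using loc.S_closed kappa_closed by auto
  show "\<one>\<^bsub>A i\<^esub> \<in> kappa i ` W"
    using loc.S_one ring_hom_one[OF kappa_hom] by (metis imageI)
  fix x y assume "x \<in> kappa i ` W" "y \<in> kappa i ` W"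
  then obtain w w' where "w \<in> W" "w' \<in> W" "x = kappa i w" "y = kappa i w'" by blast
  then show "x \<otimes>\<^bsub>A i\<^esub> y \<in> kappa i ` W"
    using loc.S_mult loc.S_closed ring_hom_mult[OF kappa_hom, of w w' i] by (metis imageI)
qed

text \<open>The localization map of \<open>A i\<close> at the image of W factors through
  \<open>M i\<close>, so an element killed by \<open>M i\<close> becomes zero in that
  localization.\<close>

lemma M_ker:
  assumes a: "a \<in> carrier (A i)" "M i a = \<zero>\<^bsub>T.A i\<^esub>"
  shows "\<exists>w\<in>W. kappa i w \<otimes>\<^bsub>A i\<^esub> a = \<zero>\<^bsub>A i\<^esub>"
proof -
  interpret l: localize "A i" "kappa i ` W"
    by (intro localize.intro localize_axioms.intro cring_A submonoid_kappa)
  obtain k where k: "k \<in> ring_hom (T.A i) l.L"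
    "\<forall>a\<in>carrier (A i). k (M i a) = loc_map (A i) (kappa i ` W) a"
    using M_factor[OF l.cring_localization l.loc_map_hom l.loc_map_unit] by blast
  have "loc_map (A i) (kappa i ` W) a = k \<zero>\<^bsub>T.A i\<^esub>" using bspec[OF k(2) a(1)] a(2) by simp
  also have "\<dots> = \<zero>\<^bsub>l.L\<^esub>" by (rule ring_hom_zero[OF k(1) T.adj.ring_axioms l.L.ring_axioms])
  finally show ?thesis using l.loc_map_eq_zero[OF a(1)] by auto
qed

text \<open>The roots over the localization are images of roots, so denominators arise only from
  constants and can be taken in W; a sum needs the product of two denominators.\<close>

lemma M_denom:
  assumes "a' \<in> carrier (T.A i)"
  shows "\<exists>a\<in>carrier (A i). \<exists>w\<in>W. M i a = T.kappa i (h w) \<otimes>\<^bsub>T.A i\<^esub> a'"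
  using assms
proof (induction i arbitrary: a')
  case 0
  then obtain r' where r': "r' \<in> carrier R'" "a' = Base r'" by (auto simp: T.carrier_A_0)
  obtain r w where rw: "r \<in> carrier R" "w \<in> W" "r' = frac R W r w" using r'(1) by (rule loc.frac_cases)
  have hw: "h w \<in> carrier R'" using ring_hom_closed[OF loc.loc_map_hom loc.S_closed[OF rw(2)]] .
  have "h w \<otimes>\<^bsub>R'\<^esub> r' = h r"
    using loc.frac_mult_loc_map[OF rw(1,2)] r'(1) hw rw(3) by (simp add: loc.L.m_comm)
  then have "M 0 (Base r) = T.kappa 0 (h w) \<otimes>\<^bsub>T.A 0\<^esub> a'"
    using ring_hom_mult[OF T.Base_hom hw r'(1)] r'(2) by simp
  then show ?case using rw by (auto simp: carrier_A_0)
next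
  case (Suc i)
  have kc: "T.kappa i (h w) \<in> carrier (T.A i)" if "w \<in> W" for w i
    using that by (intro T.kappa_closed ring_hom_closed[OF loc.loc_map_hom] loc.S_closed)
  from Suc.prems show ?case
  proof (induction rule: T.A_Suc_induct)
    case (const b)
    then obtain a w where aw: "a \<in> carrier (A i)" "w \<in> W" "M i a = T.kappa i (h w) \<otimes>\<^bsub>T.A i\<^esub> b"
      using Suc.IH by blast
    have "M (Suc i) (c i a) = T.kappa (Suc i) (h w) \<otimes>\<^bsub>T.A (Suc i)\<^esub> T.c i b"
      using M_c[OF aw(1)] ring_hom_mult[OF T.c_hom kc[OF aw(2)] const] aw(3) by simp
    then show ?case using aw c_closed by blast
  next
    case (add x y)
    then obtain a w b v where *: "a \<in> carrier (A (Suc i))" "w \<in> W"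
      "M (Suc i) a = T.kappa (Suc i) (h w) \<otimes>\<^bsub>T.A (Suc i)\<^esub> x"
      "b \<in> carrier (A (Suc i))" "v \<in> W" "M (Suc i) b = T.kappa (Suc i) (h v) \<otimes>\<^bsub>T.A (Suc i)\<^esub> y" by blast
    let ?B = "A (Suc i)" and ?T = "T.A (Suc i)"
    let ?k = "\<lambda>w. kappa (Suc i) w" and ?t = "\<lambda>w. T.kappa (Suc i) (h w)"
    have cl: "w \<in> carrier R" "v \<in> carrier R" using * loc.S_closed by auto
    have kcl: "?k w \<in> carrier ?B" "?k v \<in> carrier ?B" using cl kappa_closed by blast+
    note tcl = kc[OF *(2), of "Suc i"] kc[OF *(5), of "Suc i"]
    have "M (Suc i) (?k v \<otimes>\<^bsub>?B\<^esub> a \<oplus>\<^bsub>?B\<^esub> ?k w \<otimes>\<^bsub>?B\<^esub> b)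
        = ?t v \<otimes>\<^bsub>?T\<^esub> (?t w \<otimes>\<^bsub>?T\<^esub> x) \<oplus>\<^bsub>?T\<^esub> ?t w \<otimes>\<^bsub>?T\<^esub> (?t v \<otimes>\<^bsub>?T\<^esub> y)"
      using kcl *(1,4)
      by (simp only: ring_hom_add[OF M_hom] ring_hom_mult[OF M_hom] adj.m_closed M_kappa cl *(3,6))
    also have "\<dots> = (?t w \<otimes>\<^bsub>?T\<^esub> ?t v) \<otimes>\<^bsub>?T\<^esub> (x \<oplus>\<^bsub>?T\<^esub> y)"
      using tcl add(1,2) by (simp only: T.adj.r_distr T.adj.m_ac T.adj.m_closed)
    also have "?t w \<otimes>\<^bsub>?T\<^esub> ?t v = ?t (w \<otimes> v)"
      using cl ring_hom_closed[OF loc.loc_map_hom]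
      by (simp only: ring_hom_mult[OF T.kappa_hom] ring_hom_mult[OF loc.loc_map_hom])
    finally show ?case
      using kcl *(1,2,4,5) loc.S_mult
      by (intro bexI[of _ "?k v \<otimes>\<^bsub>?B\<^esub> a \<oplus>\<^bsub>?B\<^esub> ?k w \<otimes>\<^bsub>?B\<^esub> b"] bexI[of _ "w \<otimes> v"]) blast+
  next
    case (var x j)
    then obtain a w where *: "a \<in> carrier (A (Suc i))" "w \<in> W"
      "M (Suc i) a = T.kappa (Suc i) (h w) \<otimes>\<^bsub>T.A (Suc i)\<^esub> x" by blast
    have j: "j < n" using var(2) by simp
    have "M (Suc i) (a \<otimes>\<^bsub>A (Suc i)\<^esub> Y (Suc i) ! j)
        = T.kappa (Suc i) (h w) \<otimes>\<^bsub>T.A (Suc i)\<^esub> (x \<otimes>\<^bsub>T.A (Suc i)\<^esub> T.Y (Suc i) ! j)"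
      using *(1) Y_closed[OF j] kc[OF *(2), of "Suc i"] var(1) T.Y_closed[OF var(2)]
      by (simp only: ring_hom_mult[OF M_hom] M_Y[OF j] *(3) T.adj.m_assoc)
    then show ?case using *(1,2) Y_closed[OF j] adj.m_closed by blast
  qed
qed

end

section \<open>Comparison with the completed localization of \<open>G\<close>\<close>

locale gabber_comparison = gabber_localization p R xs W
  for p :: nat and R :: "('a, 'b) ring_scheme" (structure) and xs W +
  fixes V :: "(nat \<Rightarrow> 'a tower) set"
  assumes V: "submonoid V (gabber p R xs)" and VW: "gabber_proj ` V = W"
    and gen: "p_generating p R xs" and noeth: "noetherian_ring R"
begin

sublocale v: localize G V
  by (intro localize.intro localize_axioms.intro G.is_cring V)

abbreviation L where "L \<equiv> localization G V"
abbreviation Jinf where "Jinf \<equiv> a_kernel G R gabber_proj"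
abbreviation I where "I \<equiv> loc_ideal G V Jinf"
abbreviation \<mu> where "\<mu> i g \<equiv> M i (g i)"

definition \<theta> :: "nat \<Rightarrow> ((nat \<Rightarrow> 'a tower) \<times> (nat \<Rightarrow> 'a tower)) set \<Rightarrow> ('a \<times> 'a) set tower" where
  "\<theta> i = v.loc_lift (T.A i) (\<mu> i)"

lemma mu_hom: "\<mu> i \<in> ring_hom G (T.A i)"
  using ring_hom_trans[OF G_proj M_hom] by (simp only: comp_def)

lemma mu_pow:
  assumes "g \<in> carrier G"
  shows "\<mu> i (g [^]\<^bsub>G\<^esub> (p ^ i)) = T.kappa i (h (gabber_proj g))"
  using M_kappa G_0[OF assms] by (simp only: G_pow[OF assms] G_pow_kappa[OF assms])

lemma kappa_unit: "w \<in> W \<Longrightarrow> T.kappa i (h w) \<in> Units (T.A i)"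
  by (rule hom_Units[OF loc.cring_localization T.cring_A T.kappa_hom loc.loc_map_unit])

text \<open>The p^i-th power of the image comes from an element of W and is therefore a unit; a
  factor of a unit is a unit.\<close>

lemma mu_unit:
  assumes "g \<in> V"
  shows "\<mu> i g \<in> Units (T.A i)"
proof -
  have g: "g \<in> carrier G" by (rule v.S_closed[OF assms])
  have mc: "\<mu> i g \<in> carrier (T.A i)" by (rule ring_hom_closed[OF mu_hom g])
  have "p ^ i = Suc (p ^ i - 1)" using prime_ge_1_nat[OF prime] by simp
  then have "\<mu> i g [^]\<^bsub>T.A i\<^esub> (p ^ i - 1) \<otimes>\<^bsub>T.A i\<^esub> \<mu> i g = \<mu> i g [^]\<^bsub>T.A i\<^esub> (p ^ i)"
    by (metis monoid.nat_pow_Suc T.adj.monoid_axioms)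
  also have "\<dots> = \<mu> i (g [^]\<^bsub>G\<^esub> (p ^ i))"
    by (rule hom_nat_pow[OF G.ring_axioms T.adj.ring_axioms mu_hom g, symmetric])
  also have "\<dots> = T.kappa i (h (gabber_proj g))" by (rule mu_pow[OF g])
  also have "\<dots> \<in> Units (T.A i)" using assms VW by (intro kappa_unit) blast
  finally have "\<mu> i g \<otimes>\<^bsub>T.A i\<^esub> \<mu> i g [^]\<^bsub>T.A i\<^esub> (p ^ i - 1) \<in> Units (T.A i)"
    using mc T.adj.nat_pow_closed[OF mc] by (simp only: T.adj.m_comm)
  then show ?thesis by (rule T.adj.Units_of_mult[OF mc T.adj.nat_pow_closed[OF mc]])
qed

lemma theta_hom: "\<theta> i \<in> ring_hom L (T.A i)"
  unfolding \<theta>_def by (rule v.loc_lift_hom[OF T.cring_A mu_hom mu_unit])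

lemma theta_loc_map: "g \<in> carrier G \<Longrightarrow> \<theta> i (loc_map G V g) = \<mu> i g"
  unfolding \<theta>_def by (rule v.loc_lift_loc_map[OF T.cring_A mu_hom mu_unit])

lemma theta_frac:
  assumes "g \<in> carrier G" "s \<in> V"
  shows "\<theta> i (frac G V g s) \<otimes>\<^bsub>T.A i\<^esub> \<mu> i s = \<mu> i g"
proof -
  have "\<theta> i (frac G V g s) \<otimes>\<^bsub>T.A i\<^esub> \<theta> i (loc_map G V s) = \<theta> i (frac G V g s \<otimes>\<^bsub>L\<^esub> loc_map G V s)"
    by (rule ring_hom_mult[OF theta_hom v.frac_closed[OF assms]
          ring_hom_closed[OF v.loc_map_hom v.S_closed[OF assms(2)]], symmetric])
  then show ?thesis
    using assms by (simp only: v.frac_mult_loc_map theta_loc_map v.S_closed)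
qed

lemma theta_compat:
  assumes "x \<in> carrier L"
  shows "T.\<phi> i (\<theta> (Suc i) x) = \<theta> i x"
proof (rule v.loc_hom_eqI[OF T.cring_A _ theta_hom _ assms, of "\<lambda>x. T.\<phi> i (\<theta> (Suc i) x)"])
  show "(\<lambda>x. T.\<phi> i (\<theta> (Suc i) x)) \<in> ring_hom L (T.A i)"
    using ring_hom_trans[OF theta_hom T.phi_hom] by (simp only: comp_def)
  fix g assume g: "g \<in> carrier G"
  show "T.\<phi> i (\<theta> (Suc i) (loc_map G V g)) = \<theta> i (loc_map G V g)"
    by (simp only: theta_loc_map[OF g] M_phi[OF G_closed[OF g]] G_phi[OF g])
qed

text \<open>The target element is a/w with w in W. If g lifts a and s in V lies over w, then
  g/s^(p^i) is a preimage: at stage i it is s^(p^i), rather than s, that maps to w.\<close>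

lemma theta_surj:
  assumes a': "a' \<in> carrier (T.A i)"
  shows "\<exists>x\<in>carrier L. \<theta> i x = a'"
proof -
  obtain a w where aw: "a \<in> carrier (A i)" "w \<in> W" "M i a = T.kappa i (h w) \<otimes>\<^bsub>T.A i\<^esub> a'"
    using M_denom[OF a'] by blast
  obtain g where g: "g \<in> carrier G" "g i = a" using G_proj_surj[OF gen aw(1)] by blast
  obtain s where s: "s \<in> V" "gabber_proj s = w" using aw(2) VW by blast
  have sc: "s \<in> carrier G" by (rule v.S_closed[OF s(1)])
  let ?s = "s [^]\<^bsub>G\<^esub> (p ^ i)"
  have sV: "?s \<in> V" by (rule v.S_pow[OF s(1)])
  let ?x = "frac G V g ?s"
  have u: "\<mu> i ?s = T.kappa i (h w)" using mu_pow[OF sc] s(2) by simp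
  have xc: "\<theta> i ?x \<in> carrier (T.A i)" by (rule ring_hom_closed[OF theta_hom v.frac_closed[OF g(1) sV]])
  have kU: "T.kappa i (h w) \<in> Units (T.A i)" by (rule kappa_unit[OF aw(2)])
  have kc: "T.kappa i (h w) \<in> carrier (T.A i)" using kU by (rule T.adj.Units_closed)
  have "\<theta> i ?x \<otimes>\<^bsub>T.A i\<^esub> T.kappa i (h w) = T.kappa i (h w) \<otimes>\<^bsub>T.A i\<^esub> a'"
    using theta_frac[OF g(1) sV, of i] unfolding u g(2) aw(3) .
  then have "T.kappa i (h w) \<otimes>\<^bsub>T.A i\<^esub> \<theta> i ?x = T.kappa i (h w) \<otimes>\<^bsub>T.A i\<^esub> a'"
    using T.adj.m_comm[OF xc kc] by (simp only:)
  then have "\<theta> i ?x = a'" using T.adj.Units_l_cancel[OF kU xc a'] by (simp only:)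
  then show ?thesis using v.frac_closed[OF g(1) sV] by blast
qed

lemma Jinf_eq: "Jinf = {g \<in> carrier G. g 0 = \<zero>\<^bsub>A 0\<^esub>}"
proof -
  have eq: "gabber_proj g = \<zero> \<longleftrightarrow> g 0 = \<zero>\<^bsub>A 0\<^esub>" if "g \<in> carrier G" for g
    using G_0[OF that] ring_hom_zero[OF Base_hom ring_axioms adj.ring_axioms] by (metis tower.inject(1))
  show ?thesis unfolding a_kernel_def' by (intro Collect_cong conj_cong refl) (rule eq)
qed

lemma Jinf_ideal: "ideal Jinf G"
  unfolding Jinf_eq by (rule G.ideal_kernel[OF adj.ring_axioms G_proj])

lemma I_ideal: "ideal I L"
  by (rule v.loc_ideal_ideal[OF Jinf_ideal])

lemma loc_map_Jinf: "g \<in> Jinf \<Longrightarrow> loc_map G V g \<in> I"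
  unfolding loc_ideal_def loc_map_def using v.S_one by blast

lemma loc_map_comb:
  assumes F: "finite F" "F \<subseteq> carrier G" and \<beta>: "\<beta> \<in> F \<rightarrow> carrier G" and K: "ideal K L"
    and mem: "\<And>f. f \<in> F \<Longrightarrow> loc_map G V f [^]\<^bsub>L\<^esub> (k::nat) \<in> K"
  shows "loc_map G V (\<Oplus>\<^bsub>G\<^esub>f\<in>F. \<beta> f \<otimes>\<^bsub>G\<^esub> f [^]\<^bsub>G\<^esub> k) \<in> K"
proof -
  interpret P: ideal "{x \<in> carrier G. loc_map G V x \<in> K}" G
    by (rule G.ideal_vimage_cring[OF v.cring_localization v.loc_map_hom K])
  have "(\<Oplus>\<^bsub>G\<^esub>f\<in>F. \<beta> f \<otimes>\<^bsub>G\<^esub> f [^]\<^bsub>G\<^esub> k) \<in> {x \<in> carrier G. loc_map G V x \<in> K}"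
  proof (rule P.finsum_mem[OF F(1)])
    fix f assume f: "f \<in> F"
    then have fc: "f \<in> carrier G" using F(2) by blast
    have eq: "loc_map G V (f [^]\<^bsub>G\<^esub> k) = loc_map G V f [^]\<^bsub>L\<^esub> k"
      by (rule hom_nat_pow[OF G.ring_axioms v.L.ring_axioms v.loc_map_hom fc])
    have "loc_map G V (f [^]\<^bsub>G\<^esub> k) \<in> K" unfolding eq by (rule mem[OF f])
    then have "f [^]\<^bsub>G\<^esub> k \<in> {x \<in> carrier G. loc_map G V x \<in> K}"
      by (intro CollectI conjI G.nat_pow_closed[OF fc])
    then show "\<beta> f \<otimes>\<^bsub>G\<^esub> f [^]\<^bsub>G\<^esub> k \<in> {x \<in> carrier G. loc_map G V x \<in> K}"
      by (rule P.I_l_closed[OF _ funcset_mem[OF \<beta> f]])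
  qed
  then show ?thesis by (elim CollectE conjE)
qed

text \<open>If g/s maps to zero, some w in W kills g_i, so t^(p^i) g lies in J_i for t in V over w.
  It is then a combination of p^i-th powers of elements of J, and p^i \<ge> i places its image in
  I^i.\<close>

lemma theta_ker:
  assumes x: "x \<in> carrier L" "\<theta> i x = \<zero>\<^bsub>T.A i\<^esub>"
  shows "x \<in> v.L.ipow I i"
proof -
  obtain F where F: "finite F" "F \<subseteq> {g \<in> carrier G. g 0 = \<zero>\<^bsub>A 0\<^esub>}"
    "\<forall>i g. g \<in> carrier G \<longrightarrow> g i = \<zero>\<^bsub>A i\<^esub> \<longrightarrow>
      (\<exists>\<beta>\<in>F \<rightarrow> carrier G. g = (\<Oplus>\<^bsub>G\<^esub>f\<in>F. \<beta> f \<otimes>\<^bsub>G\<^esub> f [^]\<^bsub>G\<^esub> (p ^ i)))"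
    using kernel_generators[OF gen noeth] by (elim exE conjE)
  have Fc: "F \<subseteq> carrier G" using F(2) by blast
  obtain g s where gs: "g \<in> carrier G" "s \<in> V" "x = frac G V g s" using x(1) by (rule v.frac_cases)
  have "\<mu> i g = \<theta> i x \<otimes>\<^bsub>T.A i\<^esub> \<mu> i s" unfolding gs(3) by (rule theta_frac[OF gs(1,2), symmetric])
  also have "\<dots> = \<zero>\<^bsub>T.A i\<^esub>"
    unfolding x(2) by (rule T.adj.l_null[OF ring_hom_closed[OF mu_hom v.S_closed[OF gs(2)]]])
  finally obtain w where w: "w \<in> W" "kappa i w \<otimes>\<^bsub>A i\<^esub> g i = \<zero>\<^bsub>A i\<^esub>"
    using M_ker[OF G_closed[OF gs(1)]] by blast
  obtain t where t: "t \<in> V" "gabber_proj t = w" using w(1) VW by blast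
  have tc: "t \<in> carrier G" by (rule v.S_closed[OF t(1)])
  let ?u = "t [^]\<^bsub>G\<^esub> (p ^ i)"
  have uV: "?u \<in> V" by (rule v.S_pow[OF t(1)])
  have "(?u \<otimes>\<^bsub>G\<^esub> g) i = \<zero>\<^bsub>A i\<^esub>"
    using w(2) t(2) by (simp only: G_simps G_pow[OF tc] G_pow_kappa[OF tc])
  moreover have "?u \<otimes>\<^bsub>G\<^esub> g \<in> carrier G" using tc gs(1) by simp
  ultimately obtain \<beta> where \<beta>: "\<beta> \<in> F \<rightarrow> carrier G"
    "?u \<otimes>\<^bsub>G\<^esub> g = (\<Oplus>\<^bsub>G\<^esub>f\<in>F. \<beta> f \<otimes>\<^bsub>G\<^esub> f [^]\<^bsub>G\<^esub> (p ^ i))"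
    using F(3) by blast
  have "loc_map G V f [^]\<^bsub>L\<^esub> (p ^ i) \<in> v.L.ipow I i" if "f \<in> F" for f
  proof -
    have "loc_map G V f \<in> I" using that F(2) by (intro loc_map_Jinf) (auto simp only: Jinf_eq)
    then have "loc_map G V f [^]\<^bsub>L\<^esub> (p ^ i) \<in> v.L.ipow I (p ^ i)" by (rule v.L.pow_mem_ipow[OF I_ideal])
    moreover have "i \<le> p ^ i" using prime_gt_1_nat[OF prime] by (simp add: less_imp_le power_gt_expt)
    ultimately show ?thesis using v.L.ipow_antimono[OF I_ideal] by blast
  qed
  then have "loc_map G V (?u \<otimes>\<^bsub>G\<^esub> g) \<in> v.L.ipow I i"
    unfolding \<beta>(2) by (rule loc_map_comb[OF F(1) Fc \<beta>(1) v.L.ipow_ideal[OF I_ideal]])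
  then show ?thesis
    unfolding gs(3) by (rule v.frac_mem_ideal[OF v.L.ipow_ideal[OF I_ideal] gs(1,2) uV])
qed

text \<open>The p^i-th powers of the generators of I vanish under \<open>\<theta> i\<close>, because
  coordinate i of an element of J has vanishing p^i-th power. As there are finitely many generators,
  some power of I vanishes too.\<close>

lemma theta_ipow: "\<exists>m. \<forall>x\<in>v.L.ipow I m. \<theta> i x = \<zero>\<^bsub>T.A i\<^esub>"
proof -
  obtain F where F: "finite F" "F \<subseteq> {g \<in> carrier G. g 0 = \<zero>\<^bsub>A 0\<^esub>}"
    "\<forall>i g. g \<in> carrier G \<longrightarrow> g i = \<zero>\<^bsub>A i\<^esub> \<longrightarrow>
      (\<exists>\<beta>\<in>F \<rightarrow> carrier G. g = (\<Oplus>\<^bsub>G\<^esub>f\<in>F. \<beta> f \<otimes>\<^bsub>G\<^esub> f [^]\<^bsub>G\<^esub> (p ^ i)))"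
    using kernel_generators[OF gen noeth] by (elim exE conjE)
  have Fc: "F \<subseteq> carrier G" using F(2) by blast
  let ?F = "loc_map G V ` F" and ?K = "{x \<in> carrier L. \<theta> i x = \<zero>\<^bsub>T.A i\<^esub>}"
  have lc: "loc_map G V g \<in> carrier L" if "g \<in> carrier G" for g
    using that by (rule ring_hom_closed[OF v.loc_map_hom])
  have Fl: "?F \<subseteq> carrier L" using Fc lc by blast
  have K: "ideal ?K L" by (rule v.L.ideal_kernel[OF T.adj.ring_axioms theta_hom])
  have Fi: "ideal (Idl\<^bsub>L\<^esub> ?F) L" by (rule v.L.genideal_ideal[OF Fl])
  have "e [^]\<^bsub>L\<^esub> (p ^ i) \<in> ?K" if e: "e \<in> ?F" for e
  proof -
    obtain f where f: "f \<in> F" "e = loc_map G V f" using e by blast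
    have fc: "f \<in> carrier G" "f 0 = \<zero>\<^bsub>A 0\<^esub>" using f(1) F(2) by auto
    have "\<theta> i (e [^]\<^bsub>L\<^esub> (p ^ i)) = \<mu> i f [^]\<^bsub>T.A i\<^esub> (p ^ i)"
      unfolding f(2) hom_nat_pow[OF v.L.ring_axioms T.adj.ring_axioms theta_hom lc[OF fc(1)]]
        theta_loc_map[OF fc(1)] ..
    also have "\<dots> = M i (f i [^]\<^bsub>A i\<^esub> (p ^ i))"
      by (rule hom_nat_pow[OF adj.ring_axioms T.adj.ring_axioms M_hom G_closed[OF fc(1)], symmetric])
    also have "\<dots> = M i \<zero>\<^bsub>A i\<^esub>" unfolding G_nilpotent[OF fc order_refl] ..
    also have "\<dots> = \<zero>\<^bsub>T.A i\<^esub>" by (rule ring_hom_zero[OF M_hom adj.ring_axioms T.adj.ring_axioms])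
    finally show ?thesis
      unfolding f(2) by (intro CollectI conjI v.L.nat_pow_closed[OF lc[OF fc(1)]])
  qed
  then obtain m where m: "v.L.ipow (Idl\<^bsub>L\<^esub> ?F) m \<subseteq> ?K"
    using v.L.ipow_Idl_finite[OF finite_imageI[OF F(1)] Fl K] by blast
  have "I \<subseteq> Idl\<^bsub>L\<^esub> ?F"
  proof
    fix x assume "x \<in> I"
    then obtain j s where js: "j \<in> Jinf" "s \<in> V" "x = frac G V j s" unfolding loc_ideal_def by blast
    have j: "j \<in> carrier G" "j 0 = \<zero>\<^bsub>A 0\<^esub>" using js(1) unfolding Jinf_eq by auto
    \<comment> \<open>The case i = 0 of the description of the kernels: the exponent is p^0 = 1, so
      F itself generates J.\<close>
    then obtain \<beta> where \<beta>: "\<beta> \<in> F \<rightarrow> carrier G" "j = (\<Oplus>\<^bsub>G\<^esub>f\<in>F. \<beta> f \<otimes>\<^bsub>G\<^esub> f [^]\<^bsub>G\<^esub> (p ^ 0))"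
      using F(3) by blast
    have "loc_map G V f [^]\<^bsub>L\<^esub> (p ^ 0) \<in> Idl\<^bsub>L\<^esub> ?F" if "f \<in> F" for f
    proof -
      have "loc_map G V f \<in> Idl\<^bsub>L\<^esub> ?F" using v.L.genideal_self[OF Fl] that by blast
      moreover have "loc_map G V f [^]\<^bsub>L\<^esub> (p ^ 0) = loc_map G V f"
        using lc[of f] that Fc by (simp add: subset_iff)
      ultimately show ?thesis by (simp only:)
    qed
    then have "loc_map G V j \<in> Idl\<^bsub>L\<^esub> ?F"
      by (subst \<beta>(2)) (rule loc_map_comb[OF F(1) Fc \<beta>(1) Fi])
    then have "loc_map G V (\<one>\<^bsub>G\<^esub> \<otimes>\<^bsub>G\<^esub> j) \<in> Idl\<^bsub>L\<^esub> ?F" using j(1) by (simp only: G.l_one)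
    then show "x \<in> Idl\<^bsub>L\<^esub> ?F" unfolding js(3) by (rule v.frac_mem_ideal[OF Fi j(1) js(2) v.S_one])
  qed
  then have "v.L.ipow I m \<subseteq> v.L.ipow (Idl\<^bsub>L\<^esub> ?F) m" by (rule v.L.ipow_mono[OF _ I_ideal Fi])
  then show ?thesis using m by blast
qed

text \<open>The maps \<open>\<theta> i\<close> meet the abstract criterion, with the exponents m i
  chosen from \<open>theta_ipow\<close>. Compatibility with \<open>gabber_map\<close> holds
  coordinatewise because \<open>\<theta> i\<close> extends \<open>\<mu> i\<close>.\<close>

lemma exists_canonical_iso: "\<exists>\<Psi>. canonical_gabber_iso p R xs W V \<Psi>"
proof -
  have "\<forall>i. \<exists>m. \<forall>x\<in>v.L.ipow I m. \<theta> i x = \<zero>\<^bsub>T.A i\<^esub>" using theta_ipow by (rule allI)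
  then obtain m where m: "\<forall>i. \<forall>x\<in>v.L.ipow I (m i). \<theta> i x = \<zero>\<^bsub>T.A i\<^esub>" by (rule choice[THEN exE])
  interpret C: adic_comparison L I T.A T.\<phi> \<theta> m
  proof (intro adic_comparison.intro adic_comparison_axioms.intro v.cring_localization
      T.lim.inverse_system_axioms I_ideal theta_hom theta_compat theta_surj theta_ker)
    fix x i assume "x \<in> v.L.ipow I (m i)"
    then show "\<theta> i x = \<zero>\<^bsub>T.A i\<^esub>" using m by blast
  qed
  have map: "C.comparison (completion_map L I (loc_map G V g)) = gabber_map p R xs R' h g"
    if g: "g \<in> carrier G" for g
  proof -
    have "C.comparison (completion_map L I (loc_map G V g)) = (\<lambda>i. \<theta> i (loc_map G V g))"
      by (rule C.comparison_completion_map(2)[OF ring_hom_closed[OF v.loc_map_hom g]])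
    then show ?thesis unfolding gabber_map_def theta_loc_map[OF g] .
  qed
  have cont: "\<exists>m. \<forall>a\<in>carrier (completion L I). a m = \<zero>\<^bsub>L Quot (v.L.ipow I m)\<^esub> \<longrightarrow>
      C.comparison a i = \<zero>\<^bsub>T.A i\<^esub>" for i
    using C.comparison_zero by blast
  show ?thesis
    unfolding canonical_gabber_iso_def Let_def
  proof (intro exI[of _ C.comparison] conjI ballI allI)
    show "C.comparison \<in> ring_iso (completion L I) (gabber p R' (map h xs))"
      by (rule C.comparison_iso[folded gabber_def])
  qed (erule map, rule cont)
qed

end

theorem corollary3p2p5:
  fixes p :: nat
    and R :: "('a, 'b) ring_scheme"
    and xs :: "'a list"
    and W :: "'a set"
    and V :: "(nat \<Rightarrow> 'a tower) set"
  assumes "Factorial_Ring.prime p"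
    and "cring R"
    and "[p] \<cdot>\<^bsub>R\<^esub> \<one>\<^bsub>R\<^esub> = \<zero>\<^bsub>R\<^esub>"
    and "noetherian_ring R"
    and "F_finite p R"
    and "p_generating p R xs"
    and "submonoid W R"
    and "submonoid V (gabber p R xs)"
    and "gabber_proj ` V = W"
  shows "\<exists>\<Psi>. canonical_gabber_iso p R xs W V \<Psi>"
proof -
  \<comment> \<open>\<open>p_generating\<close> is unfolded since it also contains the fact that
    \<open>xs\<close> lies in the carrier, on which the tower depends.\<close>
  interpret gabber_comparison p R xs W V
    using assms
    by (intro gabber_comparison.intro gabber_comparison_axioms.intro gabber_localization.intro
        gabber_localization_axioms.intro gabber_tower.intro gabber_tower_axioms.intro)
      (simp_all add: p_generating_def)
  show ?thesis by (rule exists_canonical_iso)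
qed

end
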